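(* Let $(R,\mathfrak m)$ be a Cohen-Macaulay local ring of dimension $d>0$ with infinite residue field, $I$ an $\mathfrak m$-primary ideal, $J$ a minimal reduction of $I$, and $K$ an ideal containing $I$. Write $g_1=g_1(K)$ for the coefficient $g_1$ of the polynomial associated with $\lambda(R/KI^n)$. (i) If $I$ has minimal multiplicity with respect to $K$, then $g_1(K)=-\lambda(R/K)$. (ii) If $KI\cap J=KJ$ and $g_1(K)=-\lambda(R/K)$, then $I$ has minimal multiplicity with respect to $K$. (iii) The ideal $I$ has minimal multiplicity if and only if $g_1(\mathfrak m)=-1$.
   Context: Conventions: $\lambda$ denotes length, $\mu(I)$ the minimal number of generators of $I$, and $e_0(I)$ the multiplicity of $I$. For $K\supseteq I$, the function $\lambda(R/KI^n)$ agrees for $n\gg0$ with a polynomial of degree $d$ in $n$, written $\sum_{i=0}^d(-1)^ig_i\binom{n+d-i-1}{d-i}$; $g_1(K)$ denotes the coefficient $g_1$. $I$ is said to have minimal multiplicity if $e_0(I)+d-\lambda(R/I)=\mu(I)$; equivalently, $I\mathfrak m=J\mathfrak m$ for any minimal reduction $J$ of $I$. $I$ is said to have minimal multiplicity with respect to $K$ if $KI=KJ$ for any minimal reduction $J$ of $I$. *)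

theory Defs
  imports "HOL-Algebra.Algebra" "HOL-Library.Extended_Nat" Complex_Main
begin

section \<open>Local rings, dimension, depth\<close>

locale noetherian_local_ring = cring R + noetherian_ring R for R (structure) and \<mm> +
  assumes max_ideal: "maximalideal \<mm> R"
    and max_ideal_unique: "\<And>M. maximalideal M R \<Longrightarrow> M = \<mm>"

definition krull_dim :: "('a, 'b) ring_scheme \<Rightarrow> enat" where
  "krull_dim R = Sup {enat n | n (P :: nat \<Rightarrow> 'a set).
      (\<forall>i\<le>n. primeideal (P i) R) \<and> (\<forall>i<n. P i \<subset> P (Suc i))}"

text \<open>The middle conjunct says that \<open>xs ! i\<close> is a nonzerodivisor on
  \<open>R / (xs ! 0, \<dots>, xs ! (i - 1))\<close>.\<close>

definition regular_sequence :: "('a, 'b) ring_scheme \<Rightarrow> 'a list \<Rightarrow> bool" where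
  "regular_sequence R xs \<longleftrightarrow>
     set xs \<subseteq> carrier R \<and>
     (\<forall>i<length xs. \<forall>a\<in>carrier R.
        (xs ! i) \<otimes>\<^bsub>R\<^esub> a \<in> Idl\<^bsub>R\<^esub> (set (take i xs)) \<longrightarrow> a \<in> Idl\<^bsub>R\<^esub> (set (take i xs))) \<and>
     Idl\<^bsub>R\<^esub> (set xs) \<noteq> carrier R"

definition depth :: "('a, 'b) ring_scheme \<Rightarrow> 'a set \<Rightarrow> enat" where
  "depth R \<mm> = Sup {enat (length xs) | xs. regular_sequence R xs \<and> set xs \<subseteq> \<mm>}"

definition cohen_macaulay_local :: "('a, 'b) ring_scheme \<Rightarrow> 'a set \<Rightarrow> bool" where
  "cohen_macaulay_local R \<mm> \<longleftrightarrow> noetherian_local_ring R \<mm> \<and> depth R \<mm> = krull_dim R"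


section \<open>Ideals\<close>

definition radical :: "('a, 'b) ring_scheme \<Rightarrow> 'a set \<Rightarrow> 'a set" where
  "radical R I = {a \<in> carrier R. \<exists>n::nat. a [^]\<^bsub>R\<^esub> n \<in> I}"

definition primary_ideal :: "('a, 'b) ring_scheme \<Rightarrow> 'a set \<Rightarrow> bool" where
  "primary_ideal R I \<longleftrightarrow> ideal I R \<and> I \<noteq> carrier R \<and>
     (\<forall>a\<in>carrier R. \<forall>b\<in>carrier R. a \<otimes>\<^bsub>R\<^esub> b \<in> I \<longrightarrow> a \<in> I \<or> b \<in> radical R I)"

definition primary_to :: "('a, 'b) ring_scheme \<Rightarrow> 'a set \<Rightarrow> 'a set \<Rightarrow> bool" where
  "primary_to R P I \<longleftrightarrow> primary_ideal R I \<and> radical R I = P"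

abbreviation ideal_pow :: "('a, 'b) ring_scheme \<Rightarrow> 'a set \<Rightarrow> nat \<Rightarrow> 'a set" where
  "ideal_pow R I n \<equiv> I [^]\<^bsub>ideals_set R\<^esub> n"

definition min_gens :: "('a, 'b) ring_scheme \<Rightarrow> 'a set \<Rightarrow> nat" where
  "min_gens R I = (LEAST n. \<exists>S \<subseteq> carrier R. finite S \<and> card S = n \<and> I = Idl\<^bsub>R\<^esub> S)"

definition reduction :: "('a, 'b) ring_scheme \<Rightarrow> 'a set \<Rightarrow> 'a set \<Rightarrow> bool" where
  "reduction R J I \<longleftrightarrow> ideal J R \<and> J \<subseteq> I \<and>
     (\<exists>n. ideal_pow R I (Suc n) = J \<cdot>\<^bsub>R\<^esub> ideal_pow R I n)"

definition minimal_reduction :: "('a, 'b) ring_scheme \<Rightarrow> 'a set \<Rightarrow> 'a set \<Rightarrow> bool" where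
  "minimal_reduction R J I \<longleftrightarrow> reduction R J I \<and>
     (\<forall>J'. reduction R J' I \<and> J' \<subseteq> J \<longrightarrow> J' = J)"


section \<open>Length\<close>

definition module_length ::
    "('r, 'x) ring_scheme \<Rightarrow> ('r, 'a, 'b) module_scheme \<Rightarrow> enat" where
  "module_length R M = Sup {enat n | n (N :: nat \<Rightarrow> 'a set).
      (\<forall>i\<le>n. submodule (N i) R M) \<and> (\<forall>i<n. N i \<subset> N (Suc i))}"

definition quot_module :: "('a, 'b) ring_scheme \<Rightarrow> 'a set \<Rightarrow> ('a, 'a set) module" where
  "quot_module R I =
     ring.extend (R Quot I) (module.fields (\<lambda>r C. (I +>\<^bsub>R\<^esub> r) \<otimes>\<^bsub>R Quot I\<^esub> C))"

lemma quot_module_is_module: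
  assumes "cring R" "ideal I R"
  shows "module R (quot_module R I)"
proof -
  interpret R: cring R by fact
  interpret I: ideal I R by fact
  interpret Q: cring "R Quot I"
    using I.quotient_is_cring assms(1) by blast
  interpret h: ring_hom_ring R "R Quot I" "(+>\<^bsub>R\<^esub>) I"
    by (rule I.rcos_ring_hom_ring)
  have sel: "carrier (quot_module R I) = carrier (R Quot I)"
    "ring.add (quot_module R I) = ring.add (R Quot I)"
    "\<zero>\<^bsub>quot_module R I\<^esub> = \<zero>\<^bsub>R Quot I\<^esub>"
    "\<And>r C. r \<odot>\<^bsub>quot_module R I\<^esub> C = (I +>\<^bsub>R\<^esub> r) \<otimes>\<^bsub>R Quot I\<^esub> C"
    by (simp_all add: quot_module_def ring.defs module.defs)
  have "abelian_group (quot_module R I)"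
    by (rule abelian_groupI)
      (auto simp: sel Q.a_ac intro: Q.l_neg Q.a_inv_closed)
  then show ?thesis
    by (intro moduleI assms(1))
      (auto simp: sel Q.l_distr Q.r_distr Q.m_assoc)
qed

text \<open>The length of \<open>R / I\<close> as a number. The value is meaningful only when this length is
  finite, as it is for the ideals \<open>I\<close> containing a power of the maximal ideal of a
  noetherian local ring.\<close>

definition colength :: "('a, 'b) ring_scheme \<Rightarrow> 'a set \<Rightarrow> nat" where
  "colength R I = the_enat (module_length R (quot_module R I))"


section \<open>Hilbert coefficients\<close>

text \<open>The sequence \<open>c\<close> lists the coefficients of the polynomial of degree (at most) \<open>d\<close> that
  agrees with \<open>f\<close> at all large arguments, with respect to the basis of binomial coefficients with
  alternating signs; it is padded with zeros beyond \<open>d\<close>, so that it is unique.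
  The subtraction on natural numbers is exact for \<open>n \<ge> 1\<close>.\<close>

definition is_hilbert_coeffs :: "nat \<Rightarrow> (nat \<Rightarrow> nat) \<Rightarrow> (nat \<Rightarrow> int) \<Rightarrow> bool" where
  "is_hilbert_coeffs d f c \<longleftrightarrow> (\<forall>i>d. c i = 0) \<and>
     (\<forall>\<^sub>F n in sequentially.
        int (f n) = (\<Sum>i=0..d. (-1) ^ i * c i * int ((n + d - i - 1) choose (d - i))))"

definition hilbert_coeff :: "nat \<Rightarrow> (nat \<Rightarrow> nat) \<Rightarrow> nat \<Rightarrow> int" where
  "hilbert_coeff d f = (THE c. is_hilbert_coeffs d f c)"

definition e_coeff :: "('a, 'b) ring_scheme \<Rightarrow> 'a set \<Rightarrow> nat \<Rightarrow> int" where
  "e_coeff R I = hilbert_coeff (the_enat (krull_dim R)) (\<lambda>n. colength R (ideal_pow R I n))"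

definition g_coeff :: "('a, 'b) ring_scheme \<Rightarrow> 'a set \<Rightarrow> 'a set \<Rightarrow> nat \<Rightarrow> int" where
  "g_coeff R I K = hilbert_coeff (the_enat (krull_dim R))
     (\<lambda>n. colength R (K \<cdot>\<^bsub>R\<^esub> ideal_pow R I n))"


section \<open>Minimal multiplicity\<close>

definition minimal_multiplicity :: "('a, 'b) ring_scheme \<Rightarrow> 'a set \<Rightarrow> bool" where
  "minimal_multiplicity R I \<longleftrightarrow>
     e_coeff R I 0 + int (the_enat (krull_dim R)) - int (colength R I) = int (min_gens R I)"

definition minimal_multiplicity_wrt ::
    "('a, 'b) ring_scheme \<Rightarrow> 'a set \<Rightarrow> 'a set \<Rightarrow> bool" where
  "minimal_multiplicity_wrt R K I \<longleftrightarrow>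
     (\<forall>J. minimal_reduction R J I \<longrightarrow> K \<cdot>\<^bsub>R\<^esub> I = K \<cdot>\<^bsub>R\<^esub> J)"

end

theory Submission
  imports Defs
begin

text \<open>
  Let \<open>d\<close> be the dimension of \<open>R\<close>. The proof compares the ideals \<open>K I\<^sup>n\<close> with the ideals \<open>K J\<^sup>n\<close>,
  directly in \<open>R\<close>, without passing to a quotient of dimension one.

  Over a Cohen-Macaulay ring with infinite residue field a minimal reduction \<open>J\<close> is generated by a
  regular sequence of length \<open>d\<close> (\<open>minimal_reduction_regular\<close>). Powers of such an ideal behave as in
  a polynomial ring: for every \<open>K \<supseteq> J\<close> the length of \<open>J\<^sup>n / K J\<^sup>n\<close> is the length of \<open>R / K\<close> times
  the number of monomials of degree \<open>n\<close> in \<open>d\<close> variables (\<open>len_regular_pow\<close>). This gives the length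
  of \<open>R / K J\<^sup>n\<close> in closed form. As \<open>I\<^bsup>n+r\<^esup> \<subseteq> J\<^sup>n \<subseteq> I\<^sup>n\<close> for some \<open>r\<close>, the polynomial of
  \<open>R / K I\<^sup>n\<close> has the same leading term, so \<open>g\<^sub>0\<close> is the length of \<open>R / J\<close>, and the sum of \<open>g\<^sub>1\<close> and the
  length of \<open>R / K\<close> measures, up to the factor \<open>(d - 1)!\<close>, the growth of the length of
  \<open>K I\<^sup>n / K J\<^sup>n\<close> at order \<open>n\<^bsup>d-1\<^esup>\<close>.

  If \<open>K I = K J\<close>, then \<open>K I\<^sup>n = K J\<^sup>n\<close> for \<open>n > 0\<close>, so the sum vanishes: this is (i). For (ii) put
  \<open>A = J + K I\<close>. The ideal \<open>K I\<^sup>n + J\<^sup>n\<close> contains \<open>A J\<^bsup>n-1\<^esup>\<close>, and the formula above, applied to \<open>A\<close> and to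
  \<open>J\<close>, shows that the growth is at least the length of \<open>A / J\<close> (\<open>g_coeff_1_lower_bound\<close>). So if the
  sum vanishes, then \<open>K I \<subseteq> J\<close>, and \<open>K I \<inter> J = K J\<close> finishes the argument for this \<open>J\<close>. For another
  minimal reduction \<open>J'\<close> the rings \<open>R / J\<close> and \<open>R / J'\<close> both have length \<open>g\<^sub>0\<close>. By the closed form
  \<open>R / K J\<close> and \<open>R / K J'\<close> then have the same length too, and \<open>K J' \<subseteq> K I = K J\<close> becomes an equality.

  In (iii) the condition \<open>\<mm> I \<inter> J = \<mm> J\<close> holds automatically, because \<open>J\<close> is a minimal reduction
  (\<open>minimal_reduction_inter\<close>). The length of \<open>R / \<mm> J\<close> is that of \<open>R / J\<close> plus \<open>d\<close>, and \<open>\<mu>(I)\<close> is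
  the length of \<open>I / \<mm> I\<close>; so the numerical definition of minimal multiplicity says that \<open>R / \<mm> I\<close>
  and \<open>R / \<mm> J\<close> have the same length, that is, \<open>\<mm> I = \<mm> J\<close>.

  Two facts carry the weight. The first is a form of Noether normalization. If an ideal \<open>N\<close> is
  generated by \<open>s\<close> elements and no \<open>s - 1\<close> general linear combinations of them generate a reduction of
  \<open>N\<close>, then products of linear forms that vanish at the points of a grid show that the generators satisfy no
  homogeneous relation modulo \<open>\<mm>\<close> (\<open>len_pow_ge_binomial\<close>); such an \<open>N\<close> grows too fast if
  \<open>s > d\<close>. Hence \<open>J\<close> has \<open>d\<close> generators. The same fact provides the auxiliary parameters
  (\<open>common_parameters\<close>) with which a known regular sequence of length \<open>d\<close> is exchanged, one element at
  a time, for the generators of \<open>J\<close> (\<open>parameters_regular\<close>).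

  The second is the existence of the Hilbert polynomial. The length of the \<open>n\<close>-th graded piece is a
  sum, over the monomials of degree \<open>n\<close>, of a function of the exponents that is antitone
  (\<open>len_graded_piece\<close>), and such a function is eventually constant in every direction
  (\<open>antitone_stabilizes\<close>). So the sums are polynomial for large \<open>n\<close>.
\<close>

section \<open>Sums and products of ideals\<close>

context cring begin

abbreviation ideal_sum :: "'a set \<Rightarrow> 'a set \<Rightarrow> 'a set" (infixl \<open>\<uplus>\<close> 65)
  where "A \<uplus> B \<equiv> set_add R A B"

abbreviation ideal_power :: "'a set \<Rightarrow> nat \<Rightarrow> 'a set" (infixl \<open>\<up>\<close> 85)
  where "A \<up> n \<equiv> ideal_pow R A n"

lemma ideal_carrier_subset: "ideal A R \<Longrightarrow> A \<subseteq> carrier R"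
  by (auto dest: ideal.Icarr)

lemma ideal_zero_mem: "ideal A R \<Longrightarrow> \<zero> \<in> A"
  by (simp add: additive_subgroup.zero_closed ideal.axioms(1))

lemma ideal_add_mem: "ideal A R \<Longrightarrow> a \<in> A \<Longrightarrow> b \<in> A \<Longrightarrow> a \<oplus> b \<in> A"
  by (simp add: additive_subgroup.a_closed ideal.axioms(1))

lemma ideal_neg_mem: "ideal A R \<Longrightarrow> a \<in> A \<Longrightarrow> \<ominus> a \<in> A"
  by (simp add: additive_subgroup.a_inv_closed ideal.axioms(1))

lemma ideal_minus_mem: "ideal A R \<Longrightarrow> a \<in> A \<Longrightarrow> b \<in> A \<Longrightarrow> a \<ominus> b \<in> A"
  by (simp add: a_minus_def ideal_add_mem ideal_neg_mem)

lemma ideal_cancel: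
  assumes "ideal A R" "a \<in> A" "b \<in> carrier R" "a \<oplus> b \<in> A" shows "b \<in> A"
proof -
  have a: "a \<in> carrier R" using assms(1,2) by (rule ideal.Icarr)
  have "\<ominus> a \<oplus> (a \<oplus> b) = b" using a assms(3) by (simp add: r_neg1)
  then show ?thesis
    using ideal_add_mem[OF assms(1) ideal_neg_mem[OF assms(1,2)] assms(4)] by simp
qed

lemma ideal_mult_mem: "ideal A R \<Longrightarrow> a \<in> A \<Longrightarrow> x \<in> carrier R \<Longrightarrow> x \<otimes> a \<in> A"
  by (simp add: ideal.I_l_closed)

lemma ideal_mult_mem': "ideal A R \<Longrightarrow> a \<in> A \<Longrightarrow> x \<in> carrier R \<Longrightarrow> a \<otimes> x \<in> A"
  by (simp add: ideal.I_r_closed)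

lemma mem_sum_iff: "x \<in> A \<uplus> B \<longleftrightarrow> (\<exists>a\<in>A. \<exists>b\<in>B. x = a \<oplus> b)"
  by (auto simp: set_add_def')

lemma sum_upper1: "ideal A R \<Longrightarrow> ideal B R \<Longrightarrow> A \<subseteq> A \<uplus> B"
  using ideal_zero_mem ideal_carrier_subset by (force simp: mem_sum_iff)

lemma sum_upper2: "ideal A R \<Longrightarrow> ideal B R \<Longrightarrow> B \<subseteq> A \<uplus> B"
  using ideal_zero_mem ideal_carrier_subset by (force simp: mem_sum_iff)

lemma sum_le_iff:
  assumes "ideal A R" "ideal B R" "ideal C R"
  shows "A \<uplus> B \<subseteq> C \<longleftrightarrow> A \<subseteq> C \<and> B \<subseteq> C"
  using assms sum_upper1[of A B] sum_upper2[of A B] ideal_add_mem[of C]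
  by (auto simp: mem_sum_iff subset_iff)

lemma isum_mono: "A \<subseteq> A' \<Longrightarrow> B \<subseteq> B' \<Longrightarrow> A \<uplus> B \<subseteq> A' \<uplus> B'"
  by (auto simp: mem_sum_iff) blast

lemma sum_absorb1: "ideal A R \<Longrightarrow> ideal B R \<Longrightarrow> B \<subseteq> A \<Longrightarrow> A \<uplus> B = A"
  using sum_le_iff[of A B A] sum_upper1[of A B] by auto

lemma sum_absorb2: "ideal A R \<Longrightarrow> ideal B R \<Longrightarrow> A \<subseteq> B \<Longrightarrow> A \<uplus> B = B"
  using sum_le_iff[of A B B] sum_upper2[of A B] by auto

lemma sum_commute: "ideal A R \<Longrightarrow> ideal B R \<Longrightarrow> A \<uplus> B = B \<uplus> A"
  by (rule set_add_comm) (auto dest: ideal_carrier_subset)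

lemma sum_assoc: "ideal A R \<Longrightarrow> ideal B R \<Longrightarrow> ideal C R \<Longrightarrow> (A \<uplus> B) \<uplus> C = A \<uplus> (B \<uplus> C)"
  using semiring.axioms(1)[OF ideals_set_is_semiring] abelian_monoid.a_assoc[of "ideals_set R"]
  by (auto simp: ideals_set_def)

lemma prod_mono:
  assumes "A \<subseteq> A'" "B \<subseteq> B'" shows "A \<cdot> B \<subseteq> A' \<cdot> B'"
proof
  fix s assume "s \<in> A \<cdot> B" then show "s \<in> A' \<cdot> B'"
    by (induct s rule: ideal_prod.induct) (use assms in \<open>auto intro: ideal_prod.intros\<close>)
qed

lemma prod_le1: "ideal A R \<Longrightarrow> ideal B R \<Longrightarrow> A \<cdot> B \<subseteq> A"
  using ideal_prod_inter by blast

lemma prod_le2: "ideal A R \<Longrightarrow> ideal B R \<Longrightarrow> A \<cdot> B \<subseteq> B"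
  using ideal_prod_inter by blast

lemma prod_left_commute: "ideal A R \<Longrightarrow> ideal B R \<Longrightarrow> ideal C R \<Longrightarrow> A \<cdot> (B \<cdot> C) = B \<cdot> (A \<cdot> C)"
  by (metis ideal_prod_assoc ideal_prod_commute)

lemma prod_one_left: "ideal A R \<Longrightarrow> carrier R \<cdot> A = A"
  by (metis ideal_prod_commute ideal_prod_one oneideal)

lemma prod_zero_left: "ideal A R \<Longrightarrow> {\<zero>} \<cdot> A = {\<zero>}"
  by (metis ideal_prod_commute ideal_prod_zero zeroideal)

lemma zero_sum: "ideal A R \<Longrightarrow> {\<zero>} \<uplus> A = A"
  by (rule sum_absorb2) (auto simp: zeroideal ideal_zero_mem)

lemma sum_zero: "ideal A R \<Longrightarrow> A \<uplus> {\<zero>} = A"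
  by (rule sum_absorb1) (auto simp: zeroideal ideal_zero_mem)

lemma ideals_set_one [simp]: "\<one>\<^bsub>ideals_set R\<^esub> = carrier R"
  and ideals_set_mult [simp]: "A \<otimes>\<^bsub>ideals_set R\<^esub> B = A \<cdot> B"
  by (simp_all add: ideals_set_def)

lemma ideal_pow_ideal: "ideal A R \<Longrightarrow> ideal (A \<up> n) R"
  by (induct n) (auto simp: oneideal ideal_prod_is_ideal)

lemmas ideal_ops = oneideal zeroideal add_ideals ideal_prod_is_ideal ideal_pow_ideal
  cgenideal_ideal i_intersect

lemma ideal_pow_Suc: "ideal A R \<Longrightarrow> A \<up> (Suc n) = A \<cdot> A \<up> n"
  by (simp add: ideal_prod_commute ideal_pow_ideal)

lemma ideal_pow_add:
  assumes "ideal A R" shows "A \<up> (m + n) = A \<up> m \<cdot> A \<up> n"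
proof (induct n)
  case (Suc n)
  then show ?case using assms by (simp add: ideal_prod_assoc ideal_ops)
qed (use assms in \<open>simp add: ideal_prod_one ideal_ops\<close>)

lemma ideal_pow_mono:
  assumes "ideal A R" "ideal B R" "A \<subseteq> B" shows "A \<up> n \<subseteq> B \<up> n"
  by (induct n) (use assms in \<open>auto dest!: prod_mono[OF _ assms(3)]\<close>)

lemma ideal_pow_antimono:
  assumes "ideal A R" "m \<le> n" shows "A \<up> n \<subseteq> A \<up> m"
proof -
  obtain k where "n = m + k" using assms(2) le_Suc_ex by blast
  then show ?thesis using assms by (simp add: ideal_pow_add prod_le1 ideal_pow_ideal)
qed

lemma ideal_pow_pow:
  assumes "ideal A R" shows "(A \<up> m) \<up> n = A \<up> (m * n)"
proof (induct n)
  case (Suc n)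
  then show ?case using assms ideal_pow_add[of A "m * n" m]
    by (simp add: ac_simps)
qed simp

lemma elt_pow_mem: "ideal A R \<Longrightarrow> a \<in> A \<Longrightarrow> a [^] n \<in> A \<up> n" for n :: nat
  by (induct n) (auto intro: ideal_prod.prod)

lemma mem_smul_iff:
  assumes "x \<in> carrier R" "ideal B R"
  shows "y \<in> (PIdl x) \<cdot> B \<longleftrightarrow> (\<exists>b\<in>B. y = x \<otimes> b)"
proof
  assume "y \<in> (PIdl x) \<cdot> B"
  then show "\<exists>b\<in>B. y = x \<otimes> b"
  proof (induct y rule: ideal_prod.induct)
    case (prod i j)
    then obtain r where r: "r \<in> carrier R" "i = r \<otimes> x" by (auto simp: cgenideal_def)
    then have "i \<otimes> j = x \<otimes> (r \<otimes> j)"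
      using assms prod by (simp add: m_ac ideal.Icarr)
    then show ?case using r prod assms ideal_mult_mem by blast
  next
    case (sum s1 s2)
    then obtain b c where "b \<in> B" "c \<in> B" "s1 = x \<otimes> b" "s2 = x \<otimes> c" by blast
    then have "s1 \<oplus> s2 = x \<otimes> (b \<oplus> c)" "b \<oplus> c \<in> B"
      using assms by (auto simp: r_distr ideal.Icarr ideal_add_mem)
    then show ?case by blast
  qed
next
  assume "\<exists>b\<in>B. y = x \<otimes> b"
  then show "y \<in> (PIdl x) \<cdot> B" using assms cgenideal_self by (auto intro: ideal_prod.prod)
qed

lemma mem_sum_smul_iff:
  assumes "x \<in> carrier R" "ideal B R"
  shows "y \<in> C \<uplus> (PIdl x) \<cdot> B \<longleftrightarrow> (\<exists>c\<in>C. \<exists>b\<in>B. y = c \<oplus> x \<otimes> b)"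
  by (fastforce simp: mem_sum_iff mem_smul_iff[OF assms])

definition colon :: "'a set \<Rightarrow> 'a \<Rightarrow> 'a set" where
  "colon C x = {a \<in> carrier R. x \<otimes> a \<in> C}"

lemma colon_ideal:
  assumes "ideal C R" "x \<in> carrier R" shows "ideal (colon C x) R"
proof (rule idealI)
  show "subgroup (colon C x) (add_monoid R)"
    by (rule add.subgroupI) (use assms in \<open>auto simp: colon_def r_distr r_minus ideal_add_mem
      ideal_zero_mem ideal_neg_mem simp flip: a_inv_def\<close>)
next
  fix a y assume "a \<in> colon C x" "y \<in> carrier R"
  then show "y \<otimes> a \<in> colon C x" "a \<otimes> y \<in> colon C x"
    using assms ideal_mult_mem[of C "x \<otimes> a" y] by (auto simp: colon_def m_lcomm m_comm[of a y])
qed (rule ring_axioms)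

lemma colon_upper: "ideal C R \<Longrightarrow> x \<in> carrier R \<Longrightarrow> C \<subseteq> colon C x"
  using ideal_carrier_subset by (auto simp: colon_def ideal_mult_mem)

lemma smul_le_iff:
  assumes "x \<in> carrier R" "ideal B R"
  shows "(PIdl x) \<cdot> B \<subseteq> C \<longleftrightarrow> B \<subseteq> colon C x"
  using assms ideal_carrier_subset by (auto simp: mem_smul_iff colon_def subset_iff)

end

section \<open>Length of intervals of ideals\<close>

text \<open>
  The length of the module \<open>B / A\<close> for ideals \<open>A \<subseteq> B\<close>. Chains are counted in the lattice of ideals of
  \<open>R\<close>, so that subquotients can be compared without forming them.
\<close>

definition ilen :: "('a, 'b) ring_scheme \<Rightarrow> 'a set \<Rightarrow> 'a set \<Rightarrow> enat" where
  "ilen R A B = Sup {enat n | n (N :: nat \<Rightarrow> 'a set).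
      (\<forall>i\<le>n. ideal (N i) R \<and> A \<subseteq> N i \<and> N i \<subseteq> B) \<and> (\<forall>i<n. N i \<subset> N (Suc i))}"

lemma enat_Sup_attained:
  assumes "Sup S = enat n" "S \<noteq> {}" shows "enat n \<in> (S :: enat set)"
proof -
  have "finite S" "Sup S = Max S" using assms by (auto simp: Sup_enat_def split: if_splits)
  then show ?thesis using assms Max_in[of S] by simp
qed

lemma enat_Sup_add_le:
  fixes S T :: "enat set"
  assumes "S \<noteq> {}" "T \<noteq> {}" "\<And>s t. s \<in> S \<Longrightarrow> t \<in> T \<Longrightarrow> s + t \<le> L"
  shows "Sup S + Sup T \<le> L"
proof (cases L)
  case (enat l)
  have 1: "Sup S \<le> enat l"
    using assms enat by (intro Sup_least) (metis add.commute all_not_in_conv dual_order.trans le_iff_add)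
  have 2: "Sup T \<le> enat l"
    using assms enat by (intro Sup_least) (metis add.commute all_not_in_conv dual_order.trans le_iff_add)
  obtain s t where "Sup S = enat s" "Sup T = enat t"
    using 1 2 enat_ile by metis
  then show ?thesis using assms enat_Sup_attained by metis
qed auto

lemma enat_step:
  assumes "a + p \<le> a'" "b + q \<le> b'" "1 \<le> p + q" "k \<le> a + b" shows "k + 1 \<le> a' + (b' :: enat)"
proof -
  have "k + 1 \<le> (a + b) + (p + q)" using assms(3,4) by (rule add_mono[rotated])
  also have "\<dots> = (a + p) + (b + q)" by (simp add: ac_simps)
  also have "\<dots> \<le> a' + b'" using assms(1,2) by (rule add_mono)
  finally show ?thesis .
qed

context cring begin

abbreviation "len \<equiv> ilen R"

lemma len_ge:
  assumes "\<forall>i\<le>n. ideal (N i) R \<and> A \<subseteq> N i \<and> N i \<subseteq> B" "\<forall>i<n. N i \<subset> N (Suc i)"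
  shows "enat n \<le> len A B"
  unfolding ilen_def using assms by (intro Sup_upper) blast

lemma len_le:
  assumes "\<And>n N. \<forall>i\<le>n. ideal (N i) R \<and> A \<subseteq> N i \<and> N i \<subseteq> B \<Longrightarrow> \<forall>i<n. N i \<subset> N (Suc i) \<Longrightarrow> enat n \<le> L"
  shows "len A B \<le> L"
  unfolding ilen_def using assms by (intro Sup_least) blast

lemma len_mono: "A \<subseteq> A' \<Longrightarrow> B' \<subseteq> B \<Longrightarrow> len A' B' \<le> len A B"
  by (rule len_le, erule len_ge[rotated]) blast

text \<open>
  An order embedding of one interval of ideals into another bounds the length. The left inverse
  \<open>\<psi>\<close> is how strictness of the image chain is obtained.
\<close>

lemma len_embed:
  assumes \<phi>: "\<And>N. ideal N R \<Longrightarrow> C \<subseteq> N \<Longrightarrow> N \<subseteq> D \<Longrightarrow> ideal (\<phi> N) R \<and> A \<subseteq> \<phi> N \<and> \<phi> N \<subseteq> B"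
    and mono: "\<And>N M. M \<subseteq> N \<Longrightarrow> \<phi> M \<subseteq> \<phi> N"
    and \<psi>: "\<And>N. ideal N R \<Longrightarrow> C \<subseteq> N \<Longrightarrow> N \<subseteq> D \<Longrightarrow> \<psi> (\<phi> N) = N"
  shows "len C D \<le> len A B"
proof (rule len_le)
  fix n N assume N: "\<forall>i\<le>n. ideal (N i) R \<and> C \<subseteq> N i \<and> N i \<subseteq> D" "\<forall>i<n. N i \<subset> N (Suc i)"
  show "enat n \<le> len A B"
  proof (rule len_ge)
    show "\<forall>i\<le>n. ideal (\<phi> (N i)) R \<and> A \<subseteq> \<phi> (N i) \<and> \<phi> (N i) \<subseteq> B" using N \<phi> by blast
    show "\<forall>i<n. \<phi> (N i) \<subset> \<phi> (N (Suc i))"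
    proof (intro allI impI)
      fix i assume i: "i < n"
      have "\<phi> (N i) \<noteq> \<phi> (N (Suc i))"
        using i N \<psi>[of "N i"] \<psi>[of "N (Suc i)"] by (metis Suc_leI less_imp_le_nat less_irrefl)
      then show "\<phi> (N i) \<subset> \<phi> (N (Suc i))" using mono N i by blast
    qed
  qed
qed

lemma len_refl [simp]: "len A A = 0"
proof -
  have "len A A \<le> 0"
  proof (rule len_le)
    fix n :: nat and N
    assume N: "\<forall>i\<le>n. ideal (N i) R \<and> A \<subseteq> N i \<and> N i \<subseteq> A" "\<forall>i<n. N i \<subset> N (Suc i)"
    show "enat n \<le> 0"
    proof (cases n)
      case (Suc k)
      then have "N 0 \<subset> N (Suc 0)" "N 0 = A" "N (Suc 0) = A" using N by auto
      then show ?thesis by simp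
    qed (simp add: zero_enat_def)
  qed
  then show ?thesis by simp
qed

lemma len_pos:
  assumes "ideal A R" "ideal B R" "A \<subset> B" shows "1 \<le> len A B"
proof -
  have "enat 1 \<le> len A B"
    by (rule len_ge[where N = "\<lambda>i. if i = 0 then A else B"]) (use assms in auto)
  then show ?thesis by (simp add: one_enat_def)
qed

lemma len_eq_0D: "ideal A R \<Longrightarrow> ideal B R \<Longrightarrow> A \<subseteq> B \<Longrightarrow> len A B = 0 \<Longrightarrow> A = B"
  using len_pos[of A B] by (cases "A = B") auto

lemma len_superadd:
  assumes "ideal A R" "ideal B R" "ideal C R" "A \<subseteq> B" "B \<subseteq> C"
  shows "len A B + len B C \<le> len A C"
proof -
  have ne: "{enat n | n N. (\<forall>i\<le>n. ideal (N i) R \<and> E \<subseteq> N i \<and> N i \<subseteq> F) \<and> (\<forall>i<n. N i \<subset> N (Suc i))} \<noteq> {}"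
    if "ideal E R" "E \<subseteq> F" for E F
    using that by (auto intro!: exI[of _ "0::nat"] exI[of _ "\<lambda>_. E"])
  show ?thesis
    unfolding ilen_def[of _ A B] ilen_def[of _ B C]
  proof (rule enat_Sup_add_le)
    fix s t
    assume "s \<in> {enat n | n N. (\<forall>i\<le>n. ideal (N i) R \<and> A \<subseteq> N i \<and> N i \<subseteq> B) \<and> (\<forall>i<n. N i \<subset> N (Suc i))}"
      "t \<in> {enat n | n N. (\<forall>i\<le>n. ideal (N i) R \<and> B \<subseteq> N i \<and> N i \<subseteq> C) \<and> (\<forall>i<n. N i \<subset> N (Suc i))}"
    then obtain n N m M where s: "s = enat n" "\<forall>i\<le>n. ideal (N i) R \<and> A \<subseteq> N i \<and> N i \<subseteq> B" "\<forall>i<n. N i \<subset> N (Suc i)"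
      and t: "t = enat m" "\<forall>i\<le>m. ideal (M i) R \<and> B \<subseteq> M i \<and> M i \<subseteq> C" "\<forall>i<m. M i \<subset> M (Suc i)"
      by blast
    define P where "P i = (if i < n then N i else if i = n \<and> m = 0 then N n else M (i - n))" for i
    have "enat (n + m) \<le> len A C"
    proof (rule len_ge)
      show "\<forall>i\<le>n + m. ideal (P i) R \<and> A \<subseteq> P i \<and> P i \<subseteq> C"
      proof (intro allI impI)
        fix i assume i: "i \<le> n + m"
        show "ideal (P i) R \<and> A \<subseteq> P i \<and> P i \<subseteq> C"
        proof (cases "i \<le> n \<and> (i < n \<or> m = 0)")
          case True
          then have "P i = N i" by (auto simp: P_def)
          then show ?thesis using s(2)[rule_format, of i] True assms(5) by auto
        next
          case False
          then have "P i = M (i - n)" "i - n \<le> m" using i by (auto simp: P_def)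
          then show ?thesis using t(2)[rule_format, of "i - n"] assms(4) by auto
        qed
      qed
      show "\<forall>i<n + m. P i \<subset> P (Suc i)"
      proof (intro allI impI)
        fix i assume i: "i < n + m"
        consider "Suc i < n" | "Suc i = n" | "i \<ge> n" by linarith
        then show "P i \<subset> P (Suc i)"
        proof cases
          case 1 then show ?thesis using s(3) by (auto simp: P_def)
        next
          case 2
          then have "N i \<subset> N n" "N n \<subseteq> B" "B \<subseteq> M 0"
            using s(2)[rule_format, of n] s(3)[rule_format, of i] t(2)[rule_format, of 0] by auto
          then show ?thesis using 2 by (auto simp: P_def)
        next
          case 3
          then have "M (i - n) \<subset> M (Suc (i - n))" "m > 0" using i t(3)[rule_format, of "i - n"] by auto
          then show ?thesis using 3 by (auto simp: P_def Suc_diff_le)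
        qed
      qed
    qed
    then show "s + t \<le> len A C" using s t by simp
  qed (use ne assms in auto)
qed

lemma modular_cancel:
  assumes "ideal N R" "ideal M R" "ideal B R" "N \<subseteq> M" "N \<inter> B = M \<inter> B" "N \<uplus> B = M \<uplus> B"
  shows "N = M"
proof -
  have "m \<in> N" if m: "m \<in> M" for m
  proof -
    have "m \<in> N \<uplus> B" using m sum_upper1[OF assms(2,3)] assms(6) by blast
    then obtain n b where nb: "n \<in> N" "b \<in> B" "m = n \<oplus> b" by (auto simp: mem_sum_iff)
    then have "b \<in> M" using m assms ideal_cancel[of M n b] ideal_carrier_subset by blast
    then show ?thesis using nb assms ideal_add_mem by blast
  qed
  then show ?thesis using assms by blast
qed

text \<open>
  Given a chain from \<open>A\<close> to \<open>C\<close>, its traces on \<open>B\<close> and its sums with \<open>B\<close> form chains from \<open>A\<close> to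
  \<open>B\<close> and from \<open>B\<close> to \<open>C\<close>. By the modular law every step of the given chain survives in at least one
  of the two.
\<close>

lemma len_add:
  assumes "ideal A R" "ideal B R" "ideal C R" "A \<subseteq> B" "B \<subseteq> C"
  shows "len A C = len A B + len B C"
proof (rule antisym[OF len_le len_superadd])
  fix n N assume N: "\<forall>i\<le>n. ideal (N i) R \<and> A \<subseteq> N i \<and> N i \<subseteq> C" "\<forall>i<n. N i \<subset> N (Suc i)"
  have "k \<le> n \<Longrightarrow> enat k \<le> len A (N k \<inter> B) + len B (N k \<uplus> B)" for k
  proof (induct k)
    case 0 then show ?case by (simp flip: zero_enat_def)
  next
    case (Suc k)
    let ?a = "len A (N k \<inter> B)" and ?b = "len B (N k \<uplus> B)"
    have id: "ideal (N k) R" "ideal (N (Suc k)) R" "A \<subseteq> N k" "N k \<subset> N (Suc k)" using N Suc(2) by auto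
    have le: "N k \<inter> B \<subseteq> N (Suc k) \<inter> B" "N k \<uplus> B \<subseteq> N (Suc k) \<uplus> B"
      using id by (auto intro: isum_mono[THEN subsetD])
    have "?a + len (N k \<inter> B) (N (Suc k) \<inter> B) \<le> len A (N (Suc k) \<inter> B)"
      using id le assms by (intro len_superadd) (auto simp: ideal_ops)
    moreover have "?b + len (N k \<uplus> B) (N (Suc k) \<uplus> B) \<le> len B (N (Suc k) \<uplus> B)"
      using id le assms by (intro len_superadd) (auto simp: ideal_ops sum_upper2)
    moreover have "1 \<le> len (N k \<inter> B) (N (Suc k) \<inter> B) + len (N k \<uplus> B) (N (Suc k) \<uplus> B)"
    proof (rule ccontr)
      assume "\<not> ?thesis"
      then have "len (N k \<inter> B) (N (Suc k) \<inter> B) + len (N k \<uplus> B) (N (Suc k) \<uplus> B) = 0"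
        by (metis ileI1 iless_eSuc0 linorder_not_le one_eSuc)
      then have "N k \<inter> B = N (Suc k) \<inter> B" "N k \<uplus> B = N (Suc k) \<uplus> B"
        using len_eq_0D[OF _ _ le(1)] len_eq_0D[OF _ _ le(2)] id assms by (simp_all add: ideal_ops)
      then show False using modular_cancel[of "N k" "N (Suc k)" B] id assms by blast
    qed
    moreover have "enat k \<le> ?a + ?b" using Suc by simp
    ultimately have "enat k + 1 \<le> len A (N (Suc k) \<inter> B) + len B (N (Suc k) \<uplus> B)"
      by (rule enat_step)
    then show ?case by (simp add: one_enat_def)
  qed
  from this[of n] have "enat n \<le> len A (N n \<inter> B) + len B (N n \<uplus> B)" by simp
  also have "\<dots> \<le> len A B + len B C"
    using N assms sum_le_iff[of "N n" B C] by (intro add_mono len_mono) auto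
  finally show "enat n \<le> len A B + len B C" .
qed (use assms in auto)

text \<open>
  Multiplication by \<open>x\<close> maps \<open>B\<close> onto \<open>(C + x B) / C\<close> with kernel \<open>B \<inter> (C : x)\<close>. Every isomorphism of
  subquotients used below is an instance; \<open>x = 1\<close> is the second isomorphism theorem.
\<close>

lemma len_smul:
  assumes "ideal C R" "ideal B R" "x \<in> carrier R"
  shows "len C (C \<uplus> (PIdl x) \<cdot> B) = len (B \<inter> colon C x) B"
proof (rule antisym)
  have xB: "ideal ((PIdl x) \<cdot> B) R" using assms by (simp add: ideal_ops)
  show "len C (C \<uplus> (PIdl x) \<cdot> B) \<le> len (B \<inter> colon C x) B"
  proof (rule len_embed[where \<phi> = "\<lambda>N. B \<inter> colon N x" and \<psi> = "\<lambda>M. C \<uplus> (PIdl x) \<cdot> M"])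
    fix N assume N: "ideal N R" "C \<subseteq> N" "N \<subseteq> C \<uplus> (PIdl x) \<cdot> B"
    have id: "ideal (B \<inter> colon N x) R" using assms N by (simp add: ideal_ops colon_ideal)
    show "ideal (B \<inter> colon N x) R \<and> B \<inter> colon C x \<subseteq> B \<inter> colon N x \<and> B \<inter> colon N x \<subseteq> B"
      using id N by (auto simp: colon_def)
    show "C \<uplus> (PIdl x) \<cdot> (B \<inter> colon N x) = N"
    proof
      show "C \<uplus> (PIdl x) \<cdot> (B \<inter> colon N x) \<subseteq> N"
        using assms N id by (simp add: sum_le_iff ideal_ops smul_le_iff)
      show "N \<subseteq> C \<uplus> (PIdl x) \<cdot> (B \<inter> colon N x)"
      proof
        fix n assume n: "n \<in> N"
        then obtain c b where cb: "c \<in> C" "b \<in> B" "n = c \<oplus> x \<otimes> b"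
          using subsetD[OF N(3) n] mem_sum_smul_iff[OF assms(3,2)] by blast
        have b: "b \<in> carrier R" by (rule ideal.Icarr[OF assms(2) cb(2)])
        have "x \<otimes> b \<in> N"
          using ideal_cancel[of N c "x \<otimes> b"] cb(1,3) b n N(1,2) assms(3) by auto
        then have "b \<in> B \<inter> colon N x" using cb b by (auto simp: colon_def)
        then show "n \<in> C \<uplus> (PIdl x) \<cdot> (B \<inter> colon N x)"
          using cb mem_sum_smul_iff[OF assms(3) id] by blast
      qed
    qed
  qed (auto simp: colon_def)
  show "len (B \<inter> colon C x) B \<le> len C (C \<uplus> (PIdl x) \<cdot> B)"
  proof (rule len_embed[where \<psi> = "\<lambda>N. B \<inter> colon N x" and \<phi> = "\<lambda>M. C \<uplus> (PIdl x) \<cdot> M"])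
    fix M assume M: "ideal M R" "B \<inter> colon C x \<subseteq> M" "M \<subseteq> B"
    show "ideal (C \<uplus> (PIdl x) \<cdot> M) R \<and> C \<subseteq> C \<uplus> (PIdl x) \<cdot> M \<and> C \<uplus> (PIdl x) \<cdot> M \<subseteq> C \<uplus> (PIdl x) \<cdot> B"
      using assms M by (intro conjI isum_mono prod_mono sum_upper1) (simp_all add: ideal_ops)
    show "B \<inter> colon (C \<uplus> (PIdl x) \<cdot> M) x = M"
    proof
      show "M \<subseteq> B \<inter> colon (C \<uplus> (PIdl x) \<cdot> M) x"
      proof
        fix m assume m: "m \<in> M"
        then have "m \<in> carrier R" "x \<otimes> m = \<zero> \<oplus> x \<otimes> m"
          using ideal.Icarr[OF M(1) m] assms(3) by auto
        then show "m \<in> B \<inter> colon (C \<uplus> (PIdl x) \<cdot> M) x"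
          using m M(3) ideal_zero_mem[OF assms(1)] mem_sum_smul_iff[OF assms(3) M(1)]
          by (auto simp: colon_def)
      qed
      show "B \<inter> colon (C \<uplus> (PIdl x) \<cdot> M) x \<subseteq> M"
      proof
        fix b assume b: "b \<in> B \<inter> colon (C \<uplus> (PIdl x) \<cdot> M) x"
        then obtain c m where cm: "c \<in> C" "m \<in> M" "x \<otimes> b = c \<oplus> x \<otimes> m" "b \<in> carrier R" "b \<in> B"
          using mem_sum_smul_iff[OF assms(3) M(1)] unfolding colon_def by blast
        have car: "c \<in> carrier R" "m \<in> carrier R"
          using ideal.Icarr[OF assms(1) cm(1)] ideal.Icarr[OF M(1) cm(2)] by auto
        have "x \<otimes> (b \<ominus> m) = c"
          using cm car assms by (simp add: a_minus_def r_distr r_minus a_assoc r_neg)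
        then have "b \<ominus> m \<in> B \<inter> colon C x"
          using cm car assms M ideal_minus_mem[of B b m] by (auto simp: colon_def)
        then have "b \<ominus> m \<in> M" using M by blast
        then have "(b \<ominus> m) \<oplus> m \<in> M" using cm M ideal_add_mem by blast
        then show "b \<in> M" using cm car by (simp add: a_minus_def a_assoc l_neg)
      qed
    qed
  qed (intro isum_mono prod_mono order_refl)
qed

lemma PIdl_one: "PIdl \<one> = carrier R"
  using genideal_one cgenideal_eq_genideal by force

lemma colon_one: "ideal C R \<Longrightarrow> colon C \<one> = C"
  using ideal_carrier_subset[of C] by (auto simp: colon_def subset_iff)

lemma len_diamond:
  assumes "ideal C R" "ideal B R"
  shows "len C (C \<uplus> B) = len (B \<inter> C) B"
  using len_smul[OF assms one_closed] by (simp add: PIdl_one prod_one_left colon_one assms)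

lemma len_sum_antimono:
  assumes "ideal C R" "ideal C' R" "ideal B R" "C \<subseteq> C'"
  shows "len C' (C' \<uplus> B) \<le> len C (C \<uplus> B)"
  using assms by (auto simp: len_diamond intro: len_mono)

end

section \<open>Ideals generated by regular sequences\<close>

context cring begin

lemma PIdl_le_iff: "ideal C R \<Longrightarrow> x \<in> carrier R \<Longrightarrow> PIdl x \<subseteq> C \<longleftrightarrow> x \<in> C"
  using cgenideal_minimal[of C x] cgenideal_self[of x] by blast

text \<open>
  Adding the elements to \<open>Q\<close> one by one, from the left, matches the inductive definition of regular
  sequences modulo \<open>Q\<close>.
\<close>

primrec adjoin :: "'a set \<Rightarrow> 'a list \<Rightarrow> 'a set" where
  "adjoin Q [] = Q"
| "adjoin Q (x # xs) = adjoin (Q \<uplus> PIdl x) xs"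

lemma adjoin_ideal [simp]: "ideal Q R \<Longrightarrow> set xs \<subseteq> carrier R \<Longrightarrow> ideal (adjoin Q xs) R"
  by (induct xs arbitrary: Q) (auto simp: ideal_ops)

lemma adjoin_le_iff:
  "ideal Q R \<Longrightarrow> set xs \<subseteq> carrier R \<Longrightarrow> ideal C R \<Longrightarrow> adjoin Q xs \<subseteq> C \<longleftrightarrow> Q \<subseteq> C \<and> set xs \<subseteq> C"
  by (induct xs arbitrary: Q) (auto simp: ideal_ops sum_le_iff PIdl_le_iff)

lemma adjoin_upper: "ideal Q R \<Longrightarrow> set xs \<subseteq> carrier R \<Longrightarrow> Q \<subseteq> adjoin Q xs"
  and adjoin_mem: "ideal Q R \<Longrightarrow> set xs \<subseteq> carrier R \<Longrightarrow> set xs \<subseteq> adjoin Q xs"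
  using adjoin_le_iff[of Q xs "adjoin Q xs"] by simp_all

lemma adjoin_append: "adjoin Q (xs @ ys) = adjoin (adjoin Q xs) ys"
  by (induct xs arbitrary: Q) auto

lemma adjoin_sum:
  assumes "ideal Q R" "ideal P R" "set xs \<subseteq> carrier R"
  shows "adjoin (Q \<uplus> P) xs = adjoin Q xs \<uplus> P"
proof (rule antisym)
  have id: "ideal (Q \<uplus> P) R" "ideal (adjoin Q xs) R" "ideal (adjoin Q xs \<uplus> P) R"
    "ideal (adjoin (Q \<uplus> P) xs) R" using assms by (simp_all add: ideal_ops)
  show "adjoin (Q \<uplus> P) xs \<subseteq> adjoin Q xs \<uplus> P"
    using assms id adjoin_upper[of Q xs] adjoin_mem[of Q xs] sum_upper1[OF id(2) assms(2)]
      sum_upper2[OF id(2) assms(2)]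
    by (auto simp: adjoin_le_iff sum_le_iff)
  show "adjoin Q xs \<uplus> P \<subseteq> adjoin (Q \<uplus> P) xs"
    using assms id adjoin_upper[OF id(1) assms(3)] adjoin_mem[OF id(1) assms(3)]
      sum_upper1[OF assms(1,2)] sum_upper2[OF assms(1,2)]
    by (auto simp: adjoin_le_iff sum_le_iff)
qed

lemma adjoin_eq_sum: "ideal Q R \<Longrightarrow> set xs \<subseteq> carrier R \<Longrightarrow> adjoin Q xs = Q \<uplus> adjoin {\<zero>} xs"
  using adjoin_sum[of "{\<zero>}" Q xs] sum_commute[of "adjoin {\<zero>} xs" Q]
  by (simp add: zero_sum zeroideal)

lemma adjoin_mono:
  assumes "ideal Q R" "ideal Q' R" "set xs \<subseteq> carrier R" "Q \<subseteq> Q'"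
  shows "adjoin Q xs \<subseteq> adjoin Q' xs"
  using assms adjoin_upper[of Q' xs] adjoin_mem[of Q' xs] by (simp add: adjoin_le_iff)

primrec regular_mod :: "'a set \<Rightarrow> 'a list \<Rightarrow> bool" where
  "regular_mod Q [] \<longleftrightarrow> True"
| "regular_mod Q (x # xs) \<longleftrightarrow> colon Q x \<subseteq> Q \<and> regular_mod (Q \<uplus> PIdl x) xs"

lemma regular_mod_append:
  "regular_mod Q (xs @ ys) \<longleftrightarrow> regular_mod Q xs \<and> regular_mod (adjoin Q xs) ys"
  by (induct xs arbitrary: Q) auto

text \<open>
  A form of degree \<open>n + 1\<close> in the generators is a form in the old generators plus \<open>x\<close> times a form of
  degree \<open>n\<close>. It stands in for an expansion into
  monomials.
\<close>

lemma pow_sum_principal: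
  assumes "ideal J R" "x \<in> carrier R"
  shows "(J \<uplus> PIdl x) \<up> (Suc n) = J \<up> (Suc n) \<uplus> (PIdl x) \<cdot> (J \<uplus> PIdl x) \<up> n"
proof (induct n)
  case 0
  then show ?case using assms by (simp add: prod_one_left ideal_prod_one ideal_ops)
next
  case (Suc n)
  let ?P = "PIdl x" and ?L = "J \<uplus> PIdl x"
  have P: "ideal ?P R" and L: "ideal ?L R" using assms by (simp_all add: ideal_ops)
  note id = assms(1) P L ideal_pow_ideal[OF assms(1)] ideal_pow_ideal[OF L]
  have "?L \<up> (Suc (Suc n)) = ?L \<cdot> ?L \<up> (Suc n)" using L by (rule ideal_pow_Suc)
  also have "\<dots> = J \<cdot> ?L \<up> (Suc n) \<uplus> ?P \<cdot> ?L \<up> (Suc n)"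
    by (rule ideal_prod_distr(2)[OF id(5) id(1) id(2)])
  also have "J \<cdot> ?L \<up> (Suc n) = J \<cdot> (J \<up> (Suc n) \<uplus> ?P \<cdot> ?L \<up> n)" using Suc by simp
  also have "\<dots> = J \<up> (Suc (Suc n)) \<uplus> ?P \<cdot> (J \<cdot> ?L \<up> n)"
    unfolding ideal_pow_Suc[OF assms(1), of "Suc n"]
    using id prod_left_commute[of J ?P "?L \<up> n"]
    by (subst ideal_prod_distr(1)) (simp_all add: ideal_prod_is_ideal del: Group.nat_pow_Suc)
  finally have "?L \<up> (Suc (Suc n)) = J \<up> (Suc (Suc n)) \<uplus> (?P \<cdot> (J \<cdot> ?L \<up> n) \<uplus> ?P \<cdot> ?L \<up> (Suc n))"
    using id by (subst (asm) sum_assoc) (simp_all add: ideal_prod_is_ideal)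
  moreover have "J \<cdot> ?L \<up> n \<subseteq> ?L \<up> (Suc n)"
    unfolding ideal_pow_Suc[OF L] using sum_upper1[OF assms(1) P] by (intro prod_mono) auto
  then have "?P \<cdot> (J \<cdot> ?L \<up> n) \<uplus> ?P \<cdot> ?L \<up> (Suc n) = ?P \<cdot> ?L \<up> (Suc n)"
    using id id(5)[of "Suc n"]
    by (intro sum_absorb2 prod_mono ideal_prod_is_ideal) (auto simp del: Group.nat_pow_Suc)
  ultimately show ?case by simp
qed

lemma add_eq_minus:
  assumes "p \<oplus> q = f \<oplus> e" "p \<in> carrier R" "q \<in> carrier R" "f \<in> carrier R" "e \<in> carrier R"
  shows "q \<ominus> e = f \<ominus> p"
proof -
  have "q = \<ominus> p \<oplus> (p \<oplus> q)" using assms(2,3) by (simp add: r_neg1)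
  then have "q = \<ominus> p \<oplus> (f \<oplus> e)" unfolding assms(1) .
  then have "q \<ominus> e = (\<ominus> p \<oplus> (f \<oplus> e)) \<ominus> e" by simp
  also have "\<dots> = (f \<ominus> p) \<oplus> (e \<oplus> \<ominus> e)" using assms(2-5) by (simp add: a_minus_def a_ac)
  also have "\<dots> = f \<ominus> p" using assms(2-5) by (simp add: r_neg)
  finally show ?thesis .
qed

lemma smult_minus: "x \<in> carrier R \<Longrightarrow> a \<in> carrier R \<Longrightarrow> b \<in> carrier R \<Longrightarrow> x \<otimes> (a \<ominus> b) = x \<otimes> a \<ominus> x \<otimes> b"
  by (simp add: a_minus_def r_distr r_minus)

lemma minus_add_cancel_right: "a \<in> carrier R \<Longrightarrow> b \<in> carrier R \<Longrightarrow> (a \<ominus> b) \<oplus> b = a"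
  by (simp add: a_minus_def a_assoc l_neg)

section \<open>Powers of an ideal generated by a regular sequence\<close>

text \<open>
  The consequence of freeness of \<open>J\<^sup>n / J\<^bsup>n+1\<^esup>\<close> over \<open>R / J\<close> that the arguments below rest on: a
  nonzerodivisor modulo \<open>A \<supseteq> J\<close> is also a nonzerodivisor on \<open>J\<^sup>n / A J\<^sup>n\<close>. It can be stated
  without bases, and it passes from \<open>J\<close> to \<open>J + x R\<close>.
\<close>

definition flat_powers :: "'a set \<Rightarrow> bool" where
  "flat_powers J \<longleftrightarrow> (\<forall>A z n b. ideal A R \<longrightarrow> J \<subseteq> A \<longrightarrow> z \<in> carrier R \<longrightarrow> colon A z \<subseteq> A \<longrightarrow>
     b \<in> J \<up> n \<longrightarrow> z \<otimes> b \<in> A \<cdot> J \<up> n \<longrightarrow> b \<in> A \<cdot> J \<up> n)"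

lemma flat_powersD:
  "flat_powers J \<Longrightarrow> ideal A R \<Longrightarrow> J \<subseteq> A \<Longrightarrow> z \<in> carrier R \<Longrightarrow> colon A z \<subseteq> A \<Longrightarrow>
     b \<in> J \<up> n \<Longrightarrow> z \<otimes> b \<in> A \<cdot> J \<up> n \<Longrightarrow> b \<in> A \<cdot> J \<up> n"
  unfolding flat_powers_def by blast

lemma flat_powers_zero: "flat_powers {\<zero>}"
  unfolding flat_powers_def
proof (intro allI impI)
  fix A z n b
  assume *: "ideal A R" "{\<zero>} \<subseteq> A" "z \<in> carrier R" "colon A z \<subseteq> A"
     "b \<in> {\<zero>} \<up> n" "z \<otimes> b \<in> A \<cdot> {\<zero>} \<up> n"
  show "b \<in> A \<cdot> {\<zero>} \<up> n"
  proof (cases n)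
    case 0
    then show ?thesis using * by (auto simp: ideal_prod_one colon_def)
  next
    case (Suc k)
    have "{\<zero>} \<up> n = {\<zero>}"
      using ideal_pow_ideal[OF zeroideal] by (simp add: Suc ideal_prod_zero)
    then show ?thesis using * by (simp add: ideal_prod_zero)
  qed
qed

text \<open>
  By induction on \<open>n\<close>, as \<open>J\<^bsup>n+1\<^esup> = J J\<^sup>n\<close> and \<open>x\<close> is a nonzerodivisor on \<open>J\<^sup>n / J J\<^sup>n\<close>.
\<close>

lemma flat_powers_colon:
  assumes "flat_powers J" "ideal J R" "x \<in> carrier R" "colon J x \<subseteq> J"
  shows "colon (J \<up> n) x \<subseteq> J \<up> n"
proof (induct n)
  case 0 then show ?case by (auto simp: colon_def)
next
  case (Suc n)
  show ?case
  proof
    fix a assume "a \<in> colon (J \<up> (Suc n)) x"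
    then have a: "a \<in> carrier R" "x \<otimes> a \<in> J \<cdot> J \<up> n"
      unfolding ideal_pow_Suc[OF assms(2)] colon_def by auto
    then have "x \<otimes> a \<in> J \<up> n"
      using prod_le2[OF assms(2) ideal_pow_ideal[OF assms(2)], of n] by blast
    then have "a \<in> J \<up> n" using Suc a by (auto simp: colon_def)
    then have "a \<in> J \<cdot> J \<up> n"
      using flat_powersD[OF assms(1,2) order_refl assms(3,4)] a by blast
    then show "a \<in> J \<up> (Suc n)" unfolding ideal_pow_Suc[OF assms(2)] .
  qed
qed

text \<open>
  Facts shared by the next two inductions: forms over \<open>J + x R\<close> split into forms over \<open>J\<close> and multiples
  of \<open>x\<close>, and \<open>x\<close> cancels modulo powers of \<open>J\<close>.
\<close>

lemma regular_step:
  assumes "ideal J R" "x \<in> carrier R" "flat_powers J" "colon J x \<subseteq> J" "ideal A R" "J \<uplus> PIdl x \<subseteq> A"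
  defines "L \<equiv> J \<uplus> PIdl x"
  shows prod_pow_split: "A \<cdot> L \<up> (Suc n)
      = A \<cdot> J \<up> (Suc n) \<uplus> (PIdl x) \<cdot> (A \<cdot> L \<up> n)"
    and "x \<in> A" "J \<subseteq> A" "ideal L R" "J \<subseteq> L"
    and pow_le_prod: "J \<up> (Suc n) \<subseteq> A \<cdot> L \<up> n"
    and "A \<cdot> J \<up> (Suc n) \<subseteq> J \<up> (Suc n)"
    and pow_cancel: "a \<in> carrier R \<Longrightarrow> x \<otimes> a \<in> J \<up> n \<Longrightarrow> a \<in> J \<up> n"
proof -
  have P: "ideal (PIdl x) R" using assms by (simp add: ideal_ops)
  show L: "ideal L R" unfolding L_def using assms by (simp add: ideal_ops)
  note id = assms(1,5) P L ideal_pow_ideal[OF L] ideal_pow_ideal[OF assms(1)]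
  show "J \<subseteq> A" "x \<in> A" "J \<subseteq> L"
    using assms P sum_upper1[OF assms(1) P] by (simp_all add: sum_le_iff PIdl_le_iff L_def)
  have "A \<cdot> L \<up> (Suc n) = A \<cdot> (J \<up> (Suc n) \<uplus> (PIdl x) \<cdot> L \<up> n)"
    unfolding L_def pow_sum_principal[OF assms(1,2)] ..
  also have "\<dots> = A \<cdot> J \<up> (Suc n) \<uplus> A \<cdot> ((PIdl x) \<cdot> L \<up> n)"
    by (rule ideal_prod_distr(1)) (use id in \<open>simp_all add: ideal_prod_is_ideal\<close>)
  also have "A \<cdot> ((PIdl x) \<cdot> L \<up> n) = (PIdl x) \<cdot> (A \<cdot> L \<up> n)"
    using id by (intro prod_left_commute) auto
  finally show "A \<cdot> L \<up> (Suc n)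
      = A \<cdot> J \<up> (Suc n) \<uplus> (PIdl x) \<cdot> (A \<cdot> L \<up> n)" .
  show "J \<up> (Suc n) \<subseteq> A \<cdot> L \<up> n"
    unfolding ideal_pow_Suc[OF assms(1)] using \<open>J \<subseteq> A\<close> \<open>J \<subseteq> L\<close> id
    by (intro prod_mono ideal_pow_mono) auto
  show "A \<cdot> J \<up> (Suc n) \<subseteq> J \<up> (Suc n)"
    using id(2,6) by (rule prod_le2)
  show "a \<in> carrier R \<Longrightarrow> x \<otimes> a \<in> J \<up> n \<Longrightarrow> a \<in> J \<up> n"
    using flat_powers_colon[OF assms(3,1,2,4), of n] by (auto simp: colon_def)
qed

text \<open>
  Put \<open>L = J + x R\<close> and write an element of \<open>L\<^bsup>n+1\<^esup>\<close> as \<open>b = c + x a\<close> with \<open>c \<in> J\<^bsup>n+1\<^esup>\<close> and \<open>a \<in> L\<^sup>n\<close>. If \<open>z b \<in> A L\<^bsup>n+1\<^esup>\<close>, then cancelling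
  \<open>x\<close> modulo \<open>J\<^bsup>n+1\<^esup>\<close> shows \<open>z a \<in> A L\<^sup>n\<close>, so that \<open>a\<close> is handled by induction on \<open>n\<close>; what
  remains is \<open>z c \<in> A J\<^bsup>n+1\<^esup>\<close>, the case of \<open>J\<close>.
\<close>

lemma flat_powers_step:
  assumes J: "ideal J R" and x: "x \<in> carrier R" and good: "flat_powers J" and nzd: "colon J x \<subseteq> J"
  shows "flat_powers (J \<uplus> PIdl x)"
proof -
  define L where "L = J \<uplus> PIdl x"
  have "b \<in> A \<cdot> L \<up> n"
    if A: "ideal A R" "L \<subseteq> A" and z: "z \<in> carrier R" "colon A z \<subseteq> A"
      and b: "b \<in> L \<up> n" "z \<otimes> b \<in> A \<cdot> L \<up> n" for A z n b
    using b
  proof (induct n arbitrary: b)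
    case 0
    then show ?case using A z by (auto simp: ideal_prod_one colon_def)
  next
    case (Suc n)
    note st = regular_step[OF J x good nzd A(1) A(2)[unfolded L_def], folded L_def]
    note id = A(1) J st(4) ideal_pow_ideal[OF J] ideal_pow_ideal[OF st(4)]
    have id2: "ideal (A \<cdot> L \<up> n) R" "ideal (A \<cdot> J \<up> (Suc n)) R"
      "ideal (A \<cdot> L \<up> (Suc n)) R"
      using id(1) id(4)[of "Suc n"] id(5)[of n] id(5)[of "Suc n"] ideal_prod_is_ideal by blast+
    note m1 = mem_sum_smul_iff[OF x id(5)[of n]]
    note m2 = mem_sum_smul_iff[OF x id2(1)]
    obtain c a where ca: "c \<in> J \<up> (Suc n)" "a \<in> L \<up> n" "b = c \<oplus> x \<otimes> a"
      using Suc(2) m1 unfolding L_def pow_sum_principal[OF J x] by blast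
    obtain f e where fe: "f \<in> A \<cdot> J \<up> (Suc n)" "e \<in> A \<cdot> L \<up> n" "z \<otimes> b = f \<oplus> x \<otimes> e"
      using Suc(3) m2 unfolding st(1) by blast
    have car: "c \<in> carrier R" "a \<in> carrier R" "f \<in> carrier R" "e \<in> carrier R"
      using ideal.Icarr[OF id(4) ca(1)] ideal.Icarr[OF id(5) ca(2)] ideal.Icarr[OF id2(2) fe(1)]
        ideal.Icarr[OF id2(1) fe(2)] by auto
    have "z \<otimes> c \<oplus> x \<otimes> (z \<otimes> a) = f \<oplus> x \<otimes> e"
      using fe(3) ca(3) car x z(1) by (simp add: r_distr m_lcomm)
    then have "x \<otimes> (z \<otimes> a) \<ominus> x \<otimes> e = f \<ominus> z \<otimes> c"
      using car x z(1) by (intro add_eq_minus) auto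
    then have "x \<otimes> (z \<otimes> a \<ominus> e) = f \<ominus> z \<otimes> c" using car x z(1) by (simp add: smult_minus)
    moreover have "f \<ominus> z \<otimes> c \<in> J \<up> (Suc n)"
      using st(7)[of n] fe(1) ideal_mult_mem[OF id(4) ca(1) z(1)]
      by (intro ideal_minus_mem[OF id(4)]) auto
    \<comment> \<open>Here \<open>x\<close> is cancelled, since it is a nonzerodivisor modulo every power of \<open>J\<close>.\<close>
    ultimately have "z \<otimes> a \<ominus> e \<in> J \<up> (Suc n)"
      using st(8)[of "z \<otimes> a \<ominus> e" "Suc n"] car z(1) by simp
    then have "z \<otimes> a \<ominus> e \<in> A \<cdot> L \<up> n" using st(6)[of n] by blast
    from ideal_add_mem[OF id2(1) this fe(2)]
    have "z \<otimes> a \<in> A \<cdot> L \<up> n" using car z(1) by (simp add: minus_add_cancel_right)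
    then have "a \<in> A \<cdot> L \<up> n" using Suc(1) ca(2) by blast
    then have xa: "x \<otimes> a \<in> A \<cdot> L \<up> (Suc n)"
      unfolding st(1) m2 using ideal_zero_mem[OF id2(2)] car x by (intro bexI[of _ \<zero>] bexI[of _ a]) auto
    have "(z \<otimes> b) \<ominus> z \<otimes> (x \<otimes> a) \<in> A \<cdot> L \<up> (Suc n)"
      using ideal_minus_mem[OF id2(3) Suc(3) ideal_mult_mem[OF id2(3) xa z(1)]] .
    moreover have "(z \<otimes> b) \<ominus> z \<otimes> (x \<otimes> a) = z \<otimes> c"
      using ca(3) car x z(1) by (simp add: r_distr a_minus_def a_assoc r_neg)
    ultimately have "z \<otimes> c \<in> A \<cdot> L \<up> (Suc n)" by simp
    then obtain f' e' where fe': "f' \<in> A \<cdot> J \<up> (Suc n)" "e' \<in> A \<cdot> L \<up> n"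
      "z \<otimes> c = f' \<oplus> x \<otimes> e'"
      using m2 unfolding st(1) by blast
    have car': "f' \<in> carrier R" "e' \<in> carrier R"
      using ideal.Icarr[OF id2(2) fe'(1)] ideal.Icarr[OF id2(1) fe'(2)] by auto
    have "x \<otimes> e' \<in> J \<up> (Suc n)"
      using ideal_cancel[OF id(4), of f' "Suc n" "x \<otimes> e'"] st(7)[of n] fe'(1,3) car' x
        ideal_mult_mem[OF id(4) ca(1) z(1)] by auto
    then have "e' \<in> J \<up> (Suc n)" using st(8) car' by blast
    then have "x \<otimes> e' \<in> A \<cdot> J \<up> (Suc n)" using st(2) by (intro ideal_prod.prod)
    then have "z \<otimes> c \<in> A \<cdot> J \<up> (Suc n)" using fe' ideal_add_mem[OF id2(2)] by simp
    then have "c \<in> A \<cdot> J \<up> (Suc n)"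
      using flat_powersD[OF good A(1) st(3) z ca(1)] by blast
    also have "\<dots> \<subseteq> A \<cdot> L \<up> (Suc n)"
      using st(5) id by (intro prod_mono ideal_pow_mono) auto
    finally show ?case using xa ca(3) ideal_add_mem[OF id2(3)] by simp
  qed
  then show ?thesis unfolding flat_powers_def L_def by blast
qed

lemma flat_powers_regular:
  "set xs \<subseteq> carrier R \<Longrightarrow> regular_mod {\<zero>} xs \<Longrightarrow> flat_powers (adjoin {\<zero>} xs)"
  by (induct xs rule: rev_induct)
    (auto simp: flat_powers_zero regular_mod_append adjoin_append zeroideal intro!: flat_powers_step)

text \<open>
  Pascal's rule for the number of monomials, with \<open>L = J + x R\<close>. The intermediate ideal \<open>K L\<^bsup>n+1\<^esup> + x L\<^sup>n\<close> splits
  \<open>L\<^bsup>n+1\<^esup> / K L\<^bsup>n+1\<^esup>\<close> into a copy of \<open>L\<^sup>n / K L\<^sup>n\<close>, by multiplication with \<open>x\<close>, and a copy of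
  \<open>J\<^bsup>n+1\<^esup> / K J\<^bsup>n+1\<^esup>\<close>. Cancellation of \<open>x\<close> modulo powers of \<open>J\<close> makes both maps injective.
\<close>

lemma len_pow_pascal:
  assumes J: "ideal J R" and x: "x \<in> carrier R" and good: "flat_powers J" and nzd: "colon J x \<subseteq> J"
    and K: "ideal K R" "J \<uplus> PIdl x \<subseteq> K"
  defines "L \<equiv> J \<uplus> PIdl x"
  shows "len (K \<cdot> L \<up> (Suc n)) (L \<up> (Suc n)) =
    len (K \<cdot> L \<up> n) (L \<up> n) +
    len (K \<cdot> J \<up> (Suc n)) (J \<up> (Suc n))"
proof -
  note st = regular_step[OF J x good nzd K, folded L_def]
  let ?A = "L \<up> n" and ?A' = "L \<up> (Suc n)" and ?B = "J \<up> (Suc n)" and ?P = "PIdl x"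
  have id: "ideal ?A R" "ideal ?A' R" "ideal ?B R" "ideal ?P R" "ideal (K \<cdot> ?A) R" "ideal (K \<cdot> ?A') R"
    "ideal (K \<cdot> ?B) R" "ideal (?P \<cdot> ?A) R"
    using J x K(1) st(4) by (auto intro!: ideal_ops simp del: Group.nat_pow_Suc)
  have Asplit: "?A' = ?B \<uplus> ?P \<cdot> ?A" unfolding L_def by (rule pow_sum_principal[OF J x])
  define M where "M = K \<cdot> ?A' \<uplus> ?P \<cdot> ?A"
  have M: "ideal M R" unfolding M_def by (rule add_ideals[OF id(6,8)])
  have PA: "?P \<cdot> ?A \<subseteq> ?A'" unfolding Asplit by (rule sum_upper2[OF id(3,8)])
  have KA: "K \<cdot> ?A' \<subseteq> ?A'" by (rule prod_le2[OF K(1) id(2)])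
  have KAM: "K \<cdot> ?A' \<subseteq> M" unfolding M_def by (rule sum_upper1[OF id(6,8)])
  have MA: "M \<subseteq> ?A'" unfolding M_def using sum_le_iff[OF id(6,8,2)] PA KA by blast
  have "?P \<cdot> (K \<cdot> ?A) \<subseteq> ?P \<cdot> ?A" by (intro prod_mono prod_le2 K(1) id order_refl)
  have "M = K \<cdot> ?B \<uplus> (?P \<cdot> (K \<cdot> ?A) \<uplus> ?P \<cdot> ?A)"
    unfolding M_def st(1) using id K(1) by (intro sum_assoc ideal_prod_is_ideal)
  then have M_eq: "M = K \<cdot> ?B \<uplus> ?P \<cdot> ?A"
    using sum_absorb2[OF ideal_prod_is_ideal[OF id(4,5)] id(8) \<open>?P \<cdot> (K \<cdot> ?A) \<subseteq> ?P \<cdot> ?A\<close>] by simp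
  have 1: "?A \<inter> colon (K \<cdot> ?A') x = K \<cdot> ?A"
  proof
    show "K \<cdot> ?A \<subseteq> ?A \<inter> colon (K \<cdot> ?A') x"
      using prod_le2[OF K(1) id(1)] smul_le_iff[OF x id(5), of "K \<cdot> ?A'"]
        sum_upper2[OF id(7) ideal_prod_is_ideal[OF id(4,5)]] unfolding st(1) by blast
    show "?A \<inter> colon (K \<cdot> ?A') x \<subseteq> K \<cdot> ?A"
    proof
      fix a assume "a \<in> ?A \<inter> colon (K \<cdot> ?A') x"
      then have a: "a \<in> carrier R" "x \<otimes> a \<in> K \<cdot> ?A'" by (auto simp: colon_def)
      then obtain f b where fb: "f \<in> K \<cdot> ?B" "b \<in> K \<cdot> ?A" "x \<otimes> a = f \<oplus> x \<otimes> b"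
        using mem_sum_smul_iff[OF x id(5)] unfolding st(1) by blast
      have car: "f \<in> carrier R" "b \<in> carrier R"
        using ideal.Icarr[OF id(7) fb(1)] ideal.Icarr[OF id(5) fb(2)] by auto
      have "x \<otimes> (a \<ominus> b) = x \<otimes> a \<ominus> x \<otimes> b" using car a(1) x by (simp add: smult_minus)
      also have "\<dots> = f" unfolding fb(3) using car x by (simp add: a_minus_def a_assoc r_neg)
      finally have "x \<otimes> (a \<ominus> b) = f" .
      then have "a \<ominus> b \<in> ?B" using st(8)[of "a \<ominus> b" "Suc n"] st(7)[of n] fb(1) a(1) car by auto
      then have "a \<ominus> b \<in> K \<cdot> ?A" using st(6)[of n] by blast
      from ideal_add_mem[OF id(5) this fb(2)] show "a \<in> K \<cdot> ?A"
        using car a by (simp add: minus_add_cancel_right)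
    qed
  qed
  have 2: "?B \<inter> M = K \<cdot> ?B"
  proof
    show "K \<cdot> ?B \<subseteq> ?B \<inter> M"
      using st(7)[of n] sum_upper1[OF id(7,8)] unfolding M_eq by blast
    show "?B \<inter> M \<subseteq> K \<cdot> ?B"
    proof
      fix c assume c: "c \<in> ?B \<inter> M"
      then obtain f e where fe: "f \<in> K \<cdot> ?B" "e \<in> ?A" "c = f \<oplus> x \<otimes> e"
        using mem_sum_smul_iff[OF x id(1)] unfolding M_eq by blast
      have car: "f \<in> carrier R" "e \<in> carrier R"
        using ideal.Icarr[OF id(7) fe(1)] ideal.Icarr[OF id(1) fe(2)] by auto
      have "x \<otimes> e \<in> ?B" using ideal_cancel[OF id(3), of f "x \<otimes> e"] st(7)[of n] fe c car x by auto
      then have "e \<in> ?B" using st(8) car by blast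
      then have "x \<otimes> e \<in> K \<cdot> ?B" using st(2) by (intro ideal_prod.prod)
      then show "c \<in> K \<cdot> ?B" using fe ideal_add_mem[OF id(7)] by simp
    qed
  qed
  have "M \<uplus> ?B = ?A'"
  proof
    show "M \<uplus> ?B \<subseteq> ?A'"
      using sum_le_iff[OF M id(3,2)] MA sum_upper1[OF id(3,8)] unfolding Asplit by blast
    have "?P \<cdot> ?A \<subseteq> M" unfolding M_def by (rule sum_upper2[OF id(6,8)])
    then have "?B \<uplus> ?P \<cdot> ?A \<subseteq> M \<uplus> ?B"
      using sum_le_iff[OF id(3,8) add_ideals[OF M id(3)]] sum_upper1[OF M id(3)] sum_upper2[OF M id(3)]
      by blast
    then show "?A' \<subseteq> M \<uplus> ?B" using Asplit by simp
  qed
  then have "len M ?A' = len (K \<cdot> ?B) ?B" using len_diamond[OF M id(3)] 2 by simp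
  moreover have "len (K \<cdot> ?A') M = len (K \<cdot> ?A) ?A"
    unfolding M_def len_smul[OF id(6,1) x] 1 ..
  ultimately show ?thesis using len_add[OF id(6) M id(2) KAM MA] by simp
qed

text \<open>
  The quotient is free of rank the number of monomials of degree \<open>n\<close> over \<open>R / K\<close>. The binomial
  coefficient is written so that it is also right for the empty sequence, where truncated subtraction
  gives \<open>1\<close> for \<open>n = 0\<close> and \<open>0\<close> for \<open>n > 0\<close>.
\<close>

lemma len_regular_pow:
  assumes "set xs \<subseteq> carrier R" "regular_mod {\<zero>} xs" "ideal K R" "adjoin {\<zero>} xs \<subseteq> K" "len K (carrier R) = enat k"
  shows "len (K \<cdot> (adjoin {\<zero>} xs) \<up> n) ((adjoin {\<zero>} xs) \<up> n)
    = enat (k * ((n + length xs - 1) choose n))"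
  using assms(1,2,4)
proof (induct xs arbitrary: n rule: rev_induct)
  case Nil
  show ?case
  proof (cases n)
    case 0 then show ?thesis using assms by (simp add: ideal_prod_one)
  next
    case (Suc m)
    have "{\<zero>} \<up> n = {\<zero>}"
      using ideal_pow_ideal[OF zeroideal] by (simp add: Suc ideal_prod_zero)
    then show ?thesis using assms Suc by (simp add: ideal_prod_zero zero_enat_def)
  qed
next
  case (snoc x xs)
  let ?J = "adjoin {\<zero>} xs"
  have x: "x \<in> carrier R" "set xs \<subseteq> carrier R" and J: "ideal ?J R"
    and r: "regular_mod {\<zero>} xs" "colon ?J x \<subseteq> ?J"
    using snoc by (auto simp: regular_mod_append zeroideal)
  have K: "?J \<uplus> PIdl x \<subseteq> K" "?J \<subseteq> K"
    using snoc(4) sum_upper1[OF J cgenideal_ideal[OF x(1)]] by (auto simp: adjoin_append)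
  show ?case
  proof (induct n)
    case 0 then show ?case using assms by (simp add: ideal_prod_one)
  next
    case (Suc n)
    have "(Suc n + length (xs @ [x]) - 1) choose Suc n
      = ((n + length (xs @ [x]) - 1) choose n) + ((Suc n + length xs - 1) choose Suc n)"
      by simp
    then show ?case
      using len_pow_pascal[OF J x(1) flat_powers_regular[OF x(2) r(1)] r(2) assms(3) K(1), of n]
        Suc snoc(1)[OF x(2) r(1) K(2), of "Suc n"]
      by (simp add: adjoin_append distrib_left del: Group.nat_pow_Suc binomial_Suc_Suc)
  qed
qed

end

section \<open>Noetherian local rings\<close>

context cring begin

lemma colonD: "colon A x \<subseteq> A \<Longrightarrow> a \<in> carrier R \<Longrightarrow> x \<otimes> a \<in> A \<Longrightarrow> a \<in> A"
  by (auto simp: colon_def)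

lemma unit_cancel_mem:
  assumes "ideal A R" "u \<in> Units R" "a \<in> carrier R" "u \<otimes> a \<in> A" shows "a \<in> A"
proof -
  have "inv u \<otimes> (u \<otimes> a) \<in> A" by (rule ideal_mult_mem[OF assms(1,4) Units_inv_closed[OF assms(2)]])
  moreover have "inv u \<otimes> (u \<otimes> a) = (inv u \<otimes> u) \<otimes> a"
    using assms(2,3) by (intro m_assoc[symmetric]) auto
  ultimately show ?thesis using assms(2,3) by simp
qed

text \<open>
  The quotients of the chain of the ideals \<open>Q + x\<^sup>i R\<close>, for \<open>i \<le> m\<close>, are homomorphic images of
  \<open>R / (Q + x R)\<close>.
\<close>

lemma len_add_power_le:
  fixes m :: nat
  assumes "ideal Q R" "x \<in> carrier R"
  shows "len (Q \<uplus> PIdl (x [^] m)) (carrier R) \<le> enat m * len (Q \<uplus> PIdl x) (carrier R)"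
proof (induct m)
  case 0
  then show ?case
    using assms sum_absorb2[OF assms(1) oneideal ideal_carrier_subset[OF assms(1)]] by (simp add: PIdl_one)
next
  case (Suc m)
  let ?C = "Q \<uplus> PIdl (x [^] Suc m)" and ?D = "Q \<uplus> PIdl x"
  have p: "x [^] k \<in> carrier R" "ideal (PIdl (x [^] k)) R" for k :: nat
    using assms by (simp_all add: cgenideal_ideal)
  have P: "ideal (PIdl x) R" by (rule cgenideal_ideal[OF assms(2)])
  have id: "ideal ?C R" "ideal ?D R" "ideal (Q \<uplus> PIdl (x [^] m)) R"
    by (rule add_ideals[OF assms(1) p(2)], rule add_ideals[OF assms(1) P], rule add_ideals[OF assms(1) p(2)])
  have "x [^] Suc m \<in> PIdl x" using assms by (auto simp: cgenideal_def)
  then have "PIdl (x [^] Suc m) \<subseteq> PIdl x" using PIdl_le_iff[OF P p(1)] by blast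
  then have CD: "?C \<subseteq> ?D" by (intro isum_mono order_refl)
  have C_up: "Q \<subseteq> ?C" "PIdl (x [^] Suc m) \<subseteq> ?C"
    by (rule sum_upper1[OF assms(1) p(2)], rule sum_upper2[OF assms(1) p(2)])
  have "?C \<uplus> (PIdl x) \<cdot> carrier R = ?D"
  proof
    have "(PIdl x) \<cdot> carrier R = PIdl x" by (rule ideal_prod_one[OF P])
    moreover have "?C \<uplus> PIdl x \<subseteq> ?D"
      using sum_le_iff[OF id(1) P id(2)] CD sum_upper2[OF assms(1) P] by blast
    moreover have "?D \<subseteq> ?C \<uplus> PIdl x" by (intro isum_mono order_refl C_up)
    ultimately show "?C \<uplus> (PIdl x) \<cdot> carrier R \<subseteq> ?D" "?D \<subseteq> ?C \<uplus> (PIdl x) \<cdot> carrier R" by auto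
  qed
  then have "len ?C ?D = len (carrier R \<inter> colon ?C x) (carrier R)"
    using len_smul[OF id(1) oneideal assms(2)] by simp
  also have "\<dots> \<le> len (Q \<uplus> PIdl (x [^] m)) (carrier R)"
  proof (rule len_mono)
    have "x [^] m \<in> colon ?C x"
      using assms C_up PIdl_le_iff[OF id(1) p(1), of "Suc m"] by (simp add: colon_def m_comm)
    then have "Q \<uplus> PIdl (x [^] m) \<subseteq> colon ?C x"
      using sum_le_iff[OF assms(1) p(2) colon_ideal[OF id(1) assms(2)]]
        PIdl_le_iff[OF colon_ideal[OF id(1) assms(2)] p(1)] C_up(1) colon_upper[OF id(1) assms(2)] by blast
    then show "Q \<uplus> PIdl (x [^] m) \<subseteq> carrier R \<inter> colon ?C x" by (auto simp: colon_def)
  qed simp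
  finally have "len ?C ?D \<le> enat m * len ?D (carrier R)" using Suc by (rule order_trans)
  moreover have "len ?C (carrier R) = len ?C ?D + len ?D (carrier R)"
    using id CD by (intro len_add ideal_carrier_subset oneideal) auto
  ultimately have "len ?C (carrier R) \<le> enat m * len ?D (carrier R) + len ?D (carrier R)"
    by (simp add: add_right_mono)
  also have "\<dots> = enat (Suc m) * len ?D (carrier R)"
    by (simp add: distrib_right eSuc_enat[symmetric] eSuc_plus_1)
  finally show ?case .
qed

text \<open>
  The source of all upper bounds on growth: the right hand side is a polynomial in \<open>m\<close> whose degree
  is the number of elements adjoined.
\<close>

lemma len_adjoin_powers_le:
  fixes m :: nat
  assumes "ideal Q R" "set xs \<subseteq> carrier R"
  shows "len (adjoin Q (map (\<lambda>x. x [^] m) xs)) (carrier R) \<le> enat (m ^ length xs) * len (adjoin Q xs) (carrier R)"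
  using assms
proof (induct xs arbitrary: Q)
  case Nil
  have "enat (m ^ length []) = 1" by (simp add: one_enat_def)
  then show ?case by simp
next
  case (Cons x xs)
  let ?P = "PIdl (x [^] m)"
  have P: "ideal ?P R" "x \<in> carrier R" "set xs \<subseteq> carrier R" using Cons by (simp_all add: cgenideal_ideal)
  have Q: "ideal (Q \<uplus> ?P) R" using Cons P by (simp add: add_ideals)
  have "len (adjoin Q (map (\<lambda>x. x [^] m) (x # xs))) (carrier R)
    \<le> enat (m ^ length xs) * len (adjoin (Q \<uplus> ?P) xs) (carrier R)"
    using Cons(1)[OF Q P(3)] by simp
  also have "\<dots> \<le> enat (m ^ length xs) * (enat m * len (adjoin Q xs \<uplus> PIdl x) (carrier R))"
    unfolding adjoin_sum[OF Cons(2) P(1,3)]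
    using Cons P by (intro mult_left_mono len_add_power_le) auto
  also have "adjoin Q xs \<uplus> PIdl x = adjoin Q (x # xs)"
    using adjoin_sum[OF Cons(2) cgenideal_ideal[OF P(2)] P(3)] by simp
  finally show ?case by (simp add: mult.assoc[symmetric] mult.commute)
qed

lemma adjoin_principal_pow_le:
  fixes j :: nat
  assumes "ideal J R" "x \<in> carrier R" "ideal A R" "J \<up> M \<subseteq> A"
  shows "(J \<uplus> PIdl x) \<up> (M + j) \<subseteq> A \<uplus> PIdl (x [^] j)"
proof (induct j)
  case 0
  then show ?case
    using assms sum_upper2[OF assms(3) oneideal] ideal_carrier_subset[OF ideal_pow_ideal[of "J \<uplus> PIdl x" M]]
    by (simp add: PIdl_one ideal_ops)
next
  case (Suc j)
  let ?L = "J \<uplus> PIdl x" and ?E = "A \<uplus> PIdl (x [^] Suc j)"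
  have L: "ideal ?L R" using assms by (simp add: ideal_ops)
  have p: "x [^] k \<in> carrier R" "ideal (PIdl (x [^] k)) R" for k :: nat
    using assms by (simp_all add: cgenideal_ideal)
  have E: "ideal ?E R" by (rule add_ideals[OF assms(3) p(2)])
  have up: "A \<subseteq> ?E" "x [^] Suc j \<in> ?E"
    using sum_upper1[OF assms(3) p(2)] sum_upper2[OF assms(3) p(2)[of "Suc j"]]
      cgenideal_self[OF p(1)[of "Suc j"]] by blast+
  have "J \<up> (Suc (M + j)) \<subseteq> J \<up> M" by (rule ideal_pow_antimono[OF assms(1)]) simp
  then have 1: "J \<up> (Suc (M + j)) \<subseteq> ?E" using assms(4) up(1) by blast
  have "A \<uplus> PIdl (x [^] j) \<subseteq> colon ?E x"
  proof -
    have "x [^] j \<in> colon ?E x" using up assms by (simp add: colon_def m_comm)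
    then show ?thesis
      using sum_le_iff[OF assms(3) p(2) colon_ideal[OF E assms(2)]]
        PIdl_le_iff[OF colon_ideal[OF E assms(2)] p(1)] up(1) colon_upper[OF E assms(2)] by blast
  qed
  then have "(PIdl x) \<cdot> ?L \<up> (M + j) \<subseteq> ?E"
    using Suc smul_le_iff[OF assms(2) ideal_pow_ideal[OF L]] by blast
  then have "?L \<up> (Suc (M + j)) \<subseteq> ?E"
    unfolding pow_sum_principal[OF assms(1,2)] using 1 L assms
    by (subst sum_le_iff) (auto intro!: E ideal_ops simp del: Group.nat_pow_Suc)
  then show ?case by (simp only: add_Suc_right)
qed

lemma adjoin_pow_le_of_powers:
  assumes "set xs \<subseteq> carrier R" "ideal A R" "\<forall>x\<in>set xs. \<exists>n::nat. x [^] n \<in> A"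
  shows "\<exists>M. (adjoin {\<zero>} xs) \<up> M \<subseteq> A"
  using assms(1,3)
proof (induct xs rule: rev_induct)
  case Nil
  show ?case using ideal_zero_mem[OF assms(2)]
    by (intro exI[of _ "Suc 0"]) (simp add: prod_one_left zeroideal)
next
  case (snoc x xs)
  obtain M where M: "(adjoin {\<zero>} xs) \<up> M \<subseteq> A" using snoc by auto
  obtain n :: nat where n: "x [^] n \<in> A" using snoc by auto
  have x: "x \<in> carrier R" "set xs \<subseteq> carrier R" using snoc by auto
  have J: "ideal (adjoin {\<zero>} xs) R" using x by (simp add: zeroideal)
  have "(adjoin {\<zero>} (xs @ [x])) \<up> (M + n) \<subseteq> A \<uplus> PIdl (x [^] n)"
    using adjoin_principal_pow_le[OF J x(1) assms(2) M, of n] by (simp add: adjoin_append)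
  also have "\<dots> \<subseteq> A"
    using n x assms(2) by (subst sum_absorb1) (auto simp: cgenideal_ideal PIdl_le_iff)
  finally show ?case by blast
qed

lemma Idl_eq_adjoin: "set xs \<subseteq> carrier R \<Longrightarrow> Idl (set xs) = adjoin {\<zero>} xs"
proof (rule antisym)
  assume xs: "set xs \<subseteq> carrier R"
  show "Idl (set xs) \<subseteq> adjoin {\<zero>} xs"
    using adjoin_mem[OF zeroideal xs] xs by (intro genideal_minimal) (auto simp: zeroideal)
  show "adjoin {\<zero>} xs \<subseteq> Idl (set xs)"
    using xs genideal_ideal[OF xs] genideal_self[OF xs] ideal_zero_mem[OF genideal_ideal[OF xs]]
    by (simp add: adjoin_le_iff zeroideal)
qed

end

context noetherian_ring begin

lemma exists_maximal_ideal_such_that: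
  assumes "ideal A R" "Q A"
  obtains M where "ideal M R" "Q M" "\<And>B. ideal B R \<Longrightarrow> Q B \<Longrightarrow> M \<subseteq> B \<Longrightarrow> B = M"
proof -
  let ?S = "{B. ideal B R \<and> Q B}"
  have "\<exists>M\<in>?S. \<forall>B\<in>?S. M \<subseteq> B \<longrightarrow> B = M"
  proof (rule subset_Zorn_nonempty)
    show "?S \<noteq> {}" using assms by blast
    fix C assume C: "C \<noteq> {}" "subset.chain ?S C"
    then have "subset.chain {I. ideal I R} C" by (auto simp: subset.chain_def)
    then have "\<Union>C \<in> C" using ideal_chain_is_trivial[OF C(1)] by blast
    then show "\<Union>C \<in> ?S" using C by (auto simp: subset.chain_def)
  qed
  then obtain M where "M \<in> ?S" "\<forall>B\<in>?S. M \<subseteq> B \<longrightarrow> B = M" by (rule bexE)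
  then show ?thesis using that[of M] by simp
qed

end

context noetherian_local_ring begin

lemma ideal_gens:
  assumes "ideal A R" obtains xs where "set xs \<subseteq> carrier R" "A = adjoin {\<zero>} xs"
proof -
  obtain S where S: "S \<subseteq> carrier R" "finite S" "A = Idl S" using finetely_gen[OF assms] by blast
  obtain xs where "set xs = S" using finite_list[OF S(2)] by blast
  then show ?thesis using S that[of xs] Idl_eq_adjoin[of xs] by auto
qed

lemma m_ideal [simp]: "ideal \<mm> R"
  using max_ideal by (rule maximalideal.axioms(1))

lemma m_proper: "\<one> \<notin> \<mm>"
  using max_ideal maximalideal.I_notcarr[OF max_ideal] ideal.one_imp_carrier[OF m_ideal] by auto

lemma proper_ideal_le_m:
  assumes "ideal A R" "\<one> \<notin> A" shows "A \<subseteq> \<mm>"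
proof -
  obtain M where M: "ideal M R" "A \<subseteq> M \<and> \<one> \<notin> M"
    "\<And>B. ideal B R \<Longrightarrow> A \<subseteq> B \<and> \<one> \<notin> B \<Longrightarrow> M \<subseteq> B \<Longrightarrow> B = M"
    using exists_maximal_ideal_such_that[of A "\<lambda>B. A \<subseteq> B \<and> \<one> \<notin> B"] assms by blast
  have "maximalideal M R"
  proof (rule maximalidealI[OF M(1)])
    show "carrier R \<noteq> M" using M(2) by auto
    fix J assume J: "ideal J R" "M \<subseteq> J" "J \<subseteq> carrier R"
    show "J = M \<or> J = carrier R"
    proof (cases "\<one> \<in> J")
      case True then show ?thesis using ideal.one_imp_carrier[OF J(1)] by simp
    next
      case False then show ?thesis using M(2) M(3)[OF J(1) _ J(2)] J(2) by auto
    qed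
  qed
  then have "M = \<mm>" by (rule max_ideal_unique)
  then show ?thesis using M(2) by simp
qed

lemma unit_of_not_m:
  assumes "a \<in> carrier R" "a \<notin> \<mm>" shows "a \<in> Units R"
proof -
  have "\<one> \<in> PIdl a"
    using proper_ideal_le_m[OF cgenideal_ideal[OF assms(1)]] cgenideal_self[OF assms(1)] assms(2) by blast
  then obtain b where "b \<in> carrier R" "b \<otimes> a = \<one>" by (auto simp: cgenideal_def)
  then show ?thesis using assms(1) m_comm[of a b] by (auto simp: Units_def)
qed

lemma one_minus_unit: "m \<in> \<mm> \<Longrightarrow> \<one> \<ominus> m \<in> Units R"
proof (rule unit_of_not_m)
  assume m: "m \<in> \<mm>"
  have car: "m \<in> carrier R" by (rule ideal.Icarr[OF m_ideal m])
  then show "\<one> \<ominus> m \<in> carrier R" by simp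
  show "\<one> \<ominus> m \<notin> \<mm>"
    using ideal_add_mem[OF m_ideal _ m, of "\<one> \<ominus> m"] m_proper car by (auto simp: minus_add_cancel_right)
qed

text \<open>
  If \<open>B\<close> is not contained in \<open>A\<close>, choose an ideal \<open>C \<supseteq> A\<close> maximal among those that do not contain
  \<open>B\<close>, and \<open>b \<in> B\<close> outside \<open>C\<close>. Then \<open>B \<subseteq> C + b R\<close>, so \<open>b \<in> C + b \<mm>\<close>; as \<open>1 - m\<close> is a unit for
  \<open>m \<in> \<mm>\<close>, this forces \<open>b \<in> C\<close>.
\<close>

lemma nakayama:
  assumes "ideal A R" "ideal B R" "B \<subseteq> A \<uplus> \<mm> \<cdot> B" shows "B \<subseteq> A"
proof (rule ccontr)
  assume "\<not> B \<subseteq> A"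
  then obtain C where C0: "ideal C R" "A \<subseteq> C \<and> \<not> B \<subseteq> C"
    "\<And>D. ideal D R \<Longrightarrow> A \<subseteq> D \<and> \<not> B \<subseteq> D \<Longrightarrow> C \<subseteq> D \<Longrightarrow> D = C"
    using exists_maximal_ideal_such_that[of A "\<lambda>C. A \<subseteq> C \<and> \<not> B \<subseteq> C"] assms by blast
  then have C: "ideal C R" "A \<subseteq> C" "\<not> B \<subseteq> C" by simp_all
  then obtain b where b: "b \<in> B" "b \<notin> C" by blast
  have bc: "b \<in> carrier R" by (rule ideal.Icarr[OF assms(2) b(1)])
  have P: "ideal (PIdl b) R" by (rule cgenideal_ideal[OF bc])
  have D: "ideal (C \<uplus> PIdl b) R" by (rule add_ideals[OF C(1) P])
  have "C \<subseteq> C \<uplus> PIdl b" "b \<in> C \<uplus> PIdl b"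
    using sum_upper1[OF C(1) P] sum_upper2[OF C(1) P] cgenideal_self[OF bc] by auto
  then have "B \<subseteq> C \<uplus> PIdl b" using C0(3)[OF D] C(2) b(2) by auto
  then have "\<mm> \<cdot> B \<subseteq> \<mm> \<cdot> (C \<uplus> PIdl b)" by (intro prod_mono order_refl)
  also have "\<dots> = \<mm> \<cdot> C \<uplus> (PIdl b) \<cdot> \<mm>"
    using C(1) P by (simp add: ideal_prod_distr ideal_prod_commute)
  also have "\<dots> \<subseteq> C \<uplus> (PIdl b) \<cdot> \<mm>"
    by (intro isum_mono order_refl prod_le2 C m_ideal)
  finally have "A \<uplus> \<mm> \<cdot> B \<subseteq> C \<uplus> (PIdl b) \<cdot> \<mm>"
    using assms C P sum_upper1[of C "(PIdl b) \<cdot> \<mm>"]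
    by (subst sum_le_iff) (auto simp: ideal_ops)
  then have "b \<in> C \<uplus> (PIdl b) \<cdot> \<mm>" using b assms(3) by blast
  then obtain c m where cm: "c \<in> C" "m \<in> \<mm>" "b = c \<oplus> b \<otimes> m"
    using mem_sum_smul_iff[OF bc m_ideal] by blast
  have car: "m \<in> carrier R" "c \<in> carrier R"
    using ideal.Icarr[OF m_ideal cm(2)] ideal.Icarr[OF C(1) cm(1)] by auto
  have "(\<one> \<ominus> m) \<otimes> b = b \<ominus> m \<otimes> b"
    using car bc by (simp add: a_minus_def l_distr l_minus)
  also have "m \<otimes> b = b \<otimes> m" using car bc by (simp add: m_comm)
  also have "b \<ominus> b \<otimes> m = (c \<oplus> b \<otimes> m) \<ominus> b \<otimes> m" by (rule arg_cong[OF cm(3)])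
  also have "\<dots> = c" using car bc by (simp add: a_minus_def a_assoc r_neg)
  finally have "(\<one> \<ominus> m) \<otimes> b \<in> C" using cm(1) by simp
  then show False using unit_cancel_mem[OF C(1) one_minus_unit[OF cm(2)] bc] b(2) by blast
qed

lemma exists_prime_avoiding:
  assumes "ideal Q R" "S \<subseteq> carrier R" "\<one> \<in> S" "\<And>s t. s \<in> S \<Longrightarrow> t \<in> S \<Longrightarrow> s \<otimes> t \<in> S" "Q \<inter> S = {}"
  obtains P where "primeideal P R" "Q \<subseteq> P" "P \<inter> S = {}"
proof -
  obtain P where P0: "ideal P R" "Q \<subseteq> P \<and> P \<inter> S = {}"
    "\<And>D. ideal D R \<Longrightarrow> Q \<subseteq> D \<and> D \<inter> S = {} \<Longrightarrow> P \<subseteq> D \<Longrightarrow> D = P"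
    using exists_maximal_ideal_such_that[of Q "\<lambda>C. Q \<subseteq> C \<and> C \<inter> S = {}"] assms by blast
  then have P: "ideal P R" "Q \<subseteq> P" "P \<inter> S = {}" by simp_all
  have meet: "\<exists>p\<in>P. \<exists>r\<in>carrier R. p \<oplus> a \<otimes> r \<in> S" if a: "a \<in> carrier R" "a \<notin> P" for a
  proof -
    have A: "ideal (PIdl a) R" by (rule cgenideal_ideal[OF a(1)])
    have "P \<subseteq> P \<uplus> PIdl a" "a \<in> P \<uplus> PIdl a"
      using sum_upper1[OF P(1) A] sum_upper2[OF P(1) A] cgenideal_self[OF a(1)] by auto
    then have "(P \<uplus> PIdl a) \<inter> S \<noteq> {}" using P(2) P0(3)[OF add_ideals[OF P(1) A]] a(2) by auto
    then obtain s where "s \<in> S" "s \<in> P \<uplus> (PIdl a) \<cdot> carrier R" by (auto simp: ideal_prod_one[OF A])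
    then show ?thesis unfolding mem_sum_smul_iff[OF a(1) oneideal] by auto
  qed
  have "primeideal P R"
  proof (rule primeidealI[OF P(1) is_cring])
    show "carrier R \<noteq> P" using P(3) assms(3) by auto
    fix a b assume ab: "a \<in> carrier R" "b \<in> carrier R" "a \<otimes> b \<in> P"
    show "a \<in> P \<or> b \<in> P"
    proof (rule ccontr)
      assume "\<not> ?thesis"
      then obtain p r q t where h: "p \<in> P" "r \<in> carrier R" "p \<oplus> a \<otimes> r \<in> S" "q \<in> P" "t \<in> carrier R" "q \<oplus> b \<otimes> t \<in> S"
        using meet[of a] meet[of b] ab by blast
      have car: "p \<in> carrier R" "q \<in> carrier R" using ideal.Icarr[OF P(1)] h(1,4) by auto
      have "(p \<oplus> a \<otimes> r) \<otimes> (q \<oplus> b \<otimes> t) = (p \<oplus> a \<otimes> r) \<otimes> q \<oplus> ((b \<otimes> t) \<otimes> p \<oplus> (r \<otimes> t) \<otimes> (a \<otimes> b))"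
        using car h(2,5) ab(1,2) by (simp add: r_distr l_distr m_ac)
      moreover have "\<dots> \<in> P"
        using car h(2,5) ab(1,2)
          ideal_mult_mem[OF P(1) h(4), of "p \<oplus> a \<otimes> r"] ideal_mult_mem[OF P(1) h(1), of "b \<otimes> t"]
          ideal_mult_mem[OF P(1) ab(3), of "r \<otimes> t"]
        by (intro ideal_add_mem[OF P(1)]) auto
      ultimately have "(p \<oplus> a \<otimes> r) \<otimes> (q \<oplus> b \<otimes> t) \<in> P \<inter> S" using assms(4)[OF h(3,6)] by simp
      then show False using P(3) by blast
    qed
  qed
  then show ?thesis using that P by blast
qed

text \<open>
  Openness in the \<open>\<mm>\<close>-adic topology. The unit ideal is included, so the open ideals are exactly the
  ideals of finite colength.
\<close>

definition open_ideal :: "'a set \<Rightarrow> bool" where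
  "open_ideal A \<longleftrightarrow> ideal A R \<and> (\<exists>M. \<mm> \<up> M \<subseteq> A)"

lemma open_idealD: "open_ideal A \<Longrightarrow> ideal A R"
  by (simp add: open_ideal_def)

lemma open_ideal_mono: "open_ideal A \<Longrightarrow> ideal B R \<Longrightarrow> A \<subseteq> B \<Longrightarrow> open_ideal B"
  by (auto simp: open_ideal_def)

lemma open_ideal_m: "open_ideal \<mm>" and open_ideal_carrier: "open_ideal (carrier R)"
  by (auto simp: open_ideal_def oneideal prod_one_left ideal.Icarr[OF m_ideal] intro!: exI[of _ "Suc 0"])

lemma open_idealI_powers:
  assumes "ideal A R" "\<And>a. a \<in> \<mm> \<Longrightarrow> \<exists>n::nat. a [^] n \<in> A" shows "open_ideal A"
proof -
  obtain xs where xs: "set xs \<subseteq> carrier R" "\<mm> = adjoin {\<zero>} xs" using ideal_gens[OF m_ideal] by blast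
  have "\<forall>x\<in>set xs. \<exists>n::nat. x [^] n \<in> A" using assms(2) adjoin_mem[OF zeroideal xs(1)] xs(2) by blast
  then show ?thesis
    using adjoin_pow_le_of_powers[OF xs(1) assms(1)] assms(1)
    unfolding open_ideal_def xs(2)[symmetric] by simp
qed

lemma open_ideal_powers: "open_ideal A \<Longrightarrow> a \<in> \<mm> \<Longrightarrow> \<exists>n::nat. a [^] n \<in> A"
  unfolding open_ideal_def using elt_pow_mem[OF m_ideal] by blast

lemma open_ideal_prod: assumes "open_ideal A" "open_ideal B" shows "open_ideal (A \<cdot> B)"
proof -
  obtain M N where "\<mm> \<up> M \<subseteq> A" "\<mm> \<up> N \<subseteq> B" using assms by (auto simp: open_ideal_def)
  then have "\<mm> \<up> (M + N) \<subseteq> A \<cdot> B" by (simp add: ideal_pow_add prod_mono)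
  then show ?thesis using assms by (auto simp: open_ideal_def ideal_prod_is_ideal)
qed

lemma open_ideal_pow: "open_ideal A \<Longrightarrow> open_ideal (A \<up> n)"
  by (induct n) (auto intro: open_ideal_prod open_ideal_carrier)

lemma len_m: "len \<mm> (carrier R) = 1"
proof (rule antisym)
  show "len \<mm> (carrier R) \<le> 1"
  proof (rule len_le)
    fix n :: nat and N assume N: "\<forall>i\<le>n. ideal (N i) R \<and> \<mm> \<subseteq> N i \<and> N i \<subseteq> carrier R" "\<forall>i<n. N i \<subset> N (Suc i)"
    show "enat n \<le> 1"
    proof (rule ccontr)
      assume "\<not> enat n \<le> 1"
      then have n: "n \<ge> 2" by (simp add: one_enat_def)
      have "N 1 = \<mm> \<or> N 1 = carrier R" using maximalideal.I_maximal[OF max_ideal, of "N 1"] N(1) n by auto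
      moreover have "N 0 \<subset> N 1" "N 1 \<subset> N 2" using N(2) n by (auto simp: numeral_2_eq_2)
      moreover have "\<mm> \<subseteq> N 0" "N 2 \<subseteq> carrier R" using N(1) n by auto
      ultimately show False by blast
    qed
  qed
  show "1 \<le> len \<mm> (carrier R)"
    using m_proper ideal_carrier_subset[OF m_ideal] by (intro len_pos oneideal) auto
qed

lemma open_ideal_finite_len:
  assumes "open_ideal A" shows "\<exists>k. len A (carrier R) = enat k"
proof -
  obtain xs where xs: "set xs \<subseteq> carrier R" "\<mm> = adjoin {\<zero>} xs" using ideal_gens[OF m_ideal] by blast
  obtain M where M: "\<mm> \<up> M \<subseteq> A" "ideal A R" using assms by (auto simp: open_ideal_def)
  let ?ys = "map (\<lambda>x. x [^] M) xs"
  have "x [^] M \<in> A" if "x \<in> set xs" for x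
    using elt_pow_mem[OF m_ideal, of x M] that adjoin_mem[OF zeroideal xs(1)] xs(2) M by blast
  then have "adjoin {\<zero>} ?ys \<subseteq> A"
    using xs M ideal_zero_mem[OF M(2)] by (subst adjoin_le_iff) (auto simp: zeroideal)
  then have "len A (carrier R) \<le> len (adjoin {\<zero>} ?ys) (carrier R)" by (rule len_mono) simp
  also have "\<dots> \<le> enat (M ^ length xs)"
    using len_adjoin_powers_le[OF zeroideal xs(1), of M] by (simp add: xs(2)[symmetric] len_m)
  finally show ?thesis using enat_ile by blast
qed

section \<open>Regular sequences in a local ring\<close>

text \<open>
  Regular sequences in a local ring may be permuted. That \<open>b\<close> becomes a nonzerodivisor modulo \<open>Q\<close>
  is where locality enters: \<open>N = (Q : b)\<close> satisfies \<open>N \<subseteq> Q + a N\<close>.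
\<close>

lemma swap_regular:
  assumes Q: "ideal Q R" and a: "a \<in> \<mm>" and b: "b \<in> \<mm>"
    and ra: "colon Q a \<subseteq> Q" and rb: "colon (Q \<uplus> PIdl a) b \<subseteq> Q \<uplus> PIdl a"
  shows "colon Q b \<subseteq> Q" "colon (Q \<uplus> PIdl b) a \<subseteq> Q \<uplus> PIdl b"
proof -
  have ac: "a \<in> carrier R" and bc: "b \<in> carrier R" using ideal.Icarr[OF m_ideal] a b by auto
  have PA: "ideal (PIdl a) R" and PB: "ideal (PIdl b) R" using ac bc by (auto intro: cgenideal_ideal)
  have mem_a: "y \<in> Q \<uplus> PIdl a \<longleftrightarrow> (\<exists>q\<in>Q. \<exists>r\<in>carrier R. y = q \<oplus> a \<otimes> r)" for y
    using mem_sum_smul_iff[OF ac oneideal, of y Q] by (simp add: ideal_prod_one[OF PA])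
  have mem_b: "y \<in> Q \<uplus> PIdl b \<longleftrightarrow> (\<exists>q\<in>Q. \<exists>r\<in>carrier R. y = q \<oplus> b \<otimes> r)" for y
    using mem_sum_smul_iff[OF bc oneideal, of y Q] by (simp add: ideal_prod_one[OF PB])
  have raD: "r \<in> Q" if "r \<in> carrier R" "a \<otimes> r \<in> Q" for r using ra that by (auto simp: colon_def)
  have rbD: "r \<in> Q \<uplus> PIdl a" if "r \<in> carrier R" "b \<otimes> r \<in> Q \<uplus> PIdl a" for r
    using rb that by (auto simp: colon_def)
  let ?N = "colon Q b"
  have N: "ideal ?N R" by (rule colon_ideal[OF Q bc])
  have "?N \<subseteq> Q \<uplus> \<mm> \<cdot> ?N"
  proof
    fix c assume "c \<in> ?N"
    then have c: "c \<in> carrier R" "b \<otimes> c \<in> Q" by (auto simp: colon_def)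
    then have "b \<otimes> c \<in> Q \<uplus> PIdl a" using sum_upper1[OF Q PA] by blast
    then have "c \<in> Q \<uplus> PIdl a" using rbD c by blast
    then obtain q r where qr: "q \<in> Q" "r \<in> carrier R" "c = q \<oplus> a \<otimes> r" unfolding mem_a by blast
    have qc: "q \<in> carrier R" by (rule ideal.Icarr[OF Q qr(1)])
    have "b \<otimes> q \<oplus> a \<otimes> (b \<otimes> r) \<in> Q"
      using c(2) qc ac bc qr(2) unfolding qr(3) by (simp add: r_distr m_lcomm)
    then have "a \<otimes> (b \<otimes> r) \<in> Q"
      using ideal_cancel[OF Q ideal_mult_mem[OF Q qr(1) bc]] ac bc qr(2) by simp
    then have "r \<in> ?N" using raD bc qr(2) by (simp add: colon_def)
    then have "a \<otimes> r \<in> \<mm> \<cdot> ?N" using a by (intro ideal_prod.prod)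
    then show "c \<in> Q \<uplus> \<mm> \<cdot> ?N" unfolding mem_sum_iff using qr by blast
  qed
  then show "colon Q b \<subseteq> Q" by (rule nakayama[OF Q N])
  show "colon (Q \<uplus> PIdl b) a \<subseteq> Q \<uplus> PIdl b"
  proof
    fix c assume "c \<in> colon (Q \<uplus> PIdl b) a"
    then have c: "c \<in> carrier R" "a \<otimes> c \<in> Q \<uplus> PIdl b" by (auto simp: colon_def)
    then obtain q e where qe: "q \<in> Q" "e \<in> carrier R" "a \<otimes> c = q \<oplus> b \<otimes> e" unfolding mem_b by blast
    have qc: "q \<in> carrier R" by (rule ideal.Icarr[OF Q qe(1)])
    have "b \<otimes> e \<in> Q \<uplus> PIdl a"
      using ideal_cancel[OF add_ideals[OF Q PA], of q "b \<otimes> e"] sum_upper1[OF Q PA] sum_upper2[OF Q PA]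
        qe(1,2) bc ideal_mult_mem'[OF PA cgenideal_self[OF ac] c(1)] qe(3) by auto
    then have "e \<in> Q \<uplus> PIdl a" using rbD qe(2) by blast
    then obtain q' r where qr: "q' \<in> Q" "r \<in> carrier R" "e = q' \<oplus> a \<otimes> r" unfolding mem_a by blast
    have qc': "q' \<in> carrier R" by (rule ideal.Icarr[OF Q qr(1)])
    have "\<zero> \<oplus> a \<otimes> c = (q \<oplus> b \<otimes> q') \<oplus> a \<otimes> (b \<otimes> r)"
      unfolding qe(3) qr(3) using qc qc' ac bc qr(2) by (simp add: r_distr a_assoc m_lcomm)
    then have "a \<otimes> c \<ominus> a \<otimes> (b \<otimes> r) = (q \<oplus> b \<otimes> q') \<ominus> \<zero>"
      using qc qc' ac bc c(1) qr(2) by (intro add_eq_minus) auto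
    then have "a \<otimes> (c \<ominus> b \<otimes> r) = q \<oplus> b \<otimes> q'"
      using qc qc' ac bc c(1) qr(2) by (simp add: smult_minus) (simp add: a_minus_def)
    moreover have "q \<oplus> b \<otimes> q' \<in> Q" using qe(1) qr(1) bc by (intro ideal_add_mem[OF Q] ideal_mult_mem[OF Q])
    ultimately have "c \<ominus> b \<otimes> r \<in> Q" using raD[of "c \<ominus> b \<otimes> r"] c(1) bc qr(2) by simp
    moreover have "c = (c \<ominus> b \<otimes> r) \<oplus> b \<otimes> r" using c(1) bc qr(2) by (simp add: minus_add_cancel_right)
    ultimately show "c \<in> Q \<uplus> PIdl b" unfolding mem_b using qr(2) by blast
  qed
qed

lemma PIdl_sum_commute:
  "ideal Q R \<Longrightarrow> a \<in> carrier R \<Longrightarrow> b \<in> carrier R \<Longrightarrow> Q \<uplus> PIdl a \<uplus> PIdl b = Q \<uplus> PIdl b \<uplus> PIdl a"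
  by (simp add: cgenideal_ideal sum_assoc sum_commute[of "PIdl a" "PIdl b"])

lemma regular_mod_rotate:
  assumes "ideal Q R" "z \<in> \<mm>" "set us \<subseteq> \<mm>"
  shows "regular_mod Q (z # us) \<longleftrightarrow> regular_mod Q (us @ [z])"
  using assms(1,3)
proof (induct us arbitrary: Q)
  case (Cons u us)
  have car: "z \<in> carrier R" "u \<in> carrier R" using ideal.Icarr[OF m_ideal] assms Cons by auto
  have U: "ideal (Q \<uplus> PIdl u) R" using car Cons by (simp add: ideal_ops)
  have IH: "regular_mod (Q \<uplus> PIdl u) (z # us) \<longleftrightarrow> regular_mod (Q \<uplus> PIdl u) (us @ [z])"
    using Cons(1)[OF U] Cons(3) by simp
  have u: "u \<in> \<mm>" using Cons(3) by simp
  have sw: "colon Q z \<subseteq> Q \<and> colon (Q \<uplus> PIdl z) u \<subseteq> Q \<uplus> PIdl z \<longleftrightarrow>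
      colon Q u \<subseteq> Q \<and> colon (Q \<uplus> PIdl u) z \<subseteq> Q \<uplus> PIdl u"
    using swap_regular[OF Cons(2) assms(2) u] swap_regular[OF Cons(2) u assms(2)] by (intro iffI conjI) simp_all
  have "regular_mod Q (z # u # us) \<longleftrightarrow> (colon Q z \<subseteq> Q \<and> colon (Q \<uplus> PIdl z) u \<subseteq> Q \<uplus> PIdl z) \<and>
      regular_mod (Q \<uplus> PIdl z \<uplus> PIdl u) us" by simp
  also have "\<dots> \<longleftrightarrow> colon Q u \<subseteq> Q \<and> regular_mod (Q \<uplus> PIdl u) (z # us)"
    unfolding sw PIdl_sum_commute[OF Cons(2) car] by simp
  also have "\<dots> \<longleftrightarrow> regular_mod Q ((u # us) @ [z])" unfolding IH by simp
  finally show ?case .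
qed simp

text \<open>
  If \<open>w a \<in> B\<close>, then \<open>z\<^sup>N a \<in> B\<close>, because \<open>z\<^sup>N\<close> is a multiple of \<open>w\<close> modulo \<open>B\<close>; now cancel \<open>z\<close>.
\<close>

lemma regular_exchange:
  fixes N :: nat
  assumes "ideal B R" "z \<in> carrier R" "w \<in> carrier R" "colon B z \<subseteq> B" "z [^] N \<in> B \<uplus> PIdl w"
  shows "colon B w \<subseteq> B"
proof
  fix a assume "a \<in> colon B w"
  then have a: "a \<in> carrier R" "w \<otimes> a \<in> B" by (auto simp: colon_def)
  have W: "ideal (PIdl w) R" by (rule cgenideal_ideal[OF assms(3)])
  obtain b r where br: "b \<in> B" "r \<in> carrier R" "z [^] N = b \<oplus> w \<otimes> r"
    using assms(5) mem_sum_smul_iff[OF assms(3) oneideal, of _ B] by (auto simp: ideal_prod_one[OF W])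
  have bc: "b \<in> carrier R" by (rule ideal.Icarr[OF assms(1) br(1)])
  have "z [^] N \<otimes> a = a \<otimes> b \<oplus> r \<otimes> (w \<otimes> a)"
    unfolding br(3) using bc br(2) a(1) assms(3) by (subst l_distr) (simp_all add: m_ac)
  then have zN: "z [^] N \<otimes> a \<in> B"
    using ideal_add_mem[OF assms(1) ideal_mult_mem[OF assms(1) br(1) a(1)] ideal_mult_mem[OF assms(1) a(2) br(2)]] by simp
  have "z [^] k \<otimes> a \<in> B \<Longrightarrow> a \<in> B" for k :: nat
  proof (induct k)
    case (Suc k)
    then have "z \<otimes> (z [^] k \<otimes> a) \<in> B" using assms(2) a(1) by (simp add: m_ac)
    then have "z [^] k \<otimes> a \<in> B" using assms(2,4) a(1) by (auto simp: colon_def)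
    then show ?case by (rule Suc)
  qed (use a in simp)
  then show "a \<in> B" using zN by blast
qed

text \<open>
  A prime ideal that contains a regular sequence of length \<open>n\<close> has height at least \<open>n\<close>. The step
  localizes at \<open>P\<close> and inverts \<open>y\<close>: the multiplicative set of the elements \<open>a y\<^sup>n\<close> with \<open>a \<notin> P\<close> misses
  \<open>J\<close> since \<open>y\<close> is a nonzerodivisor modulo \<open>J\<close>, so a prime ideal over \<open>J\<close> avoids it. That prime lies
  in \<open>P\<close> and does not contain \<open>y\<close>.
\<close>

lemma regular_prime_chain:
  assumes "set ys \<subseteq> carrier R" "regular_mod {\<zero>} ys" "primeideal P R" "adjoin {\<zero>} ys \<subseteq> P"
  shows "\<exists>C. (\<forall>i\<le>length ys. primeideal (C i) R) \<and> (\<forall>i<length ys. C i \<subset> C (Suc i)) \<and> C (length ys) = P"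
  using assms
proof (induct ys arbitrary: P rule: rev_induct)
  case Nil then show ?case by auto
next
  case (snoc y ys)
  let ?J = "adjoin {\<zero>} ys"
  have y: "y \<in> carrier R" "set ys \<subseteq> carrier R" and r: "regular_mod {\<zero>} ys" "colon ?J y \<subseteq> ?J"
    using snoc by (auto simp: regular_mod_append)
  have J: "ideal ?J R" using y by (simp add: zeroideal)
  interpret P: primeideal P R by (rule snoc(4))
  have JP: "?J \<subseteq> P" "y \<in> P"
    using snoc(5) sum_le_iff[OF J cgenideal_ideal[OF y(1)] P.is_ideal] PIdl_le_iff[OF P.is_ideal y(1)]
    by (auto simp: adjoin_append)
  define S where "S = {a \<otimes> y [^] n | a n. a \<in> carrier R - P \<and> n \<in> (UNIV :: nat set)}"
  have one: "\<one> \<in> carrier R - P" using P.I_notcarr ideal.one_imp_carrier[OF P.is_ideal] by auto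
  have S_in: "a \<otimes> y [^] n \<in> S" if "a \<in> carrier R - P" for a and n :: nat using that by (auto simp: S_def)
  have "S \<subseteq> carrier R" using y by (auto simp: S_def)
  moreover have "\<one> \<in> S" using S_in[OF one, of 0] by simp
  moreover have "s \<otimes> t \<in> S" if st: "s \<in> S" "t \<in> S" for s t
  proof -
    obtain a b and n k :: nat
      where *: "s = a \<otimes> y [^] n" "t = b \<otimes> y [^] k" "a \<in> carrier R - P" "b \<in> carrier R - P"
      using st by (auto simp: S_def)
    then have "s \<otimes> t = (a \<otimes> b) \<otimes> y [^] (n + k)" using y by (simp add: m_ac nat_pow_mult[symmetric])
    moreover have "a \<otimes> b \<in> carrier R - P" using * P.I_prime[of a b] by auto
    ultimately show ?thesis using S_in by simp
  qed
  moreover have "?J \<inter> S = {}"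
  proof -
    have "a \<otimes> y [^] n \<notin> ?J" if a: "a \<in> carrier R" "a \<notin> P" for a and n :: nat
    proof (induct n)
      case 0 then show ?case using a JP by auto
    next
      case (Suc n)
      have "a \<otimes> y [^] Suc n = y \<otimes> (a \<otimes> y [^] n)" using a y by (simp add: m_ac)
      then show ?case using Suc colonD[OF r(2), of "a \<otimes> y [^] n"] a y by auto
    qed
    then show ?thesis by (auto simp: S_def)
  qed
  ultimately obtain Q where Q: "primeideal Q R" "?J \<subseteq> Q" "Q \<inter> S = {}"
    using exists_prime_avoiding[OF J, of S] by blast
  have "Q \<subseteq> P"
  proof
    fix q assume q: "q \<in> Q"
    then have qc: "q \<in> carrier R" using ideal.Icarr[OF primeideal.axioms(1)[OF Q(1)]] by blast
    then show "q \<in> P" using Q(3) q S_in[of q 0] by auto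
  qed
  moreover have "y \<notin> Q" using Q(3) S_in[OF one, of 1] y by auto
  ultimately have QP: "Q \<subset> P" using JP by blast
  obtain C where C: "\<forall>i\<le>length ys. primeideal (C i) R" "\<forall>i<length ys. C i \<subset> C (Suc i)" "C (length ys) = Q"
    using snoc(1)[OF y(2) r(1) Q(1,2)] by blast
  show ?case
    by (rule exI[of _ "\<lambda>i. if i \<le> length ys then C i else P"])
      (use C QP snoc(4) in \<open>auto simp: less_Suc_eq Suc_le_eq\<close>)
qed

text \<open>
  Otherwise a prime ideal other than \<open>\<mm>\<close> contains the sequence, and the chain below it, extended by
  \<open>\<mm>\<close>, is longer than the dimension.
\<close>

lemma regular_open:
  assumes "krull_dim R = enat (length ys)" "set ys \<subseteq> \<mm>" "regular_mod {\<zero>} ys"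
  shows "open_ideal (adjoin {\<zero>} ys)"
proof (rule open_idealI_powers)
  have ys: "set ys \<subseteq> carrier R" using assms(2) ideal_carrier_subset[OF m_ideal] by blast
  let ?J = "adjoin {\<zero>} ys"
  show J: "ideal ?J R" using ys by (simp add: zeroideal)
  fix a assume a: "a \<in> \<mm>"
  have ac: "a \<in> carrier R" by (rule ideal.Icarr[OF m_ideal a])
  show "\<exists>n::nat. a [^] n \<in> ?J"
  proof (rule ccontr)
    assume n: "\<nexists>n::nat. a [^] n \<in> ?J"
    let ?S = "range (\<lambda>n::nat. a [^] n)"
    have "?S \<subseteq> carrier R" using ac by auto
    moreover have "\<one> \<in> ?S" using ac by (metis nat_pow_0 rangeI)
    moreover have "s \<otimes> t \<in> ?S" if "s \<in> ?S" "t \<in> ?S" for s t using that ac by (auto simp: nat_pow_mult)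
    moreover have "?J \<inter> ?S = {}" using n by auto
    ultimately obtain P where P: "primeideal P R" "?J \<subseteq> P" "P \<inter> ?S = {}"
      using exists_prime_avoiding[OF J, of ?S] by blast
    have Pi: "ideal P R" using P(1) by (rule primeideal.axioms(1))
    have "P \<subseteq> \<mm>"
      using P(1) ideal.one_imp_carrier[OF Pi] primeideal.I_notcarr[OF P(1)] by (intro proper_ideal_le_m[OF Pi]) auto
    moreover have "a \<in> ?S" using ac by (intro image_eqI[of _ _ "1::nat"]) auto
    then have "a \<notin> P" using P(3) by blast
    ultimately have Pm: "P \<subset> \<mm>" using a by blast
    obtain C where C: "\<forall>i\<le>length ys. primeideal (C i) R" "\<forall>i<length ys. C i \<subset> C (Suc i)" "C (length ys) = P"
      using regular_prime_chain[OF ys assms(3) P(1,2)] by blast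
    let ?C = "\<lambda>i. if i \<le> length ys then C i else \<mm>"
    have "enat (Suc (length ys)) \<le> krull_dim R"
      unfolding krull_dim_def
    proof (intro Sup_upper CollectI exI[of _ "Suc (length ys)"] exI[of _ ?C] conjI refl)
      show "\<forall>i\<le>Suc (length ys). primeideal (?C i) R" using C maximalideal_prime[OF max_ideal] by auto
      show "\<forall>i<Suc (length ys). ?C i \<subset> ?C (Suc i)" using C Pm by (auto simp: less_Suc_eq Suc_le_eq)
    qed
    then show False using assms(1) by simp
  qed
qed

end

section \<open>Generic reductions\<close>

text \<open>
  The binomial coefficient has degree \<open>p + 1\<close> in \<open>n\<close>.
\<close>

lemma power_lt_binomial:
  assumes "e \<le> p" shows "\<exists>n. C * n ^ e < (n + p) choose (p + 1)"
proof -
  define n where "n = C * (p + 1) ^ (p + 1) + 1"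
  have "real n * (real n ^ p) / (real (p + 1) ^ (p + 1)) \<le> (real (n + p) / real (p + 1)) ^ (p + 1)"
    unfolding power_divide by (intro divide_right_mono) (auto intro: power_mono simp flip: power_Suc)
  also have "\<dots> \<le> real ((n + p) choose (p + 1))"
    using binomial_ge_n_over_k_pow_k[of "p + 1" "n + p", where ?'a = real] by (simp add: n_def)
  finally have "real n * (real n ^ p) / (real (p + 1) ^ (p + 1)) \<le> real ((n + p) choose (p + 1))" .
  moreover have "real C * real n ^ p < real n * (real n ^ p) / (real (p + 1) ^ (p + 1))"
  proof -
    have "real n = real C * real (p + 1) ^ (p + 1) + 1"
      unfolding n_def by (simp only: of_nat_add of_nat_mult of_nat_power of_nat_1)
    then have "real C * real (p + 1) ^ (p + 1) < real n" by linarith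
    moreover have "n > 0" by (simp add: n_def)
    then have "real n ^ p > 0" by simp
    ultimately have "(real C * real (p + 1) ^ (p + 1)) * real n ^ p < real n * real n ^ p"
      by (rule mult_strict_right_mono)
    moreover have "0 < real (p + 1) ^ (p + 1)" by simp
    ultimately show ?thesis by (subst pos_less_divide_eq) (simp_all only: ac_simps)
  qed
  ultimately have "real (C * n ^ p) < real ((n + p) choose (p + 1))" by simp
  then have "C * n ^ p < (n + p) choose (p + 1)" by (simp only: of_nat_less_iff)
  moreover have "C * n ^ e \<le> C * n ^ p" using assms by (intro mult_left_mono power_increasing) (auto simp: n_def)
  ultimately show ?thesis using le_less_trans by blast
qed

context cring begin

lemma smul_assoc: "a \<in> carrier R \<Longrightarrow> b \<in> carrier R \<Longrightarrow> ideal B R \<Longrightarrow> (PIdl (a \<otimes> b)) \<cdot> B = (PIdl a) \<cdot> ((PIdl b) \<cdot> B)"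
proof (rule Set.set_eqI)
  fix y assume a: "a \<in> carrier R" and b: "b \<in> carrier R" and B: "ideal B R"
  have bB: "ideal ((PIdl b) \<cdot> B) R" using b B by (simp add: ideal_ops)
  have "y \<in> (PIdl (a \<otimes> b)) \<cdot> B \<longleftrightarrow> (\<exists>r\<in>B. y = a \<otimes> (b \<otimes> r))"
    unfolding mem_smul_iff[OF m_closed[OF a b] B] using a b ideal.Icarr[OF B] by (auto simp: m_assoc)
  also have "\<dots> \<longleftrightarrow> (\<exists>z\<in>(PIdl b) \<cdot> B. y = a \<otimes> z)" unfolding Bex_def mem_smul_iff[OF b B] by auto
  finally show "y \<in> (PIdl (a \<otimes> b)) \<cdot> B \<longleftrightarrow> y \<in> (PIdl a) \<cdot> ((PIdl b) \<cdot> B)"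
    unfolding mem_smul_iff[OF a bB] .
qed

text \<open>
  The elements \<open>x\<close> and \<open>xs\<close> are thought of as coordinates, and \<open>bs\<close> as the point of the grid whose
  coordinates relative to \<open>x\<close> are the values \<open>c b\<close>. The hypothesis says that no power of \<open>x\<close>
  vanishes at a point of the grid. A polynomial that vanishes on the whole grid is zero; accordingly
  there is no relation of degree \<open>n\<close>, and the quotient by \<open>Q n\<close> is at least as long as the space
  of forms of degree \<open>n\<close>.

  The induction removes the coordinate \<open>y\<close>. With \<open>v j = y - c j x\<close> and \<open>Y j = v 0 \<cdots> v (j - 1)\<close>,
  filter the forms of degree \<open>n\<close> by divisibility by \<open>Y 0, Y 1, \<dots>\<close>. The \<open>j\<close>-th quotient
  consists of forms on the hyperplane \<open>v j = 0\<close>, and there \<open>Y j\<close> is a unit multiple of \<open>x\<^sup>j\<close>, so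
  the hypothesis is inherited by that hyperplane.
\<close>

lemma len_pow_ge_binomial:
  fixes c :: "nat \<Rightarrow> 'a"
  assumes N: "ideal N R" and x: "x \<in> N"
    and c: "\<And>i. c i \<in> carrier R" "\<And>i j. i \<noteq> j \<Longrightarrow> c i \<ominus> c j \<in> Units R"
    and xs: "set xs \<subseteq> N" and Q: "\<And>n. ideal (Q n) R"
    and indep: "\<And>bs n. length bs = length xs \<Longrightarrow>
      x [^] n \<notin> adjoin {\<zero>} (map2 (\<lambda>y b. y \<ominus> c b \<otimes> x) xs bs) \<cdot> N \<up> (n - 1) \<uplus> Q n"
  shows "enat ((n + length xs) choose length xs) \<le> len (Q n) (Q n \<uplus> N \<up> n)"
  using xs Q indep
proof (induct xs arbitrary: Q n)
  case Nil
  have N': "ideal (N \<up> k) R" for k by (rule ideal_pow_ideal[OF N])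
  have "x [^] n \<notin> Q n"
    using Nil(3)[of "[]" n] by (simp add: prod_zero_left N' zero_sum Nil(2))
  moreover have "x [^] n \<in> Q n \<uplus> N \<up> n"
    using sum_upper2[OF Nil(2) N'] elt_pow_mem[OF N x] by blast
  ultimately have "Q n \<subset> Q n \<uplus> N \<up> n" using sum_upper1[OF Nil(2) N'] by blast
  then have "1 \<le> len (Q n) (Q n \<uplus> N \<up> n)" by (intro len_pos Nil add_ideals N')
  then show ?case by (simp add: one_enat_def)
next
  case (Cons y xs)
  have N': "ideal (N \<up> k) R" for k by (rule ideal_pow_ideal[OF N])
  have xc: "x \<in> carrier R" and yc: "y \<in> carrier R" and y: "y \<in> N" and xs: "set xs \<subseteq> N"
    using ideal.Icarr[OF N x] ideal.Icarr[OF N, of y] Cons(2) by auto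
  have xsc: "set xs \<subseteq> carrier R" using xs ideal_carrier_subset[OF N] by blast
  define v where "v j = y \<ominus> c j \<otimes> x" for j
  have v: "v j \<in> N" for j
    unfolding v_def using ideal_minus_mem[OF N y ideal_mult_mem[OF N x c(1)]] .
  have vc: "v j \<in> carrier R" for j by (rule ideal.Icarr[OF N v])
  define Y where "Y = rec_nat \<one> (\<lambda>i r. v i \<otimes> r)"
  have Y0: "Y 0 = \<one>" and YS: "Y (Suc j) = v j \<otimes> Y j" for j by (simp_all add: Y_def)
  have YN: "Y j \<in> N \<up> j" for j
    by (induct j) (use v in \<open>auto simp: Y0 YS ideal_prod_commute[OF N' N] intro: ideal_prod.prod\<close>)
  have Yc: "Y j \<in> carrier R" for j by (rule ideal.Icarr[OF N' YN])
  have PY: "ideal (PIdl (Y j)) R" for j by (rule cgenideal_ideal[OF Yc])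
  have PYN: "PIdl (Y j) \<subseteq> N \<up> j" for j using PIdl_le_iff[OF N' Yc] YN by blast
  define T where "T n j = Q n \<uplus> (PIdl (Y j)) \<cdot> N \<up> (n - j)" for n j
  have YNi: "ideal ((PIdl (Y j)) \<cdot> N \<up> k) R" for j k by (rule ideal_prod_is_ideal[OF PY N'])
  have T: "ideal (T n j) R" for n j unfolding T_def by (rule add_ideals[OF Cons(3) YNi])
  \<comment> \<open>The relations of degree \<open>m\<close> on the hyperplane where \<open>v j\<close> vanishes.\<close>
  define Q' where "Q' j m = colon (T (m + j) (Suc j)) (Y j)" for j m
  have Q': "ideal (Q' j m) R" for j m unfolding Q'_def by (rule colon_ideal[OF T Yc])
  have indep': "x [^] m \<notin> adjoin {\<zero>} (map2 (\<lambda>y b. y \<ominus> c b \<otimes> x) xs bs) \<cdot> N \<up> (m - 1) \<uplus> Q' j m"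
    if bs: "length bs = length xs" for bs m j
  proof
    let ?ws = "map2 (\<lambda>y b. y \<ominus> c b \<otimes> x) xs bs"
    define V where "V = adjoin {\<zero>} ?ws"
    define W where "W = adjoin {\<zero>} (map2 (\<lambda>y b. y \<ominus> c b \<otimes> x) (y # xs) (j # bs))"
    have ws: "set ?ws \<subseteq> carrier R" using xsc c(1) xc by (auto dest!: set_zip_leftD)
    have V: "ideal V R" unfolding V_def using ws by (simp add: zeroideal)
    have Wc: "set (map2 (\<lambda>y b. y \<ominus> c b \<otimes> x) (y # xs) (j # bs)) \<subseteq> carrier R" using ws vc[of j] by (simp add: v_def)
    have W: "ideal W R" unfolding W_def by (rule adjoin_ideal[OF zeroideal Wc])
    have vW: "v j \<in> W"
      using adjoin_mem[OF zeroideal Wc] unfolding W_def by (simp add: v_def)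
    have VW: "V \<subseteq> W"
      using adjoin_mem[OF zeroideal Wc] adjoin_upper[OF zeroideal Wc] ws
      unfolding V_def W_def[symmetric] by (simp add: adjoin_le_iff zeroideal W)
    define E where "E = W \<cdot> N \<up> (m + j - 1) \<uplus> Q (m + j)"
    have WN: "ideal (W \<cdot> N \<up> k) R" for k by (rule ideal_prod_is_ideal[OF W N'])
    have E: "ideal E R" unfolding E_def by (rule add_ideals[OF WN Cons(3)])
    have E1: "W \<cdot> N \<up> k \<subseteq> E" if "m + j - 1 \<le> k" for k
      using sum_upper1[OF WN Cons(3)] prod_mono[OF order_refl ideal_pow_antimono[OF N that]]
      unfolding E_def by blast
    have E2: "Q (m + j) \<subseteq> E" unfolding E_def by (rule sum_upper2[OF WN Cons(3)])
    \<comment> \<open>Modulo \<open>v j\<close>, each factor \<open>v k\<close> of \<open>Y j\<close> is the unit \<open>c j - c k\<close> times \<open>x\<close>, so the factors can be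
      traded one by one for powers of \<open>x\<close>.\<close>
    have down: "k \<le> j \<Longrightarrow> l + k = m + j \<Longrightarrow> Y k \<otimes> x [^] l \<in> E \<Longrightarrow> x [^] (m + j) \<in> E" for k l
    proof (induct k arbitrary: l)
      case 0 then show ?case using xc by (simp add: Y0)
    next
      case (Suc k)
      have d: "c j \<ominus> c k \<in> Units R" using Suc(2) by (intro c(2)) simp
      then have dc: "c j \<ominus> c k \<in> carrier R" by auto
      have "v k = v j \<oplus> (c j \<ominus> c k) \<otimes> x"
      proof -
        have "v j \<oplus> (c j \<ominus> c k) \<otimes> x = y \<oplus> ((\<ominus> (c j \<otimes> x) \<oplus> c j \<otimes> x) \<ominus> c k \<otimes> x)"
          using yc xc c(1) unfolding v_def by (simp add: a_minus_def l_distr l_minus a_assoc)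
        then show ?thesis using yc xc c(1) unfolding v_def by (simp add: l_neg a_minus_def)
      qed
      then have "Y (Suc k) \<otimes> x [^] l = (v j \<oplus> (c j \<ominus> c k) \<otimes> x) \<otimes> (Y k \<otimes> x [^] l)"
        using Yc[of k] vc[of k] xc by (simp add: YS m_assoc)
      also have "\<dots> = v j \<otimes> (Y k \<otimes> x [^] l) \<oplus> ((c j \<ominus> c k) \<otimes> x) \<otimes> (Y k \<otimes> x [^] l)"
        using Yc[of k] vc[of j] dc xc by (intro l_distr) auto
      also have "((c j \<ominus> c k) \<otimes> x) \<otimes> (Y k \<otimes> x [^] l) = (c j \<ominus> c k) \<otimes> (Y k \<otimes> x [^] Suc l)"
        using Yc[of k] dc xc by (simp add: m_ac)
      finally have "Y (Suc k) \<otimes> x [^] l = v j \<otimes> (Y k \<otimes> x [^] l) \<oplus> (c j \<ominus> c k) \<otimes> (Y k \<otimes> x [^] Suc l)" .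
      moreover have "Y k \<otimes> x [^] l \<in> N \<up> (k + l)"
        unfolding ideal_pow_add[OF N] using YN elt_pow_mem[OF N x] by (rule ideal_prod.prod)
      then have "v j \<otimes> (Y k \<otimes> x [^] l) \<in> W \<cdot> N \<up> (k + l)" using vW by (intro ideal_prod.prod)
      then have "v j \<otimes> (Y k \<otimes> x [^] l) \<in> E" using subsetD[OF E1[of "k + l"]] Suc(3) by simp
      ultimately have "(c j \<ominus> c k) \<otimes> (Y k \<otimes> x [^] Suc l) \<in> E"
        using ideal_cancel[OF E, of "v j \<otimes> (Y k \<otimes> x [^] l)"] Suc(4) dc Yc xc by simp
      then have "Y k \<otimes> x [^] Suc l \<in> E" using unit_cancel_mem[OF E d] Yc xc by simp
      then show ?case using Suc(1)[of "Suc l"] Suc(2,3) by simp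
    qed
    assume "x [^] m \<in> V \<cdot> N \<up> (m - 1) \<uplus> Q' j m"
    then obtain w q where wq: "w \<in> V \<cdot> N \<up> (m - 1)" "q \<in> Q' j m" "x [^] m = w \<oplus> q"
      by (auto simp: mem_sum_iff)
    have wc: "w \<in> carrier R" by (rule ideal.Icarr[OF ideal_prod_is_ideal[OF V N'] wq(1)])
    have qc: "q \<in> carrier R" by (rule ideal.Icarr[OF Q' wq(2)])
    have "w \<otimes> Y j \<in> (V \<cdot> N \<up> (m - 1)) \<cdot> N \<up> j" using wq(1) YN by (rule ideal_prod.prod)
    also have "\<dots> = V \<cdot> N \<up> ((m - 1) + j)"
      unfolding ideal_pow_add[OF N] by (rule ideal_prod_assoc[OF V N' N'])
    also have "\<dots> \<subseteq> W \<cdot> N \<up> ((m - 1) + j)" by (intro prod_mono VW order_refl)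
    also have "\<dots> \<subseteq> E" by (rule E1) simp
    finally have 1: "Y j \<otimes> w \<in> E" using wc Yc by (simp add: m_comm)
    have "(PIdl (Y (Suc j))) \<cdot> N \<up> (m + j - Suc j) = (PIdl (v j)) \<cdot> ((PIdl (Y j)) \<cdot> N \<up> (m - 1))"
      unfolding YS by (subst smul_assoc[OF vc Yc N']) simp
    also have "\<dots> \<subseteq> W \<cdot> (N \<up> j \<cdot> N \<up> (m - 1))"
      using PIdl_le_iff[OF W vc] vW by (intro prod_mono PYN order_refl) blast
    also have "\<dots> = W \<cdot> N \<up> (j + (m - 1))" unfolding ideal_pow_add[OF N] ..
    also have "\<dots> \<subseteq> E" by (rule E1) simp
    finally have "T (m + j) (Suc j) \<subseteq> E" unfolding T_def using sum_le_iff[OF Cons(3) YNi E] E2 by blast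
    then have 2: "Y j \<otimes> q \<in> E" using wq(2) by (auto simp: Q'_def colon_def)
    have "Y j \<otimes> x [^] m \<in> E" unfolding wq(3) using ideal_add_mem[OF E 1 2] wc qc Yc by (simp add: r_distr)
    then have "x [^] (m + j) \<in> E" using down[of j m] by simp
    then show False using Cons(4)[of "j # bs" "m + j"] bs unfolding E_def W_def by simp
  qed
  have TT: "T n (Suc j) \<uplus> (PIdl (Y j)) \<cdot> N \<up> (n - j) = T n j" if "j \<le> n" for j
  proof -
    have "(PIdl (Y (Suc j))) \<cdot> N \<up> (n - Suc j) = (PIdl (Y j)) \<cdot> ((PIdl (v j)) \<cdot> N \<up> (n - Suc j))"
      unfolding YS m_comm[OF vc Yc] by (rule smul_assoc[OF Yc vc N'])
    also have "(PIdl (v j)) \<cdot> N \<up> (n - Suc j) \<subseteq> N \<cdot> N \<up> (n - Suc j)"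
      using PIdl_le_iff[OF N vc] v by (intro prod_mono) auto
    also have "\<dots> = N \<up> (Suc (n - Suc j))" by (rule ideal_pow_Suc[OF N, symmetric])
    also have "\<dots> \<subseteq> N \<up> (n - j)" by (rule ideal_pow_antimono[OF N]) simp
    finally have le: "(PIdl (Y (Suc j))) \<cdot> N \<up> (n - Suc j) \<subseteq> (PIdl (Y j)) \<cdot> N \<up> (n - j)"
      by (simp add: prod_mono)
    show ?thesis
      unfolding T_def sum_assoc[OF Cons(3) YNi YNi] sum_absorb2[OF YNi YNi le] ..
  qed
  have TS: "T n (Suc j) \<subseteq> T n j" if "j \<le> n" for j
    using sum_upper1[OF T YNi] TT[OF that] by blast
  have step: "enat (((n - j) + length xs) choose length xs) \<le> len (T n (Suc j)) (T n j)" if "j \<le> n" for j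
  proof -
    let ?m = "n - j"
    have n: "n = ?m + j" using that by simp
    have "enat ((?m + length xs) choose length xs) \<le> len (Q' j ?m) (Q' j ?m \<uplus> N \<up> ?m)"
      by (rule Cons(1)[OF xs Q' indep'])
    also have "\<dots> = len (N \<up> ?m \<inter> Q' j ?m) (N \<up> ?m)"
      by (rule len_diamond[OF Q' N'])
    also have "\<dots> = len (T n (Suc j)) (T n (Suc j) \<uplus> (PIdl (Y j)) \<cdot> N \<up> ?m)"
      unfolding len_smul[OF T N' Yc] Q'_def n[symmetric] ..
    finally show ?thesis unfolding TT[OF that] .
  qed
  have tel: "k \<le> Suc n \<Longrightarrow> T n k \<subseteq> T n 0 \<and>
      enat (\<Sum>j<k. ((n - j) + length xs) choose length xs) \<le> len (T n k) (T n 0)" for k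
  proof (induct k)
    case 0 then show ?case by (simp flip: zero_enat_def)
  next
    case (Suc k)
    then have IH: "T n k \<subseteq> T n 0" "enat (\<Sum>j<k. ((n - j) + length xs) choose length xs) \<le> len (T n k) (T n 0)" and k: "k \<le> n"
      by auto
    have "len (T n (Suc k)) (T n 0) = len (T n (Suc k)) (T n k) + len (T n k) (T n 0)"
      by (rule len_add[OF T T T TS[OF k] IH(1)])
    then show ?case using add_mono[OF step[OF k] IH(2)] TS[OF k] IH(1)
      by (auto simp: add.commute)
  qed
  have "(\<Sum>j<Suc n. ((n - j) + length xs) choose length xs) = (\<Sum>j<Suc n. (j + length xs) choose length xs)"
    using sum.nat_diff_reindex[of "\<lambda>j. (j + length xs) choose length xs" "Suc n"] by simp
  also have "\<dots> = (n + length (y # xs)) choose length (y # xs)"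
    using choose_rising_sum(1)[of "length xs" n] by (simp add: lessThan_Suc_atMost ac_simps)
  finally have "enat ((n + length (y # xs)) choose length (y # xs)) \<le> len (T n (Suc n)) (T n 0)"
    using tel[of "Suc n"] by simp
  also have "\<dots> \<le> len (Q n) (T n 0)"
    unfolding T_def by (intro len_mono sum_upper1 Cons(3) YNi order_refl)
  also have "T n 0 = Q n \<uplus> N \<up> n"
    by (simp add: T_def Y0 PIdl_one prod_one_left N')
  finally show ?case .
qed

lemma sum_pow_le:
  assumes "ideal Q R" "ideal N R"
  shows "(Q \<uplus> N) \<up> n \<subseteq> Q \<uplus> N \<up> n"
proof (induct n)
  case 0 then show ?case using sum_upper2[OF assms(1) oneideal] by simp
next
  case (Suc n)
  have N': "ideal (N \<up> k) R" for k by (rule ideal_pow_ideal[OF assms(2)])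
  have D: "ideal (Q \<uplus> N \<up> (Suc n)) R" by (rule add_ideals[OF assms(1) N'])
  have "(Q \<uplus> N \<up> n) \<cdot> (Q \<uplus> N) = (Q \<uplus> N \<up> n) \<cdot> Q \<uplus> (Q \<uplus> N \<up> n) \<cdot> N"
    using assms N' by (intro ideal_prod_distr(1) add_ideals)
  also have "(Q \<uplus> N \<up> n) \<cdot> N = Q \<cdot> N \<uplus> N \<up> (Suc n)"
    using assms N' by (simp add: ideal_prod_distr)
  finally have "(Q \<uplus> N \<up> n) \<cdot> (Q \<uplus> N) = (Q \<uplus> N \<up> n) \<cdot> Q \<uplus> (Q \<cdot> N \<uplus> N \<up> (Suc n))" .
  moreover have "(Q \<uplus> N \<up> n) \<cdot> Q \<subseteq> Q" "Q \<cdot> N \<subseteq> Q"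
    by (rule prod_le2[OF add_ideals[OF assms(1) N'] assms(1)], rule prod_le1[OF assms])
  then have "(Q \<uplus> N \<up> n) \<cdot> Q \<uplus> (Q \<cdot> N \<uplus> N \<up> (Suc n)) \<subseteq> Q \<uplus> N \<up> (Suc n)"
    using sum_upper1[OF assms(1) N'[of "Suc n"]] sum_upper2[OF assms(1) N'[of "Suc n"]]
      sum_le_iff[OF ideal_prod_is_ideal[OF add_ideals[OF assms(1) N'] assms(1)]
        add_ideals[OF ideal_prod_is_ideal[OF assms(1,2)] N'] D]
      sum_le_iff[OF ideal_prod_is_ideal[OF assms(1,2)] N' D]
    by blast
  moreover have "(Q \<uplus> N) \<up> (Suc n) \<subseteq> (Q \<uplus> N \<up> n) \<cdot> (Q \<uplus> N)"
    using prod_mono[OF Suc order_refl] by simp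
  ultimately show ?case by (simp only:)
qed

lemma pow_le_prod_plus_principal:
  assumes "ideal W R" "x \<in> carrier R"
  shows "(W \<uplus> PIdl x) \<up> (Suc n) \<subseteq> W \<cdot> (W \<uplus> PIdl x) \<up> n \<uplus> PIdl (x [^] Suc n)"
proof -
  let ?N = "W \<uplus> PIdl x"
  have P: "ideal (PIdl x) R" by (rule cgenideal_ideal[OF assms(2)])
  have N: "ideal ?N R" by (rule add_ideals[OF assms(1) P])
  have N': "ideal (?N \<up> k) R" for k by (rule ideal_pow_ideal[OF N])
  have WN: "ideal (W \<cdot> ?N \<up> k) R" for k by (rule ideal_prod_is_ideal[OF assms(1) N'])
  have Px: "ideal (PIdl (x [^] k)) R" "x [^] k \<in> carrier R" for k :: nat using assms by (auto intro: cgenideal_ideal)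
  have E: "ideal (W \<cdot> ?N \<up> k \<uplus> PIdl (x [^] Suc k)) R" for k by (rule add_ideals[OF WN Px(1)])
  show ?thesis
  proof (induct n)
    case 0
    then show ?case using assms N P by (simp add: ideal_prod_one prod_one_left)
  next
    case (Suc n)
    let ?E = "W \<cdot> ?N \<up> (Suc n) \<uplus> PIdl (x [^] Suc (Suc n))"
    have 1: "?N \<up> (Suc (Suc n)) = W \<cdot> ?N \<up> (Suc n) \<uplus> (PIdl x) \<cdot> ?N \<up> (Suc n)"
      unfolding ideal_pow_Suc[OF N, of "Suc n"] by (rule ideal_prod_distr(2)[OF N' assms(1) P])
    have 2: "(PIdl x) \<cdot> ?N \<up> (Suc n) \<subseteq> ?E"
    proof -
      have "W \<cdot> ?N \<up> n \<subseteq> colon ?E x"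
      proof -
        have "(PIdl x) \<cdot> (W \<cdot> ?N \<up> n) = W \<cdot> ((PIdl x) \<cdot> ?N \<up> n)"
          by (rule prod_left_commute[OF P assms(1) N'])
        also have "\<dots> \<subseteq> W \<cdot> ?N \<up> (Suc n)"
          unfolding ideal_pow_Suc[OF N] using sum_upper2[OF assms(1) P] by (intro prod_mono) auto
        finally show ?thesis
          using sum_upper1[OF WN Px(1)] smul_le_iff[OF assms(2) WN] by blast
      qed
      moreover have "x [^] Suc (Suc n) \<in> ?E"
        using sum_upper2[OF WN Px(1)] cgenideal_self[OF Px(2)] by (rule subsetD)
      then have "x [^] Suc n \<in> colon ?E x"
        using Px(2)[of "Suc n"] unfolding colon_def nat_pow_Suc2[OF assms(2), of "Suc n"] by (intro CollectI conjI)
      then have "PIdl (x [^] Suc n) \<subseteq> colon ?E x" using PIdl_le_iff[OF colon_ideal[OF E assms(2)] Px(2)] by blast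
      ultimately have "W \<cdot> ?N \<up> n \<uplus> PIdl (x [^] Suc n) \<subseteq> colon ?E x"
        using sum_le_iff[OF WN Px(1) colon_ideal[OF E assms(2)]] by blast
      then show ?thesis using Suc smul_le_iff[OF assms(2) N'] by blast
    qed
    show ?case
      unfolding 1 by (rule iffD2[OF sum_le_iff[OF WN ideal_prod_is_ideal[OF P N'] E]])
        (rule conjI[OF sum_upper1[OF WN Px(1)] 2])
  qed
qed

end

context noetherian_local_ring begin

text \<open>
  Representatives of infinitely many residue classes: the coordinates of the grid.
\<close>

lemma exists_distinct_residues:
  assumes "infinite (carrier (R Quot \<mm>))"
  obtains c :: "nat \<Rightarrow> 'a" where "\<And>i. c i \<in> carrier R" "\<And>i j. i \<noteq> j \<Longrightarrow> c i \<ominus> c j \<in> Units R"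
proof -
  obtain f :: "nat \<Rightarrow> 'a set" where f: "inj f" "range f \<subseteq> carrier (R Quot \<mm>)"
    using infinite_countable_subset[OF assms] by blast
  have "\<exists>r\<in>carrier R. f i = \<mm> +> r" for i
    using f(2) by (auto simp: FactRing_def A_RCOSETS_def' subset_iff image_iff)
  then obtain c where c: "\<And>i. c i \<in> carrier R" "\<And>i. f i = \<mm> +> c i" by metis
  have "c i \<ominus> c j \<in> Units R" if "i \<noteq> j" for i j
  proof (rule unit_of_not_m)
    show "c i \<ominus> c j \<in> carrier R" using c by simp
    have "f i \<noteq> f j" using f(1) that by (simp add: inj_eq)
    then show "c i \<ominus> c j \<notin> \<mm>"
      using quotient_eq_iff_same_a_r_cos[OF m_ideal c(1) c(1), of i j] unfolding c(2) by simp
  qed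
  then show ?thesis using c(1) that by blast
qed

text \<open>
  If every choice of \<open>ys\<close> fails, then by Nakayama no power of \<open>x\<close> lies in
  \<open>W N\<^bsup>n-1\<^esup> + Q + \<mm> N\<^sup>n\<close>, where \<open>W\<close> is generated by the elements \<open>y - c\<^sub>b x\<close>; indeed
  \<open>N\<^sup>n \<subseteq> W N\<^bsup>n-1\<^esup> + x\<^sup>n R\<close>. So the previous bound applies, and \<open>R / (Q + N\<^sup>n)\<close> grows faster than assumed.
\<close>

lemma drop_generator:
  assumes inf: "infinite (carrier (R Quot \<mm>))" and Q: "ideal Q R" "Q \<subseteq> \<mm>"
    and xs: "x \<in> \<mm>" "set xs \<subseteq> \<mm>" and N_def: "N = adjoin {\<zero>} (x # xs)"
    and e: "e \<le> length xs" and growth: "\<And>n. len (Q \<uplus> N \<up> n) (carrier R) \<le> enat (C * n ^ e)"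
  shows "\<exists>ys n. set ys \<subseteq> N \<and> length ys = length xs \<and>
    N \<up> (Suc n) \<subseteq> adjoin {\<zero>} ys \<cdot> N \<up> n \<uplus> Q"
proof (rule ccontr)
  assume neg: "\<not> ?thesis"
  have car: "x \<in> carrier R" "set xs \<subseteq> carrier R" "set (x # xs) \<subseteq> carrier R"
    using xs ideal_carrier_subset[OF m_ideal] by auto
  have N: "ideal N R" unfolding N_def by (rule adjoin_ideal[OF zeroideal car(3)])
  have mem: "x \<in> N" "set xs \<subseteq> N" using adjoin_mem[OF zeroideal car(3)] unfolding N_def by auto
  have Nm: "N \<subseteq> \<mm>" unfolding N_def using xs ideal_zero_mem[OF m_ideal] adjoin_le_iff[OF zeroideal car(3) m_ideal] by simp
  have N': "ideal (N \<up> k) R" for k by (rule ideal_pow_ideal[OF N])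
  have mN: "ideal (\<mm> \<cdot> N \<up> k) R" for k by (rule ideal_prod_is_ideal[OF m_ideal N'])
  obtain c :: "nat \<Rightarrow> 'a" where c: "\<And>i. c i \<in> carrier R" "\<And>i j. i \<noteq> j \<Longrightarrow> c i \<ominus> c j \<in> Units R"
    using exists_distinct_residues[OF inf] by blast
  define Q' where "Q' n = Q \<uplus> \<mm> \<cdot> N \<up> n" for n
  have Q': "ideal (Q' n) R" for n unfolding Q'_def by (rule add_ideals[OF Q(1) mN])
  have Q'm: "Q' n \<subseteq> \<mm>" for n
    unfolding Q'_def using sum_le_iff[OF Q(1) mN m_ideal] Q(2) prod_le1[OF m_ideal N'] by blast
  have indep: "x [^] n \<notin> adjoin {\<zero>} (map2 (\<lambda>y b. y \<ominus> c b \<otimes> x) xs bs) \<cdot> N \<up> (n - 1) \<uplus> Q' n"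
    if bs: "length bs = length xs" for bs n
  proof
    let ?ws = "map2 (\<lambda>y b. y \<ominus> c b \<otimes> x) xs bs"
    let ?W = "adjoin {\<zero>} ?ws"
    assume mem_n: "x [^] n \<in> ?W \<cdot> N \<up> (n - 1) \<uplus> Q' n"
    have wsN: "set ?ws \<subseteq> N"
      using mem c(1) ideal_minus_mem[OF N] ideal_mult_mem[OF N mem(1)] by (auto dest!: set_zip_leftD)
    then have ws: "set ?ws \<subseteq> carrier R" using ideal_carrier_subset[OF N] by blast
    have W: "ideal ?W R" by (rule adjoin_ideal[OF zeroideal ws])
    have P: "ideal (PIdl x) R" by (rule cgenideal_ideal[OF car(1)])
    have WP: "ideal (?W \<uplus> PIdl x) R" by (rule add_ideals[OF W P])
    have WN: "?W \<subseteq> N" using adjoin_le_iff[OF zeroideal ws N] wsN ideal_zero_mem[OF N] by simp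
    have N_eq: "N = ?W \<uplus> PIdl x"
    proof
      show "?W \<uplus> PIdl x \<subseteq> N" using sum_le_iff[OF W P N] WN PIdl_le_iff[OF N car(1)] mem(1) by simp
      have xW: "x \<in> ?W \<uplus> PIdl x" using sum_upper2[OF W P] cgenideal_self[OF car(1)] by blast
      have "y \<in> ?W \<uplus> PIdl x" if y: "y \<in> set xs" for y
      proof -
        obtain i where i: "i < length xs" "y = xs ! i" using y by (auto simp: in_set_conv_nth)
        have "y \<ominus> c (bs ! i) \<otimes> x \<in> set ?ws" using i bs by (force simp: set_zip)
        then have "y \<ominus> c (bs ! i) \<otimes> x \<in> ?W \<uplus> PIdl x"
          using adjoin_mem[OF zeroideal ws] sum_upper1[OF W P] by blast
        from ideal_add_mem[OF WP this ideal_mult_mem[OF WP xW c(1)[of "bs ! i"]]]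
        show ?thesis using subsetD[OF car(2) y] car(1) c(1) by (simp add: minus_add_cancel_right)
      qed
      then show "N \<subseteq> ?W \<uplus> PIdl x"
        unfolding N_def using xW ideal_zero_mem[OF WP] adjoin_le_iff[OF zeroideal car(3) WP] by auto
    qed
    show False
    proof (cases n)
      case 0
      have "?W \<cdot> N \<up> (n - 1) \<subseteq> \<mm>" using prod_le1[OF W N'] WN Nm by blast
      then have "x [^] n \<in> \<mm>"
        using mem_n sum_le_iff[OF ideal_prod_is_ideal[OF W N'] Q' m_ideal] Q'm by blast
      then show ?thesis using 0 m_proper by simp
    next
      case (Suc k)
      let ?A = "?W \<cdot> N \<up> k \<uplus> Q"
      have WNk: "ideal (?W \<cdot> N \<up> k) R" by (rule ideal_prod_is_ideal[OF W N'])
      have A: "ideal ?A R" by (rule add_ideals[OF WNk Q(1)])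
      have xk: "x [^] Suc k \<in> carrier R" using car by simp
      have "x [^] Suc k \<in> ?A \<uplus> \<mm> \<cdot> N \<up> (Suc k)"
        using mem_n unfolding Q'_def Suc sum_assoc[OF WNk Q(1) mN] by (simp only: diff_Suc_1)
      then have "PIdl (x [^] Suc k) \<subseteq> ?A \<uplus> \<mm> \<cdot> N \<up> (Suc k)"
        using PIdl_le_iff[OF add_ideals[OF A mN] xk] by blast
      moreover have "?W \<cdot> N \<up> k \<subseteq> ?A \<uplus> \<mm> \<cdot> N \<up> (Suc k)"
        using sum_upper1[OF WNk Q(1)] sum_upper1[OF A mN] by blast
      ultimately have "?W \<cdot> N \<up> k \<uplus> PIdl (x [^] Suc k) \<subseteq> ?A \<uplus> \<mm> \<cdot> N \<up> (Suc k)"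
        using sum_le_iff[OF WNk cgenideal_ideal[OF xk] add_ideals[OF A mN]] by blast
      then have "N \<up> (Suc k) \<subseteq> ?A \<uplus> \<mm> \<cdot> N \<up> (Suc k)"
        using pow_le_prod_plus_principal[OF W car(1), of k] unfolding N_eq[symmetric] by (rule order_trans[rotated])
      then have "N \<up> (Suc k) \<subseteq> ?A" by (rule nakayama[OF A N'])
      moreover have "length ?ws = length xs" using bs by simp
      ultimately show False using neg wsN by blast
    qed
  qed
  have ge: "enat ((n + length xs) choose length xs) \<le> len (Q' n) (Q' n \<uplus> N \<up> n)" for n
    by (rule len_pow_ge_binomial[OF N mem(1) c mem(2) Q' indep])
  have QN: "ideal (Q \<uplus> N \<up> k) R" for k by (rule add_ideals[OF Q(1) N'])
  have "enat ((n + length xs) choose (length xs + 1)) \<le> len (Q \<uplus> N \<up> n) (carrier R)" for n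
  proof (induct n)
    case 0 then show ?case by (simp add: zero_enat_def[symmetric] binomial_eq_0)
  next
    case (Suc n)
    have le: "\<mm> \<cdot> N \<up> n \<subseteq> N \<up> n" by (rule prod_le2[OF m_ideal N'])
    have eq: "Q' n \<uplus> N \<up> n = Q \<uplus> N \<up> n"
      unfolding Q'_def sum_assoc[OF Q(1) mN N'] sum_absorb2[OF mN N' le] ..
    have "Q \<uplus> N \<up> (Suc n) \<subseteq> Q' n"
      unfolding Q'_def ideal_pow_Suc[OF N] by (intro isum_mono prod_mono Nm order_refl)
    then have "len (Q' n) (Q' n \<uplus> N \<up> n) \<le> len (Q \<uplus> N \<up> (Suc n)) (Q \<uplus> N \<up> n)"
      unfolding eq by (intro len_mono order_refl)
    then have "enat ((n + length xs) choose length xs) \<le> len (Q \<uplus> N \<up> (Suc n)) (Q \<uplus> N \<up> n)"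
      using ge[of n] by (rule order_trans[rotated])
    note this Suc
    moreover have "len (Q \<uplus> N \<up> (Suc n)) (carrier R) =
        len (Q \<uplus> N \<up> (Suc n)) (Q \<uplus> N \<up> n) + len (Q \<uplus> N \<up> n) (carrier R)"
      by (intro len_add QN oneideal isum_mono order_refl ideal_pow_antimono N ideal_carrier_subset) simp
    ultimately have "enat ((n + length xs) choose length xs) + enat ((n + length xs) choose (length xs + 1))
      \<le> len (Q \<uplus> N \<up> (Suc n)) (carrier R)"
      using add_mono by metis
    then show ?case by (simp add: add.commute)
  qed
  then have "enat ((n + length xs) choose (length xs + 1)) \<le> enat (C * n ^ e)" for n
    using growth order_trans by blast
  then have "(n + length xs) choose (length xs + 1) \<le> C * n ^ e" for n by simp
  then show False using power_lt_binomial[OF e, of C] by (meson not_less)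
qed

lemma reduction_iterate:
  assumes "ideal N R" "ideal W R" "ideal Q R" "N \<up> (Suc n) \<subseteq> W \<cdot> N \<up> n \<uplus> Q"
  shows "N \<up> (n + m) \<subseteq> W \<up> m \<cdot> N \<up> n \<uplus> Q"
proof (induct m)
  case 0
  then show ?case using sum_upper1[OF ideal_pow_ideal[OF assms(1)] assms(3)]
    by (simp add: prod_one_left ideal_pow_ideal assms)
next
  case (Suc m)
  have N': "ideal (N \<up> k) R" and W': "ideal (W \<up> k) R" for k using assms by (auto intro: ideal_pow_ideal)
  have id: "ideal (W \<up> k \<cdot> N \<up> l) R" for k l by (rule ideal_prod_is_ideal[OF W' N'])
  let ?D = "W \<up> (Suc m) \<cdot> N \<up> n \<uplus> Q"
  have D: "ideal ?D R" by (rule add_ideals[OF id assms(3)])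
  have "N \<up> (n + Suc m) = N \<cdot> N \<up> (n + m)"
    using ideal_pow_Suc[OF assms(1), of "n + m"] by (simp only: add_Suc_right)
  also have "\<dots> \<subseteq> N \<cdot> (W \<up> m \<cdot> N \<up> n \<uplus> Q)" by (intro prod_mono Suc order_refl)
  also have "\<dots> = N \<cdot> (W \<up> m \<cdot> N \<up> n) \<uplus> N \<cdot> Q"
    by (rule ideal_prod_distr(1)[OF assms(1) id assms(3)])
  also have "N \<cdot> (W \<up> m \<cdot> N \<up> n) = W \<up> m \<cdot> N \<up> (Suc n)"
    unfolding ideal_pow_Suc[OF assms(1)] by (rule prod_left_commute[OF assms(1) W' N'])
  also have "\<dots> \<subseteq> W \<up> m \<cdot> (W \<cdot> N \<up> n \<uplus> Q)"
    by (intro prod_mono assms order_refl)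
  also have "\<dots> = W \<up> m \<cdot> (W \<cdot> N \<up> n) \<uplus> W \<up> m \<cdot> Q"
    by (rule ideal_prod_distr(1)[OF W' ideal_prod_is_ideal[OF assms(2) N'] assms(3)])
  also have "W \<up> m \<cdot> (W \<cdot> N \<up> n) = W \<up> (Suc m) \<cdot> N \<up> n"
    using ideal_prod_assoc[OF W' assms(2) N'] by simp
  finally have le: "N \<up> (n + Suc m) \<subseteq> (W \<up> (Suc m) \<cdot> N \<up> n \<uplus> W \<up> m \<cdot> Q) \<uplus> N \<cdot> Q"
    by (simp add: isum_mono)
  have "W \<up> m \<cdot> Q \<subseteq> ?D" "N \<cdot> Q \<subseteq> ?D" "W \<up> (Suc m) \<cdot> N \<up> n \<subseteq> ?D"
    using prod_le2[OF W' assms(3)] prod_le2[OF assms(1,3)] sum_upper2[OF id assms(3)] sum_upper1[OF id assms(3)] by blast+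
  then have "(W \<up> (Suc m) \<cdot> N \<up> n \<uplus> W \<up> m \<cdot> Q) \<uplus> N \<cdot> Q \<subseteq> ?D"
    using sum_le_iff[OF add_ideals[OF id ideal_prod_is_ideal[OF W' assms(3)]] ideal_prod_is_ideal[OF assms(1,3)] D]
      sum_le_iff[OF id ideal_prod_is_ideal[OF W' assms(3)] D] by blast
  then show ?case using le by blast
qed

text \<open>
  Generators are dropped one at a time. The growth hypothesis is inherited by the smaller ideal \<open>W\<close>, since
  \<open>N\<^bsup>n+m\<^esup> \<subseteq> W\<^sup>m + Q\<close> for a fixed \<open>n\<close>; only the constant changes, not the exponent \<open>e\<close>.
\<close>

lemma exists_generic_reduction:
  assumes inf: "infinite (carrier (R Quot \<mm>))" and Q: "ideal Q R" "Q \<subseteq> \<mm>"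
    and "set xs \<subseteq> \<mm>" and "\<And>n. len (Q \<uplus> (adjoin {\<zero>} xs) \<up> n) (carrier R) \<le> enat (C * n ^ e)"
  shows "\<exists>ws n. set ws \<subseteq> adjoin {\<zero>} xs \<and> length ws \<le> e \<and>
    (adjoin {\<zero>} xs) \<up> (Suc n) \<subseteq> adjoin {\<zero>} ws \<cdot> (adjoin {\<zero>} xs) \<up> n \<uplus> Q"
  using assms(4,5)
proof (induct "length xs" arbitrary: xs C rule: less_induct)
  case less
  let ?N = "adjoin {\<zero>} xs"
  have xsc: "set xs \<subseteq> carrier R" using less(2) ideal_carrier_subset[OF m_ideal] by blast
  have N: "ideal ?N R" by (rule adjoin_ideal[OF zeroideal xsc])
  have N': "ideal (?N \<up> k) R" for k by (rule ideal_pow_ideal[OF N])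
  show ?case
  proof (cases "length xs \<le> e")
    case True
    have "?N \<up> (Suc 0) \<subseteq> ?N \<cdot> ?N \<up> 0 \<uplus> Q"
      using sum_upper1[OF N Q(1)] by (simp add: prod_one_left ideal_prod_one N)
    then show ?thesis using True adjoin_mem[OF zeroideal xsc] by blast
  next
    case False
    then obtain x xs' where x: "xs = x # xs'" "e \<le> length xs'" by (cases xs) auto
    obtain ys n where ys: "set ys \<subseteq> ?N" "length ys = length xs'"
      "?N \<up> (Suc n) \<subseteq> adjoin {\<zero>} ys \<cdot> ?N \<up> n \<uplus> Q"
      using drop_generator[OF inf Q, of x xs' ?N e C] less(2,3) x by auto
    let ?W = "adjoin {\<zero>} ys"
    have ysc: "set ys \<subseteq> carrier R" using ys(1) ideal_carrier_subset[OF N] by blast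
    have W: "ideal ?W R" by (rule adjoin_ideal[OF zeroideal ysc])
    have W': "ideal (?W \<up> k) R" for k by (rule ideal_pow_ideal[OF W])
    have "?N \<subseteq> \<mm>" using adjoin_le_iff[OF zeroideal xsc m_ideal] less(2) ideal_zero_mem[OF m_ideal] by simp
    then have ysm: "set ys \<subseteq> \<mm>" using ys(1) by blast
    have WN: "?W \<subseteq> ?N" using adjoin_le_iff[OF zeroideal ysc N] ys(1) ideal_zero_mem[OF N] by simp
    note it = reduction_iterate[OF N W Q(1) ys(3)]
    have growth: "len (Q \<uplus> ?W \<up> m) (carrier R) \<le> enat ((C * (n + 1) ^ e) * m ^ e)" for m
    proof (cases "m = 0")
      case True
      then show ?thesis
        using sum_absorb2[OF Q(1) oneideal ideal_carrier_subset[OF Q(1)]] by (simp add: zero_enat_def[symmetric])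
    next
      case False
      have "?N \<up> (n + m) \<subseteq> Q \<uplus> ?W \<up> m"
      proof -
        have "?W \<up> m \<cdot> ?N \<up> n \<uplus> Q \<subseteq> ?W \<up> m \<uplus> Q"
          by (intro isum_mono prod_le1 W' N' order_refl)
        then show ?thesis using it[of m] sum_commute[OF W' Q(1)] by blast
      qed
      then have "Q \<uplus> ?N \<up> (n + m) \<subseteq> Q \<uplus> ?W \<up> m"
        using sum_le_iff[OF Q(1) N' add_ideals[OF Q(1) W']] sum_upper1[OF Q(1) W'] by blast
      then have "len (Q \<uplus> ?W \<up> m) (carrier R) \<le> len (Q \<uplus> ?N \<up> (n + m)) (carrier R)"
        by (intro len_mono order_refl)
      also have "\<dots> \<le> enat (C * (n + m) ^ e)" by (rule less(3))
      also have "\<dots> \<le> enat ((C * (n + 1) ^ e) * m ^ e)"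
      proof -
        have "n + m \<le> (n + 1) * m" using False by (cases m) auto
        then have "(n + m) ^ e \<le> ((n + 1) * m) ^ e" by (rule power_mono) simp
        then have "C * (n + m) ^ e \<le> C * ((n + 1) ^ e * m ^ e)"
          unfolding power_mult_distrib by (rule mult_left_mono) simp
        then show ?thesis by (simp only: enat_ord_simps mult.assoc)
      qed
      finally show ?thesis .
    qed
    obtain ws k where ws: "set ws \<subseteq> ?W" "length ws \<le> e"
      "?W \<up> (Suc k) \<subseteq> adjoin {\<zero>} ws \<cdot> ?W \<up> k \<uplus> Q"
      using less(1)[OF _ ysm growth] ys(2) x by auto
    let ?V = "adjoin {\<zero>} ws"
    have wsc: "set ws \<subseteq> carrier R" using ws(1) ideal_carrier_subset[OF W] by blast
    have V: "ideal ?V R" by (rule adjoin_ideal[OF zeroideal wsc])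
    have WNk: "ideal (?W \<up> k \<cdot> ?N \<up> n) R" by (rule ideal_prod_is_ideal[OF W' N'])
    have D: "ideal (?V \<cdot> ?N \<up> (n + k) \<uplus> Q) R"
      by (rule add_ideals[OF ideal_prod_is_ideal[OF V N'] Q(1)])
    have "?W \<up> (Suc k) \<cdot> ?N \<up> n \<subseteq> (?V \<cdot> ?W \<up> k \<uplus> Q) \<cdot> ?N \<up> n"
      by (intro prod_mono ws order_refl)
    also have "\<dots> = (?V \<cdot> ?W \<up> k) \<cdot> ?N \<up> n \<uplus> Q \<cdot> ?N \<up> n"
      by (rule ideal_prod_distr(2)[OF N' ideal_prod_is_ideal[OF V W'] Q(1)])
    also have "(?V \<cdot> ?W \<up> k) \<cdot> ?N \<up> n = ?V \<cdot> (?W \<up> k \<cdot> ?N \<up> n)"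
      by (rule ideal_prod_assoc[OF V W' N'])
    also have "?V \<cdot> (?W \<up> k \<cdot> ?N \<up> n) \<uplus> Q \<cdot> ?N \<up> n \<subseteq> ?V \<cdot> ?N \<up> (n + k) \<uplus> Q"
      unfolding ideal_pow_add[OF N] ideal_prod_commute[OF N' N']
      using ideal_pow_mono[OF W N WN] N'
      by (intro isum_mono prod_mono prod_le1 Q order_refl) (auto simp: ideal_prod_commute)
    finally have "?W \<up> (Suc k) \<cdot> ?N \<up> n \<uplus> Q \<subseteq> ?V \<cdot> ?N \<up> (n + k) \<uplus> Q"
      using sum_le_iff[OF ideal_prod_is_ideal[OF W' N'] Q(1) D] sum_upper2[OF ideal_prod_is_ideal[OF V N'] Q(1)] by blast
    then have "?N \<up> (Suc (n + k)) \<subseteq> ?V \<cdot> ?N \<up> (n + k) \<uplus> Q"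
      using it[of "Suc k"] unfolding add_Suc_right by (rule order_trans[rotated])
    then show ?thesis using ws(1,2) WN by blast
  qed
qed

text \<open>
  If \<open>\<mm>\<^sup>M \<subseteq> Q + N\<close>, then \<open>Q + N\<^sup>n\<close> contains the powers \<open>x\<^bsup>Mn\<^esup>\<close> of the parameters.
\<close>

lemma growth_bound:
  assumes Q: "ideal Q R" and N: "ideal N R" and xs: "set xs \<subseteq> \<mm>"
    and "open_ideal (adjoin Q xs)" "open_ideal (Q \<uplus> N)"
  shows "\<exists>C. \<forall>n. len (Q \<uplus> N \<up> n) (carrier R) \<le> enat (C * n ^ length xs)"
proof -
  have xsc: "set xs \<subseteq> carrier R" using xs ideal_carrier_subset[OF m_ideal] by blast
  obtain M where M: "\<mm> \<up> M \<subseteq> Q \<uplus> N" using assms(5) by (auto simp: open_ideal_def)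
  obtain k where k: "len (adjoin Q xs) (carrier R) = enat k" using open_ideal_finite_len[OF assms(4)] by blast
  have N': "ideal (N \<up> j) R" for j by (rule ideal_pow_ideal[OF N])
  have "len (Q \<uplus> N \<up> n) (carrier R) \<le> enat ((M ^ length xs * k) * n ^ length xs)" for n
  proof -
    let ?ys = "map (\<lambda>x. x [^] (M * n)) xs"
    have ysc: "set ?ys \<subseteq> carrier R" using xsc by auto
    have D: "ideal (Q \<uplus> N \<up> n) R" by (rule add_ideals[OF Q N'])
    have "\<mm> \<up> (M * n) \<subseteq> Q \<uplus> N \<up> n"
      using ideal_pow_mono[OF ideal_pow_ideal[OF m_ideal] add_ideals[OF Q N] M, of n] sum_pow_le[OF Q N, of n]
      unfolding ideal_pow_pow[OF m_ideal] by blast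
    then have "set ?ys \<subseteq> Q \<uplus> N \<up> n" using elt_pow_mem[OF m_ideal] xs by auto
    then have "adjoin Q ?ys \<subseteq> Q \<uplus> N \<up> n"
      using adjoin_le_iff[OF Q ysc D] sum_upper1[OF Q N'] by blast
    then have "len (Q \<uplus> N \<up> n) (carrier R) \<le> len (adjoin Q ?ys) (carrier R)" by (intro len_mono order_refl)
    also have "\<dots> \<le> enat ((M * n) ^ length xs) * enat k" using len_adjoin_powers_le[OF Q xsc, of "M * n"] k by simp
    finally show ?thesis by (simp add: power_mult_distrib ac_simps)
  qed
  then show ?thesis by blast
qed

end

section \<open>Systems of parameters and minimal reductions\<close>

context cring begin

lemma regular_mod_iff_nth:
  "regular_mod Q xs \<longleftrightarrow>
    (\<forall>i<length xs. colon (adjoin Q (take i xs)) (xs ! i) \<subseteq> adjoin Q (take i xs))"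
  by (induct xs arbitrary: Q) (auto simp: All_less_Suc2)

lemma regular_sequence_imp_regular_mod:
  assumes "regular_sequence R xs" shows "regular_mod {\<zero>} xs"
  unfolding regular_mod_iff_nth
proof (intro allI impI)
  fix i assume i: "i < length xs"
  have "set (take i xs) \<subseteq> carrier R" using assms set_take_subset[of i xs] by (auto simp: regular_sequence_def)
  then show "colon (adjoin {\<zero>} (take i xs)) (xs ! i) \<subseteq> adjoin {\<zero>} (take i xs)"
    using assms i unfolding regular_sequence_def by (auto simp: Idl_eq_adjoin colon_def)
qed

text \<open>
  The correspondence between submodules of \<open>R / A\<close> and ideals above \<open>A\<close>.
\<close>

lemma module_length_quot:
  assumes A: "ideal A R"
  shows "module_length R (quot_module R A) = len A (carrier R)"
proof -
  have coset_ex: "\<exists>r\<in>carrier R. C = A +> r" if "C \<in> carrier (R Quot A)" for C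
    using that unfolding FactRing_def A_RCOSETS_def' by auto
  have zQ: "\<zero>\<^bsub>R Quot A\<^esub> = A" by (simp add: FactRing_def)
  interpret A: ideal A R by (rule A)
  interpret h: ring_hom_ring R "R Quot A" "(+>) A" by (rule A.rcos_ring_hom_ring)
  let ?M = "quot_module R A"
  interpret M: module R ?M by (rule quot_module_is_module[OF is_cring A])
  have sel: "carrier ?M = carrier (R Quot A)" "add ?M = add (R Quot A)" "\<zero>\<^bsub>?M\<^esub> = \<zero>\<^bsub>R Quot A\<^esub>"
    "\<And>r C. r \<odot>\<^bsub>?M\<^esub> C = (A +> r) \<otimes>\<^bsub>R Quot A\<^esub> C"
    by (simp_all add: quot_module_def ring.defs module.defs)
  have coset_eq: "A +> b = A +> c \<longleftrightarrow> b \<ominus> c \<in> A" if "b \<in> carrier R" "c \<in> carrier R" for b c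
    using quotient_eq_iff_same_a_r_cos[OF A that] by simp
  define \<Phi> where "\<Phi> N = {r \<in> carrier R. A +> r \<in> N}" for N
  define \<Psi> where "\<Psi> B = (+>) A ` B" for B
  have \<Phi>: "ideal (\<Phi> N) R \<and> A \<subseteq> \<Phi> N" if "submodule N R ?M" for N
  proof -
    interpret N: submodule N R ?M by fact
    have z: "\<zero>\<^bsub>R Quot A\<^esub> \<in> N" using N.one_closed by (simp add: sel)
    have add: "C \<oplus>\<^bsub>R Quot A\<^esub> D \<in> N" if "C \<in> N" "D \<in> N" for C D
      using N.m_closed[OF that] by (simp add: sel)
    have smul: "x \<otimes> r \<in> \<Phi> N" if "x \<in> carrier R" "r \<in> \<Phi> N" for x r
      using N.smult_closed[of x "A +> r"] that by (auto simp: \<Phi>_def sel h.hom_mult)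
    have "subgroup (\<Phi> N) (add_monoid R)"
    proof (rule add.subgroupI)
      show "\<Phi> N \<subseteq> carrier R" by (auto simp: \<Phi>_def)
      have "\<zero> \<in> \<Phi> N" using z by (simp add: \<Phi>_def)
      then show "\<Phi> N \<noteq> {}" by blast
      fix a b assume a: "a \<in> \<Phi> N" and b: "b \<in> \<Phi> N"
      show "a \<oplus> b \<in> \<Phi> N" using add a b by (auto simp: \<Phi>_def)
    next
      fix a assume a: "a \<in> \<Phi> N"
      then have "a \<in> carrier R" by (simp add: \<Phi>_def)
      then show "\<ominus> a \<in> \<Phi> N" using smul[of "\<ominus> \<one>" a] a by (simp add: l_minus)
    qed
    moreover have "r \<otimes> x \<in> \<Phi> N" if "r \<in> \<Phi> N" "x \<in> carrier R" for r x
    proof -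
      have "r \<in> carrier R" using that(1) by (simp add: \<Phi>_def)
      then show ?thesis using smul[OF that(2,1)] m_comm[of r x] that(2) by simp
    qed
    ultimately have "ideal (\<Phi> N) R" using smul by (intro idealI ring_axioms) blast+
    moreover have "A \<subseteq> \<Phi> N"
    proof
      fix a assume a: "a \<in> A"
      have "A +> a \<in> N" using z unfolding zQ a_rcos_zero[OF A a] .
      then show "a \<in> \<Phi> N" unfolding \<Phi>_def using ideal.Icarr[OF A a] by (intro CollectI conjI)
    qed
    ultimately show ?thesis by blast
  qed
  have \<Psi>: "submodule (\<Psi> B) R ?M" if B: "ideal B R" for B
  proof (rule M.submoduleI)
    have Bc: "b \<in> carrier R" if "b \<in> B" for b by (rule ideal.Icarr[OF B that])
    show "\<Psi> B \<subseteq> carrier ?M" using Bc by (auto simp: \<Psi>_def sel)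
    show "\<zero>\<^bsub>?M\<^esub> \<in> \<Psi> B"
      unfolding \<Psi>_def sel using ideal_zero_mem[OF B] h.hom_zero by (metis image_eqI)
    show add: "C \<oplus>\<^bsub>?M\<^esub> D \<in> \<Psi> B" if CD: "C \<in> \<Psi> B" "D \<in> \<Psi> B" for C D
    proof -
      obtain b c where bc: "b \<in> B" "c \<in> B" "C = A +> b" "D = A +> c" using CD by (auto simp: \<Psi>_def)
      then have "C \<oplus>\<^bsub>?M\<^esub> D = A +> (b \<oplus> c)" using Bc by (simp add: sel)
      then show ?thesis using ideal_add_mem[OF B bc(1,2)] by (auto simp: \<Psi>_def)
    qed
    show smul: "x \<odot>\<^bsub>?M\<^esub> C \<in> \<Psi> B" if xC: "x \<in> carrier R" "C \<in> \<Psi> B" for x C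
    proof -
      obtain b where b: "b \<in> B" "C = A +> b" using xC by (auto simp: \<Psi>_def)
      then have "x \<odot>\<^bsub>?M\<^esub> C = A +> (x \<otimes> b)" using Bc xC by (simp add: sel)
      then show ?thesis using ideal_mult_mem[OF B b(1) xC(1)] by (auto simp: \<Psi>_def)
    qed
    fix C assume C: "C \<in> \<Psi> B"
    then have "C \<in> carrier ?M" using Bc by (auto simp: \<Psi>_def sel)
    then have "\<ominus>\<^bsub>?M\<^esub> C = (\<ominus> \<one>) \<odot>\<^bsub>?M\<^esub> C" by (simp add: M.smult_l_minus)
    then show "\<ominus>\<^bsub>?M\<^esub> C \<in> \<Psi> B" using smul[of "\<ominus> \<one>" C] C by simp
  qed
  show ?thesis
  proof (rule antisym)
    show "module_length R ?M \<le> len A (carrier R)"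
      unfolding module_length_def
    proof (rule Sup_least, clarify)
      fix n N assume N: "\<forall>i\<le>n. submodule (N i) R ?M" "\<forall>i<n. N i \<subset> N (Suc i)"
      show "enat n \<le> len A (carrier R)"
      proof (rule len_ge)
        show "\<forall>i\<le>n. ideal (\<Phi> (N i)) R \<and> A \<subseteq> \<Phi> (N i) \<and> \<Phi> (N i) \<subseteq> carrier R"
          using N(1) \<Phi> by (auto simp: \<Phi>_def)
        show "\<forall>i<n. \<Phi> (N i) \<subset> \<Phi> (N (Suc i))"
        proof (intro allI impI)
          fix i assume i: "i < n"
          then obtain C where C: "C \<in> N (Suc i)" "C \<notin> N i" using N(2) by blast
          have "submodule (N (Suc i)) R ?M" using N(1) i by simp
          then have "C \<in> carrier (R Quot A)"
            using C(1) subgroup.subset[OF submodule.axioms(1)] by (fastforce simp: sel)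
          then obtain r where "r \<in> carrier R" "C = A +> r" using coset_ex by blast
          then have "r \<in> \<Phi> (N (Suc i))" "r \<notin> \<Phi> (N i)" using C by (auto simp: \<Phi>_def)
          moreover have "\<Phi> (N i) \<subseteq> \<Phi> (N (Suc i))" using N(2) i by (auto simp: \<Phi>_def)
          ultimately show "\<Phi> (N i) \<subset> \<Phi> (N (Suc i))" by blast
        qed
      qed
    qed
    show "len A (carrier R) \<le> module_length R ?M"
    proof (rule len_le)
      fix n N assume N: "\<forall>i\<le>n. ideal (N i) R \<and> A \<subseteq> N i \<and> N i \<subseteq> carrier R" "\<forall>i<n. N i \<subset> N (Suc i)"
      show "enat n \<le> module_length R ?M"
        unfolding module_length_def
      proof (intro Sup_upper CollectI exI[of _ n] exI[of _ "\<lambda>i. \<Psi> (N i)"] conjI refl)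
        show "\<forall>i\<le>n. submodule (\<Psi> (N i)) R ?M" using N(1) \<Psi> by blast
        show "\<forall>i<n. \<Psi> (N i) \<subset> \<Psi> (N (Suc i))"
        proof (intro allI impI)
          fix i assume i: "i < n"
          have Ni: "ideal (N i) R" "A \<subseteq> N i" and NS: "ideal (N (Suc i)) R" using N(1) i by auto
          obtain b where b: "b \<in> N (Suc i)" "b \<notin> N i" using N(2) i by blast
          have bc: "b \<in> carrier R" by (rule ideal.Icarr[OF NS b(1)])
          have "A +> b \<notin> \<Psi> (N i)"
          proof
            assume "A +> b \<in> \<Psi> (N i)"
            then obtain c where c: "c \<in> N i" "A +> b = A +> c" by (auto simp: \<Psi>_def)
            have cc: "c \<in> carrier R" by (rule ideal.Icarr[OF Ni(1) c(1)])
            have "b \<ominus> c \<in> N i" using coset_eq[OF bc cc] c(2) Ni(2) by blast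
            from ideal_add_mem[OF Ni(1) this c(1)] show False
              using b(2) bc cc by (simp add: minus_add_cancel_right)
          qed
          moreover have "A +> b \<in> \<Psi> (N (Suc i))" using b by (auto simp: \<Psi>_def)
          moreover have "\<Psi> (N i) \<subseteq> \<Psi> (N (Suc i))" using N(2) i by (auto simp: \<Psi>_def)
          ultimately show "\<Psi> (N i) \<subset> \<Psi> (N (Suc i))" by blast
        qed
      qed
    qed
  qed
qed

lemma colength_eq: "ideal A R \<Longrightarrow> len A (carrier R) = enat k \<Longrightarrow> colength R A = k"
  by (simp add: colength_def module_length_quot)

end

context noetherian_local_ring begin

text \<open>
  Modulo \<open>x z\<close> the ring has dimension one less: \<open>R / (x z)\<close> is an extension of \<open>R / (x)\<close> by an image of
  \<open>R / (z)\<close>, and both grow with exponent \<open>length xs\<close>. So a generic reduction of \<open>\<mm>\<close> modulo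
  \<open>Q + x z R\<close> has that many generators. These are parameters modulo \<open>x\<close> and modulo \<open>z\<close> at once.
\<close>

lemma common_parameters:
  assumes inf: "infinite (carrier (R Quot \<mm>))" and Q: "ideal Q R" "Q \<subseteq> \<mm>"
    and x: "x \<in> \<mm>" "set xs \<subseteq> \<mm>" "open_ideal (adjoin Q (x # xs))"
    and z: "z \<in> \<mm>" "set zs \<subseteq> \<mm>" "open_ideal (adjoin Q (z # zs))"
    and len: "length zs = length xs"
  shows "\<exists>us. set us \<subseteq> \<mm> \<and> length us = length xs \<and> open_ideal (adjoin Q ((x \<otimes> z) # us))"
proof -
  have car: "x \<in> carrier R" "z \<in> carrier R" using ideal.Icarr[OF m_ideal] x z by auto
  have xz: "x \<otimes> z \<in> carrier R" "x \<otimes> z \<in> \<mm>" using car ideal_mult_mem[OF m_ideal z(1) car(1)] by auto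
  have P: "ideal (PIdl x) R" "ideal (PIdl z) R" "ideal (PIdl (x \<otimes> z)) R"
    using car xz by (auto intro: cgenideal_ideal)
  define Q' where "Q' = Q \<uplus> PIdl (x \<otimes> z)"
  have Q'i: "ideal Q' R" and Qx: "ideal (Q \<uplus> PIdl x) R" and Qz: "ideal (Q \<uplus> PIdl z) R"
    unfolding Q'_def using Q P by (auto intro: add_ideals)
  have Q'm: "Q' \<subseteq> \<mm>" unfolding Q'_def
    using sum_le_iff[OF Q(1) P(3) m_ideal] Q(2) PIdl_le_iff[OF m_ideal xz(1)] xz(2) by blast
  have m': "ideal (\<mm> \<up> n) R" for n by (rule ideal_pow_ideal[OF m_ideal])
  have op: "open_ideal (A \<uplus> \<mm>)" if "ideal A R" for A
    using open_ideal_mono[OF open_ideal_m add_ideals[OF that m_ideal] sum_upper2[OF that m_ideal]] .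
  obtain C1 where C1: "\<And>n. len (Q \<uplus> PIdl x \<uplus> \<mm> \<up> n) (carrier R) \<le> enat (C1 * n ^ length xs)"
    using growth_bound[OF Qx m_ideal x(2) _ op[OF Qx]] x(3) by auto
  obtain C2 where C2: "\<And>n. len (Q \<uplus> PIdl z \<uplus> \<mm> \<up> n) (carrier R) \<le> enat (C2 * n ^ length xs)"
    using growth_bound[OF Qz m_ideal z(2) _ op[OF Qz]] z(3) len by auto
  have growth: "len (Q' \<uplus> \<mm> \<up> n) (carrier R) \<le> enat ((C1 + C2) * n ^ length xs)" for n
  proof -
    let ?C0 = "Q' \<uplus> \<mm> \<up> n" and ?D = "Q \<uplus> PIdl x \<uplus> \<mm> \<up> n" and ?E = "Q \<uplus> PIdl z \<uplus> \<mm> \<up> n"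
    have C0: "ideal ?C0 R" and D: "ideal ?D R" and E: "ideal ?E R" by (auto intro: add_ideals Q'i Qx Qz m')
    have up: "Q \<subseteq> ?C0" "x \<otimes> z \<in> ?C0" "\<mm> \<up> n \<subseteq> ?C0"
      using sum_upper1[OF Q'i m'[of n]] sum_upper2[OF Q'i m'[of n]] sum_upper1[OF Q(1) P(3)]
        sum_upper2[OF Q(1) P(3)] cgenideal_self[OF xz(1)] unfolding Q'_def by blast+
    have col: "ideal (colon ?C0 x) R" by (rule colon_ideal[OF C0 car(1)])
    have "z \<in> colon ?C0 x" using up car by (simp add: colon_def)
    then have "?E \<subseteq> colon ?C0 x"
      using up colon_upper[OF C0 car(1)] sum_le_iff[OF Qz m' col] sum_le_iff[OF Q(1) P(2) col]
        PIdl_le_iff[OF col car(2)] by blast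
    then have "len (carrier R \<inter> colon ?C0 x) (carrier R) \<le> len ?E (carrier R)"
      using ideal_carrier_subset[OF E] by (intro len_mono order_refl Int_greatest)
    then have 1: "len ?C0 (?C0 \<uplus> PIdl x) \<le> len ?E (carrier R)"
      using len_smul[OF C0 oneideal car(1)] by (simp add: ideal_prod_one[OF P(1)])
    have C0x: "ideal (?C0 \<uplus> PIdl x) R" by (rule add_ideals[OF C0 P(1)])
    have "?D \<subseteq> ?C0 \<uplus> PIdl x"
      using sum_le_iff[OF Qx m' C0x] sum_le_iff[OF Q(1) P(1) C0x] up
        sum_upper1[OF C0 P(1)] sum_upper2[OF C0 P(1)] by blast
    then have 2: "len (?C0 \<uplus> PIdl x) (carrier R) \<le> len ?D (carrier R)" by (intro len_mono order_refl)
    have "len ?C0 (carrier R) = len ?C0 (?C0 \<uplus> PIdl x) + len (?C0 \<uplus> PIdl x) (carrier R)"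
      by (intro len_add C0 C0x oneideal sum_upper1 P ideal_carrier_subset)
    also have "\<dots> \<le> enat (C2 * n ^ length xs) + enat (C1 * n ^ length xs)"
      by (intro add_mono order_trans[OF 1 C2] order_trans[OF 2 C1])
    finally show ?thesis by (simp add: distrib_right add.commute)
  qed
  obtain ts where ts: "set ts \<subseteq> carrier R" "\<mm> = adjoin {\<zero>} ts" using ideal_gens[OF m_ideal] by blast
  have tsm: "set ts \<subseteq> \<mm>" using adjoin_mem[OF zeroideal ts(1)] ts(2) by simp
  obtain ws n where ws: "set ws \<subseteq> \<mm>" "length ws \<le> length xs"
    "\<mm> \<up> (Suc n) \<subseteq> adjoin {\<zero>} ws \<cdot> \<mm> \<up> n \<uplus> Q'"
    using exists_generic_reduction[OF inf Q'i Q'm tsm, of "C1 + C2" "length xs"] growth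
    unfolding ts(2)[symmetric] by blast
  have wsc: "set ws \<subseteq> carrier R" using ws(1) ideal_carrier_subset[OF m_ideal] by blast
  have W: "ideal (adjoin {\<zero>} ws) R" by (rule adjoin_ideal[OF zeroideal wsc])
  \<comment> \<open>Padding by zeros gives exactly the required number of elements.\<close>
  let ?us = "ws @ replicate (length xs - length ws) \<zero>"
  have us: "set ?us \<subseteq> \<mm>" "length ?us = length xs" using ws ideal_zero_mem[OF m_ideal] by auto
  have usc: "set ?us \<subseteq> carrier R" using us(1) ideal_carrier_subset[OF m_ideal] by blast
  have "adjoin {\<zero>} ws \<cdot> \<mm> \<up> n \<uplus> Q' \<subseteq> adjoin {\<zero>} ws \<uplus> Q'"
    by (intro isum_mono prod_le1 W m' order_refl)
  also have "adjoin {\<zero>} ws \<uplus> Q' = adjoin Q' ws"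
    unfolding adjoin_eq_sum[OF Q'i wsc] by (rule sum_commute[OF W Q'i])
  also have "\<dots> \<subseteq> adjoin Q' ?us"
    using adjoin_upper[OF Q'i usc] adjoin_mem[OF Q'i usc] adjoin_le_iff[OF Q'i wsc adjoin_ideal[OF Q'i usc]] by auto
  finally have "open_ideal (adjoin Q' ?us)"
    using ws(3) adjoin_ideal[OF Q'i usc] unfolding open_ideal_def by blast
  then show ?thesis using us by (intro exI[of _ ?us]) (simp add: Q'_def)
qed

text \<open>
  The Cohen-Macaulay property: if one system of parameters is regular, then all are. To pass from
  \<open>z # zs'\<close> to \<open>x # xs'\<close>, take common parameters \<open>us\<close> modulo \<open>x z\<close>. By induction modulo \<open>z\<close> the
  sequence \<open>z # us\<close> is regular, hence so is \<open>us @ [z]\<close>; exchange \<open>z\<close> for \<open>x\<close>, rotate back to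
  \<open>x # us\<close>, and use induction modulo \<open>x\<close> to replace \<open>us\<close> by \<open>xs'\<close>.
\<close>

theorem parameters_regular:
  assumes inf: "infinite (carrier (R Quot \<mm>))" and "ideal Q R" "Q \<subseteq> \<mm>"
    and "set zs \<subseteq> \<mm>" "regular_mod Q zs" "open_ideal (adjoin Q zs)"
    and "set xs \<subseteq> \<mm>" "length xs = length zs" "open_ideal (adjoin Q xs)"
  shows "regular_mod Q xs"
  using assms(2-9)
proof (induct "length zs" arbitrary: Q zs xs)
  case 0 then show ?case by simp
next
  case (Suc e)
  obtain z zs' x xs' where eq: "zs = z # zs'" "xs = x # xs'" "length zs' = e" "length xs' = e"
    using Suc(2,9) by (cases zs; cases xs) auto
  have m: "z \<in> \<mm>" "set zs' \<subseteq> \<mm>" "x \<in> \<mm>" "set xs' \<subseteq> \<mm>" using Suc(5,8) eq by auto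
  have Q: "ideal Q R" "Q \<subseteq> \<mm>" using Suc by auto
  have car: "x \<in> carrier R" "z \<in> carrier R" using ideal.Icarr[OF m_ideal] m by auto
  have P: "ideal (PIdl x) R" "ideal (PIdl z) R" "ideal (PIdl (x \<otimes> z)) R"
    using car by (auto intro: cgenideal_ideal)
  have Qx: "ideal (Q \<uplus> PIdl x) R" "Q \<uplus> PIdl x \<subseteq> \<mm>" and Qz: "ideal (Q \<uplus> PIdl z) R" "Q \<uplus> PIdl z \<subseteq> \<mm>"
    and Qxz: "ideal (Q \<uplus> PIdl (x \<otimes> z)) R"
    using Q P m sum_le_iff[OF Q(1) _ m_ideal] PIdl_le_iff[OF m_ideal car(1)] PIdl_le_iff[OF m_ideal car(2)]
    by (simp_all add: add_ideals)
  obtain us where us: "set us \<subseteq> \<mm>" "length us = e" "open_ideal (adjoin Q ((x \<otimes> z) # us))"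
    using common_parameters[OF inf Q m(3,4) _ m(1,2)] Suc(7,10) eq by auto
  have usc: "set us \<subseteq> carrier R" using us(1) ideal_carrier_subset[OF m_ideal] by blast
  have op: "open_ideal (adjoin (Q \<uplus> PIdl y) us)" if y: "y \<in> carrier R" "x \<otimes> z \<in> PIdl y" for y
  proof -
    have Y: "ideal (PIdl y) R" by (rule cgenideal_ideal[OF y(1)])
    have "PIdl (x \<otimes> z) \<subseteq> PIdl y" using PIdl_le_iff[OF Y] y car by simp
    then have "adjoin (Q \<uplus> PIdl (x \<otimes> z)) us \<subseteq> adjoin (Q \<uplus> PIdl y) us"
      by (intro adjoin_mono Qxz add_ideals Q Y usc isum_mono order_refl)
    then show ?thesis
      using open_ideal_mono[OF us(3) adjoin_ideal[OF add_ideals[OF Q(1) Y] usc]] by simp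
  qed
  have opx: "open_ideal (adjoin (Q \<uplus> PIdl x) us)"
    using op[OF car(1)] ideal_mult_mem'[OF P(1) cgenideal_self[OF car(1)] car(2)] by blast
  have opz: "open_ideal (adjoin (Q \<uplus> PIdl z) us)"
    using op[OF car(2)] ideal_mult_mem[OF P(2) cgenideal_self[OF car(2)] car(1)] by blast
  have rz: "colon Q z \<subseteq> Q" "regular_mod (Q \<uplus> PIdl z) zs'" using Suc(6) eq by auto
  have "regular_mod (Q \<uplus> PIdl z) us"
    using Suc(1)[of zs' "Q \<uplus> PIdl z" us] eq Qz m(2) rz(2) Suc(7) us(1,2) opz by auto
  then have "regular_mod Q (us @ [z])"
    using regular_mod_rotate[OF Q(1) m(1) us(1)] rz(1) by simp
  then have ru: "regular_mod Q us" "colon (adjoin Q us) z \<subseteq> adjoin Q us"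
    by (auto simp: regular_mod_append)
  obtain N :: nat where "z [^] N \<in> adjoin (Q \<uplus> PIdl x) us" using open_ideal_powers[OF opx m(1)] by blast
  then have "z [^] N \<in> adjoin Q us \<uplus> PIdl x" unfolding adjoin_sum[OF Q(1) P(1) usc] .
  then have "colon (adjoin Q us) x \<subseteq> adjoin Q us"
    using regular_exchange[OF adjoin_ideal[OF Q(1) usc] car(2,1) ru(2)] by blast
  then have "regular_mod Q (us @ [x])" using ru(1) by (simp add: regular_mod_append)
  then have "regular_mod Q (x # us)" using regular_mod_rotate[OF Q(1) m(3) us(1)] by simp
  then have rx: "colon Q x \<subseteq> Q" "regular_mod (Q \<uplus> PIdl x) us" by auto
  have "regular_mod (Q \<uplus> PIdl x) xs'"
    using Suc(1)[of us "Q \<uplus> PIdl x" xs'] us(1,2) Qx rx(2) opx m(4) eq Suc(10) by auto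
  then show ?case using rx(1) eq by simp
qed

text \<open>
  The depth is a supremum of lengths; as it is finite, it is attained.
\<close>

lemma exists_regular_parameters:
  assumes "depth R \<mm> = krull_dim R" "krull_dim R = enat d"
  shows "\<exists>ys. length ys = d \<and> set ys \<subseteq> \<mm> \<and> regular_mod {\<zero>} ys"
proof -
  have "\<one> \<noteq> \<zero>" using m_proper ideal_zero_mem[OF m_ideal] by auto
  then have "Idl (set []) \<noteq> carrier R" using Idl_eq_adjoin[of "[]"] one_closed by auto
  then have "regular_sequence R []" by (simp add: regular_sequence_def)
  then have "{enat (length xs) | xs. regular_sequence R xs \<and> set xs \<subseteq> \<mm>} \<noteq> {}"
    by (auto intro!: exI[of _ "[]"])
  then have "enat d \<in> {enat (length xs) | xs. regular_sequence R xs \<and> set xs \<subseteq> \<mm>}"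
    using assms by (intro enat_Sup_attained) (auto simp: depth_def)
  then show ?thesis using regular_sequence_imp_regular_mod by auto
qed

lemma primary_open:
  assumes "primary_to R \<mm> I" shows "open_ideal I" "I \<subseteq> \<mm>"
proof -
  have I: "ideal I R" and rad: "radical R I = \<mm>"
    using assms by (auto simp: primary_to_def primary_ideal_def)
  show "open_ideal I" using I rad by (intro open_idealI_powers) (auto simp: radical_def)
  show "I \<subseteq> \<mm>"
  proof
    fix a assume a: "a \<in> I"
    have "a \<in> carrier R" by (rule ideal.Icarr[OF I a])
    then have "a [^] (1::nat) \<in> I" using a by simp
    then show "a \<in> \<mm>" using rad \<open>a \<in> carrier R\<close> unfolding radical_def by blast
  qed
qed

lemma reductionD:
  assumes "reduction R J I" "ideal I R"
  shows "ideal J R" "J \<subseteq> I"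
    and reduction_pow: "\<exists>n. \<forall>m. I \<up> (n + m) = J \<up> m \<cdot> I \<up> n"
proof -
  show J: "ideal J R" and "J \<subseteq> I" using assms by (auto simp: reduction_def)
  obtain n where n: "I \<up> (Suc n) = J \<cdot> I \<up> n" using assms unfolding reduction_def by blast
  have I': "ideal (I \<up> k) R" and J': "ideal (J \<up> k) R" for k
    using assms(2) J by (auto intro: ideal_pow_ideal)
  have "I \<up> (n + m) = J \<up> m \<cdot> I \<up> n" for m
  proof (induct m)
    case 0 then show ?case by (simp add: prod_one_left I')
  next
    case (Suc m)
    have "I \<up> (n + Suc m) = I \<cdot> I \<up> (n + m)"
      using ideal_pow_Suc[OF assms(2), of "n + m"] by (simp only: add_Suc_right)
    also have "\<dots> = J \<up> m \<cdot> (I \<cdot> I \<up> n)"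
      unfolding Suc by (rule prod_left_commute[OF assms(2) J' I'])
    also have "\<dots> = J \<up> m \<cdot> (J \<cdot> I \<up> n)"
      unfolding ideal_pow_Suc[OF assms(2), symmetric] n ..
    also have "\<dots> = J \<up> (Suc m) \<cdot> I \<up> n"
      using ideal_prod_assoc[OF J' J I'] by simp
    finally show ?case .
  qed
  then show "\<exists>n. \<forall>m. I \<up> (n + m) = J \<up> m \<cdot> I \<up> n" by blast
qed

lemma reduction_open:
  assumes "reduction R J I" "open_ideal I" shows "open_ideal J"
proof -
  obtain n where n: "I \<up> (Suc n) = J \<cdot> I \<up> n" using assms unfolding reduction_def by blast
  have J: "ideal J R" using assms by (auto simp: reduction_def)
  have "I \<up> (Suc n) \<subseteq> J"
    unfolding n by (rule prod_le1[OF J ideal_pow_ideal[OF open_idealD[OF assms(2)]]])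
  then show ?thesis using open_ideal_mono[OF open_ideal_pow[OF assms(2)] J] by blast
qed

lemma reduction_trans:
  assumes "reduction R J I" "ideal I R" "ideal W R" "W \<subseteq> J" "J \<up> (Suc n) \<subseteq> W \<cdot> J \<up> n"
  shows "reduction R W I"
proof -
  note J = reductionD(1,2)[OF assms(1,2)]
  obtain k where k: "\<And>m. I \<up> (k + m) = J \<up> m \<cdot> I \<up> k"
    using reduction_pow[OF assms(1,2)] by blast
  have I': "ideal (I \<up> l) R" and J': "ideal (J \<up> l) R" for l
    using assms(2) J by (auto intro: ideal_pow_ideal)
  have "W \<cdot> J \<up> n \<subseteq> J \<up> (Suc n)"
    unfolding ideal_pow_Suc[OF J(1)] by (intro prod_mono assms order_refl)
  then have "J \<up> (Suc n) = W \<cdot> J \<up> n" using assms(5) by blast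
  then have "I \<up> (k + Suc n) = (W \<cdot> J \<up> n) \<cdot> I \<up> k" unfolding k by simp
  also have "\<dots> = W \<cdot> I \<up> (k + n)" unfolding k by (rule ideal_prod_assoc[OF assms(3) J' I'])
  finally have "I \<up> (Suc (k + n)) = W \<cdot> I \<up> (k + n)" by (simp only: add_Suc_right)
  then show ?thesis unfolding reduction_def using assms J by blast
qed

text \<open>
  A generic reduction of \<open>J\<close> with at most \<open>d\<close> generators is a reduction of \<open>I\<close>, so by minimality it is
  \<open>J\<close>. Its generators, padded by zeros, form a system of parameters, which is regular because some
  system of parameters is.
\<close>

theorem minimal_reduction_regular:
  assumes inf: "infinite (carrier (R Quot \<mm>))" and dim: "depth R \<mm> = krull_dim R" "krull_dim R = enat d"
    and I: "open_ideal I" "I \<subseteq> \<mm>" and J: "minimal_reduction R J I"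
  shows "\<exists>xs. length xs = d \<and> set xs \<subseteq> \<mm> \<and> regular_mod {\<zero>} xs \<and> J = adjoin {\<zero>} xs"
proof -
  have Ii: "ideal I R" by (rule open_idealD[OF I(1)])
  have red: "reduction R J I" using J by (simp add: minimal_reduction_def)
  note Ji = reductionD(1,2)[OF red Ii]
  have Jo: "open_ideal J" by (rule reduction_open[OF red I(1)])
  have z: "{\<zero>} \<subseteq> \<mm>" using ideal_zero_mem[OF m_ideal] by simp
  obtain ys where ys: "length ys = d" "set ys \<subseteq> \<mm>" "regular_mod {\<zero>} ys"
    using exists_regular_parameters[OF dim] by blast
  have yo: "open_ideal (adjoin {\<zero>} ys)" using regular_open[of ys] ys dim by simp
  obtain gs where gs: "set gs \<subseteq> carrier R" "J = adjoin {\<zero>} gs" using ideal_gens[OF Ji(1)] by blast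
  have gsm: "set gs \<subseteq> \<mm>" using adjoin_mem[OF zeroideal gs(1)] gs(2) Ji(2) I(2) by blast
  have "open_ideal ({\<zero>} \<uplus> J)" using Jo by (simp add: zero_sum Ji)
  then obtain C where C: "\<And>n. len ({\<zero>} \<uplus> J \<up> n) (carrier R) \<le> enat (C * n ^ d)"
    using growth_bound[OF zeroideal Ji(1) ys(2) yo] ys(1) by blast
  obtain ws n where ws: "set ws \<subseteq> J" "length ws \<le> d"
    "J \<up> (Suc n) \<subseteq> adjoin {\<zero>} ws \<cdot> J \<up> n \<uplus> {\<zero>}"
    using exists_generic_reduction[OF inf zeroideal z gsm, of C d] C unfolding gs(2)[symmetric] by blast
  let ?xs = "ws @ replicate (d - length ws) \<zero>"
  have xs: "set ?xs \<subseteq> J" "length ?xs = d" using ws ideal_zero_mem[OF Ji(1)] by auto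
  have xsm: "set ?xs \<subseteq> \<mm>" using xs(1) Ji(2) I(2) by blast
  have xsc: "set ?xs \<subseteq> carrier R" using xsm ideal_carrier_subset[OF m_ideal] by blast
  then have wsc: "set ws \<subseteq> carrier R" by simp
  let ?W = "adjoin {\<zero>} ?xs"
  have W: "ideal ?W R" by (rule adjoin_ideal[OF zeroideal xsc])
  have WJ: "?W \<subseteq> J" using adjoin_le_iff[OF zeroideal xsc Ji(1)] xs(1) ideal_zero_mem[OF Ji(1)] by simp
  have J': "ideal (J \<up> k) R" for k by (rule ideal_pow_ideal[OF Ji(1)])
  have "adjoin {\<zero>} ws \<subseteq> ?W"
    using adjoin_le_iff[OF zeroideal wsc W] adjoin_mem[OF zeroideal xsc] ideal_zero_mem[OF W] by simp
  then have "adjoin {\<zero>} ws \<cdot> J \<up> n \<subseteq> ?W \<cdot> J \<up> n" by (intro prod_mono order_refl)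
  moreover have "adjoin {\<zero>} ws \<cdot> J \<up> n \<uplus> {\<zero>} = adjoin {\<zero>} ws \<cdot> J \<up> n"
    by (rule sum_zero[OF ideal_prod_is_ideal[OF adjoin_ideal[OF zeroideal wsc] J']])
  ultimately have "J \<up> (Suc n) \<subseteq> ?W \<cdot> J \<up> n" using ws(3) by blast
  then have "reduction R ?W I" using reduction_trans[OF red Ii W WJ] by blast
  then have WJ': "?W = J" using J WJ by (simp add: minimal_reduction_def)
  have "regular_mod {\<zero>} ?xs"
    using parameters_regular[OF inf zeroideal z ys(2,3) yo xsm] xs(2) ys(1) Jo unfolding WJ' by simp
  then show ?thesis using xs(2) xsm WJ' by (intro exI[of _ ?xs]) simp
qed

end

section \<open>Functions that are eventually polynomial\<close>

text \<open>
  The function agrees for large arguments with a polynomial of degree less than \<open>e\<close>. Iterated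
  differences avoid any reference to coefficients.
\<close>

primrec eventually_poly :: "nat \<Rightarrow> (nat \<Rightarrow> int) \<Rightarrow> bool" where
  "eventually_poly 0 f \<longleftrightarrow> (\<forall>\<^sub>F n in sequentially. f n = 0)"
| "eventually_poly (Suc e) f \<longleftrightarrow> eventually_poly e (\<lambda>n. f (Suc n) - f n)"

lemma eventually_poly_shift: "eventually_poly e (\<lambda>n. f (n + k)) \<longleftrightarrow> eventually_poly e f"
proof (induct e arbitrary: f)
  case 0 then show ?case using eventually_sequentially_seg[of "\<lambda>n. f n = 0" k] by simp
next
  case (Suc e)
  show ?case using Suc[of "\<lambda>n. f (Suc n) - f n"] by simp
qed

lemma eventually_poly_shift_back: "eventually_poly e f \<Longrightarrow> eventually_poly e (\<lambda>n. f (n - k))"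
  using eventually_poly_shift[of e "\<lambda>n. f (n - k)" k] by simp

lemma eventually_poly_cong:
  "eventually (\<lambda>n. f n = g n) sequentially \<Longrightarrow> eventually_poly e f \<longleftrightarrow> eventually_poly e g"
proof (induct e arbitrary: f g)
  case 0 then show ?case by (auto elim: eventually_elim2)
next
  case (Suc e)
  have "eventually (\<lambda>n. f (Suc n) = g (Suc n)) sequentially"
    using eventually_sequentially_Suc[of "\<lambda>n. f n = g n"] Suc(2) by blast
  then have "eventually (\<lambda>n. f (Suc n) - f n = g (Suc n) - g n) sequentially"
    using Suc(2) by (auto elim: eventually_elim2)
  then show ?case using Suc(1) by simp
qed

lemma eventually_poly_add: "eventually_poly e f \<Longrightarrow> eventually_poly e g \<Longrightarrow> eventually_poly e (\<lambda>n. f n + g n)"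
proof (induct e arbitrary: f g)
  case 0 then show ?case by (auto elim: eventually_elim2)
next
  case (Suc e)
  have "eventually_poly e (\<lambda>n. (f (Suc n) - f n) + (g (Suc n) - g n))" using Suc by simp
  then show ?case by (simp add: algebra_simps)
qed

lemma eventually_poly_uminus: "eventually_poly e f \<Longrightarrow> eventually_poly e (\<lambda>n. - f n)"
proof (induct e arbitrary: f)
  case (Suc e)
  have "eventually_poly e (\<lambda>n. f (Suc n) - f n)" using Suc(2) by simp
  from Suc(1)[OF this] show ?case by (simp add: algebra_simps)
qed simp

lemma eventually_poly_zero: "eventually_poly e (\<lambda>n. 0)"
  by (induct e) auto

lemma eventually_poly_sum:
  "(\<And>k. k \<in> A \<Longrightarrow> eventually_poly e (f k)) \<Longrightarrow> eventually_poly e (\<lambda>n. \<Sum>k\<in>A. f k n)"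
  by (induct A rule: infinite_finite_induct) (auto simp: eventually_poly_zero eventually_poly_add)

text \<open>
  The sum of \<open>h\<close> over all lists of length \<open>e\<close> with sum \<open>n\<close>, that is, over the exponents of the
  monomials of degree \<open>n\<close> in \<open>e\<close> variables.
\<close>

primrec simplex_sum :: "nat \<Rightarrow> (nat list \<Rightarrow> 'b::comm_monoid_add) \<Rightarrow> nat \<Rightarrow> 'b" where
  "simplex_sum 0 h n = (if n = 0 then h [] else 0)"
| "simplex_sum (Suc e) h n = (\<Sum>k\<le>n. simplex_sum e (\<lambda>u. h (k # u)) (n - k))"

lemma simplex_sum_cong:
  "(\<And>u. length u = e \<Longrightarrow> h u = h' u) \<Longrightarrow> simplex_sum e h n = simplex_sum e h' n"
proof (induct e arbitrary: h h' n)
  case (Suc e)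
  show ?case
    unfolding simplex_sum.simps by (intro sum.cong refl Suc(1) Suc(2)) simp
qed simp

text \<open>
  By induction on \<open>e\<close> the diagonal \<open>g k (k # u)\<close> is eventually constant in \<open>k\<close>, uniformly in \<open>u\<close>.
  By monotonicity \<open>g k (j # u)\<close> has the same value once \<open>k\<close> and \<open>j\<close> are both large. The remaining
  finitely many small \<open>j\<close> are covered by the induction hypothesis as well.
\<close>

lemma antitone_stabilizes:
  fixes g :: "nat \<Rightarrow> nat list \<Rightarrow> nat"
  assumes "\<And>k l u v. k \<le> l \<Longrightarrow> list_all2 (\<le>) u v \<Longrightarrow> length u = e \<Longrightarrow> g l v \<le> g k u"
  shows "\<exists>K. \<forall>k\<ge>K. \<forall>u. length u = e \<longrightarrow> g k u = g K u"
  using assms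
proof (induct e arbitrary: g)
  case 0
  obtain K where K: "\<And>k. g K [] \<le> g k []"
    using ex_has_least_nat[of "\<lambda>_. True" 0 "\<lambda>k. g k []"] by auto
  have "g k [] = g K []" if "k \<ge> K" for k using K[of k] 0[of K k "[]" "[]"] that by simp
  then show ?case by auto
next
  case (Suc e)
  have refl: "list_all2 (\<le>) u u" for u :: "nat list" by (rule list_all2_refl) simp
  obtain K1 where K1: "\<And>k u. k \<ge> K1 \<Longrightarrow> length u = e \<Longrightarrow> g k (k # u) = g K1 (K1 # u)"
  proof -
    have "\<exists>K. \<forall>k\<ge>K. \<forall>u. length u = e \<longrightarrow> g k (k # u) = g K (K # u)"
      by (rule Suc(1), rule Suc(2)) auto
    then show ?thesis using that by blast
  qed
  have "\<exists>K. \<forall>k\<ge>K. \<forall>u. length u = e \<longrightarrow> g k (j # u) = g K (j # u)" for j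
    by (rule Suc(1), rule Suc(2)) auto
  then obtain L where L: "\<And>j k u. k \<ge> L j \<Longrightarrow> length u = e \<Longrightarrow> g k (j # u) = g (L j) (j # u)" by metis
  define K where "K = Max (insert K1 (L ` {..<K1}))"
  have K: "K1 \<le> K" "\<And>j. j < K1 \<Longrightarrow> L j \<le> K" by (simp_all add: K_def)
  have "g k u = g K u" if k: "k \<ge> K" and u: "length u = Suc e" for k u
  proof -
    obtain j u' where ju: "u = j # u'" "length u' = e" using u by (cases u) auto
    show ?thesis
    proof (cases "j < K1")
      case True
      then show ?thesis using L[of j k u'] L[of j K u'] K(2)[of j] k ju by simp
    next
      case False
      have "g l u = g K1 (K1 # u')" if l: "l \<ge> K1" for l
      proof (rule antisym)
        show "g l u \<le> g K1 (K1 # u')" using Suc(2)[of K1 l "K1 # u'" u] l False ju refl by simp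
        have "g (max l j) (max l j # u') \<le> g l u"
          using Suc(2)[of l "max l j" u "max l j # u'"] ju refl by simp
        then show "g K1 (K1 # u') \<le> g l u" using K1[of "max l j" u'] l ju by simp
      qed
      then show ?thesis using k K(1) by (metis order_trans)
    qed
  qed
  then show ?case by blast
qed

text \<open>
  For large first exponent \<open>k\<close> the slice \<open>h (k # u)\<close> does not depend on \<open>k\<close>. So the difference of
  consecutive sums consists of finitely many sums in one variable less.
\<close>

lemma eventually_poly_antitone:
  fixes h :: "nat list \<Rightarrow> nat"
  assumes "\<And>u v. list_all2 (\<le>) u v \<Longrightarrow> length u = e \<Longrightarrow> h v \<le> h u"
  shows "eventually_poly e (simplex_sum e (\<lambda>u. int (h u)))"
  using assms
proof (induct e arbitrary: h)
  case 0
  show ?case unfolding eventually_poly.simps eventually_sequentially by (intro exI[of _ 1]) simp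
next
  case (Suc e)
  obtain K where K: "\<And>k u. k \<ge> K \<Longrightarrow> length u = e \<Longrightarrow> h (k # u) = h (K # u)"
  proof -
    have "\<exists>K. \<forall>k\<ge>K. \<forall>u. length u = e \<longrightarrow> h (k # u) = h (K # u)"
      by (rule antitone_stabilizes, rule Suc(2)) auto
    then show ?thesis using that by blast
  qed
  define f where "f k = simplex_sum e (\<lambda>u. int (h (k # u)))" for k
  have f: "eventually_poly e (f k)" for k
    unfolding f_def by (rule Suc(1)) (use Suc(2) in auto)
  have fK: "f k = f K" if "k \<ge> K" for k
    unfolding f_def using K[OF that] by (intro ext simplex_sum_cong) simp
  define F where "F = simplex_sum (Suc e) (\<lambda>u. int (h u))"
  have F: "F m = (\<Sum>k<K. f k (m - k)) + (\<Sum>i\<le>m - K. f K i)" if "m \<ge> K" for m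
  proof -
    have "F m = (\<Sum>k\<in>{..<K} \<union> {K..m}. f k (m - k))"
      unfolding F_def f_def using that by (auto intro!: sum.cong)
    also have "\<dots> = (\<Sum>k<K. f k (m - k)) + (\<Sum>k\<in>{K..m}. f k (m - k))"
      by (rule sum.union_disjoint) auto
    also have "(\<Sum>k\<in>{K..m}. f k (m - k)) = (\<Sum>k\<in>{K..m}. f K (m - k))"
      by (rule sum.cong[OF refl], rule fun_cong[OF fK]) simp
    also have "\<dots> = (\<Sum>i\<le>m - K. f K i)"
      by (rule sum.reindex_bij_witness[of _ "\<lambda>i. m - i" "\<lambda>k. m - k"]) (use that in auto)
    finally show ?thesis .
  qed
  have "F (Suc n) - F n = (\<Sum>k<K. f k (Suc n - k) + - f k (n - k)) + f K (Suc n - K)" if "n \<ge> K" for n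
    using F[of n] F[of "Suc n"] that by (simp add: Suc_diff_le sum_subtractf)
  then have "eventually (\<lambda>n. F (Suc n) - F n = (\<Sum>k<K. f k (Suc n - k) + - f k (n - k)) + f K (Suc n - K)) sequentially"
    by (auto simp: eventually_sequentially)
  moreover have shifted: "eventually_poly e (\<lambda>n. f k (Suc n - j))" for k j
    using eventually_poly_shift[of e "\<lambda>n. f k (n - j)" 1] eventually_poly_shift_back[OF f] by simp
  have "eventually_poly e (\<lambda>n. (\<Sum>k<K. f k (Suc n - k) + - f k (n - k)) + f K (Suc n - K))"
    by (intro eventually_poly_add eventually_poly_sum eventually_poly_uminus shifted eventually_poly_shift_back f)
  ultimately have "eventually_poly (Suc e) F" using eventually_poly_cong by simp
  then show ?case by (simp add: F_def)
qed

text \<open>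
  The polynomials \<open>binom (n + i - 1) i\<close>, in which the coefficients \<open>g\<^sub>i\<close> are expressed.
\<close>

definition hilbert_basis :: "nat \<Rightarrow> nat \<Rightarrow> nat" where
  "hilbert_basis i n = (n + i - 1) choose i"

lemma hilbert_basis_0 [simp]: "hilbert_basis 0 n = 1"
  by (simp add: hilbert_basis_def)

lemma hilbert_basis_diff: "hilbert_basis (Suc i) (Suc n) = hilbert_basis (Suc i) n + hilbert_basis i (Suc n)"
  by (simp add: hilbert_basis_def)

lemma eventually_poly_basis:
  "eventually_poly (Suc d) f \<Longrightarrow>
    \<exists>a. eventually (\<lambda>n. f n = (\<Sum>i\<le>d. a i * int (hilbert_basis i n))) sequentially"
proof (induct d arbitrary: f)
  case 0
  then obtain N where N: "\<And>n. n \<ge> N \<Longrightarrow> f (Suc n) = f n" by (auto simp: eventually_sequentially)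
  have "f (N + k) = f N" for k by (induct k) (use N in auto)
  then have "\<forall>n\<ge>N. f n = (\<Sum>i\<le>0. (\<lambda>_. f N) i * int (hilbert_basis i n))" by (metis le_Suc_ex atMost_0 hilbert_basis_0 mult_1_right of_nat_1 sum.empty sum.insert finite.emptyI empty_iff add_0_right)
  then show ?case by (auto simp: eventually_sequentially intro!: exI[of _ "\<lambda>_. f N"])
next
  case (Suc d)
  define g where "g n = f n - f (n - 1)" for n
  have "eventually_poly (Suc d) (\<lambda>n. g (n + 1))" using Suc(2) by (simp add: g_def)
  then have "eventually_poly (Suc d) g" using eventually_poly_shift[of "Suc d" g 1] by blast
  then obtain b N where b: "\<And>n. n \<ge> N \<Longrightarrow> g n = (\<Sum>i\<le>d. b i * int (hilbert_basis i n))"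
    using Suc(1)[of g] by (auto simp: eventually_sequentially)
  define q where "q n = (\<Sum>i\<le>d. b i * int (hilbert_basis (Suc i) n))" for n
  define c where "c = f N - q N"
  have "f (N + k) - q (N + k) = c" for k
  proof (induct k)
    case (Suc k)
    have "q (Suc (N + k)) - q (N + k) = g (Suc (N + k))"
      unfolding q_def using b[of "Suc (N + k)"]
      by (simp add: hilbert_basis_diff sum_subtractf[symmetric] algebra_simps)
    then show ?case using Suc by (simp add: g_def)
  qed (simp add: c_def)
  then have "f n = c + q n" if "n \<ge> N" for n using that by (metis add.commute diff_add_cancel le_Suc_ex)
  then have "f n = (\<Sum>i\<le>Suc d. (case i of 0 \<Rightarrow> c | Suc j \<Rightarrow> b j) * int (hilbert_basis i n))" if "n \<ge> N" for n
    using that by (simp add: sum.atMost_Suc_shift q_def del: sum.atMost_Suc)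
  then show ?case
    unfolding eventually_sequentially
    by (intro exI[of _ "\<lambda>i. case i of 0 \<Rightarrow> c | Suc j \<Rightarrow> b j"] exI[of _ N]) blast
qed

lemma hilbert_basis_limit: "(\<lambda>n. real (hilbert_basis i n) / real n ^ i) \<longlonglongrightarrow> 1 / fact i"
proof (induct i)
  case (Suc i)
  have step: "real (hilbert_basis (Suc i) n) / real n ^ Suc i
      = (real (hilbert_basis i n) / real n ^ i) * ((1 + real i / real n) / real (Suc i))" if "n \<ge> 1" for n
  proof -
    have "Suc i * hilbert_basis (Suc i) n = (n + i) * hilbert_basis i n"
      using Suc_times_binomial[of i "n + i - 1"] that by (simp add: hilbert_basis_def)
    then have "real (Suc i) * real (hilbert_basis (Suc i) n) = (real n + real i) * real (hilbert_basis i n)"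
      by (metis of_nat_add of_nat_mult)
    then have 1: "real (hilbert_basis (Suc i) n) = (real n + real i) * real (hilbert_basis i n) / real (Suc i)"
      by (simp only: eq_divide_eq mult.commute) simp
    have 2: "1 + real i / real n = (real n + real i) / real n" using that by (simp add: field_simps)
    show ?thesis unfolding 1 2 power_Suc by (simp only: divide_inverse inverse_mult_distrib ac_simps)
  qed
  have "(\<lambda>n. (real (hilbert_basis i n) / real n ^ i) * ((1 + real i / real n) / real (Suc i)))
      \<longlonglongrightarrow> (1 / fact i) * ((1 + 0) / real (Suc i))"
    by (intro tendsto_intros Suc lim_const_over_n) auto
  then have "(\<lambda>n. (real (hilbert_basis i n) / real n ^ i) * ((1 + real i / real n) / real (Suc i)))
      \<longlonglongrightarrow> 1 / fact (Suc i)" by (simp add: mult.commute)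
  then show ?case
    by (rule Lim_transform_eventually) (use step in \<open>auto simp: eventually_sequentially intro!: exI[of _ 1]\<close>)
qed simp

lemma hilbert_sum_limit:
  fixes a :: "nat \<Rightarrow> int"
  shows "(\<lambda>n. real_of_int (\<Sum>i\<le>d. a i * int (hilbert_basis i n)) / real n ^ d) \<longlonglongrightarrow> real_of_int (a d) / fact d"
proof -
  have each: "(\<lambda>n. real_of_int (a i) * (real (hilbert_basis i n) / real n ^ d)) \<longlonglongrightarrow>
      (if i = d then real_of_int (a d) / fact d else 0)" if "i \<le> d" for i
  proof (cases "i = d")
    case True
    then show ?thesis using tendsto_mult_left[OF hilbert_basis_limit[of d], of "real_of_int (a d)"] by simp
  next
    case False
    have "(\<lambda>n. 1 / real n) \<longlonglongrightarrow> 0" by (rule lim_const_over_n)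
    then have "(\<lambda>n. (1 / real n) ^ (d - i)) \<longlonglongrightarrow> 0 ^ (d - i)" by (rule tendsto_power)
    then have "(\<lambda>n. real_of_int (a i) * ((real (hilbert_basis i n) / real n ^ i) * (1 / real n) ^ (d - i)))
        \<longlonglongrightarrow> real_of_int (a i) * ((1 / fact i) * 0 ^ (d - i))"
      by (intro tendsto_mult tendsto_const hilbert_basis_limit)
    moreover have "real_of_int (a i) * ((real (hilbert_basis i n) / real n ^ i) * (1 / real n) ^ (d - i))
        = real_of_int (a i) * (real (hilbert_basis i n) / real n ^ d)" for n
    proof -
      have "real n ^ d = real n ^ i * real n ^ (d - i)" using that by (simp flip: power_add)
      then show ?thesis by (simp add: divide_inverse power_inverse)
    qed
    moreover have "(0::real) ^ (d - i) = 0" using False that by simp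
    ultimately show ?thesis using False by simp
  qed
  have "(\<lambda>n. \<Sum>i\<le>d. real_of_int (a i) * (real (hilbert_basis i n) / real n ^ d)) \<longlonglongrightarrow>
      (\<Sum>i\<le>d. if i = d then real_of_int (a d) / fact d else 0)"
    using each by (intro tendsto_sum) auto
  then show ?thesis by (simp add: sum_divide_distrib)
qed

text \<open>
  The leading coefficient is read off from a limit, so all coefficients vanish, from the top down.
\<close>

lemma hilbert_sum_unique:
  fixes a :: "nat \<Rightarrow> int"
  assumes "eventually (\<lambda>n. (\<Sum>i\<le>d. a i * int (hilbert_basis i n)) = 0) sequentially" "i \<le> d"
  shows "a i = 0"
  using assms
proof (induct d)
  case 0
  then show ?case by (auto simp: eventually_sequentially)
next
  case (Suc d)
  have "eventually (\<lambda>n. real_of_int (\<Sum>i\<le>Suc d. a i * int (hilbert_basis i n)) / real n ^ Suc d = 0) sequentially"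
    using Suc(2) by (rule eventually_mono) simp
  then have "(\<lambda>n. real_of_int (\<Sum>i\<le>Suc d. a i * int (hilbert_basis i n)) / real n ^ Suc d) \<longlonglongrightarrow> 0"
    by (rule tendsto_eventually)
  then have "real_of_int (a (Suc d)) / fact (Suc d) = 0"
    using hilbert_sum_limit[of a "Suc d"] LIMSEQ_unique by blast
  then have top: "a (Suc d) = 0" by simp
  then show ?case using Suc by (cases "i = Suc d") auto
qed

lemma hilbert_coeff_exists:
  assumes "eventually_poly (Suc d) (\<lambda>n. int (f n))"
  obtains a where "eventually (\<lambda>n. int (f n) = (\<Sum>i\<le>d. a i * int (hilbert_basis i n))) sequentially"
    "\<And>i. i \<le> d \<Longrightarrow> hilbert_coeff d f i = (-1) ^ i * a (d - i)"
proof -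
  obtain a where a: "eventually (\<lambda>n. int (f n) = (\<Sum>i\<le>d. a i * int (hilbert_basis i n))) sequentially"
    using eventually_poly_basis[OF assms] by blast
  have sum_eq: "(\<Sum>i=0..d. (-1) ^ i * c i * int ((n + d - i - 1) choose (d - i)))
      = (\<Sum>i\<le>d. ((-1) ^ (d - i) * c (d - i)) * int (hilbert_basis i n))" for c :: "nat \<Rightarrow> int" and n
    by (rule sum.reindex_bij_witness[of _ "\<lambda>i. d - i" "\<lambda>i. d - i"])
      (auto simp: hilbert_basis_def)
  define c where "c i = (if i \<le> d then (-1) ^ i * a (d - i) else 0)" for i
  have c: "is_hilbert_coeffs d f c"
    unfolding is_hilbert_coeffs_def sum_eq
  proof (intro conjI allI impI)
    have "(\<Sum>i\<le>d. ((-1) ^ (d - i) * c (d - i)) * int (hilbert_basis i n)) = (\<Sum>i\<le>d. a i * int (hilbert_basis i n))" for n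
      by (rule sum.cong) (auto simp: c_def simp flip: power_add mult.assoc)
    then show "eventually (\<lambda>n. int (f n) = (\<Sum>i\<le>d. ((-1) ^ (d - i) * c (d - i)) * int (hilbert_basis i n))) sequentially"
      using a by simp
  qed (simp add: c_def)
  moreover have "c' = c" if c': "is_hilbert_coeffs d f c'" for c'
  proof
    fix i
    show "c' i = c i"
    proof (cases "i \<le> d")
      case False then show ?thesis using c c' by (auto simp: is_hilbert_coeffs_def)
    next
      case True
      define b where "b j = (-1) ^ (d - j) * c' (d - j) - (-1) ^ (d - j) * c (d - j)" for j
      have "eventually (\<lambda>n. (\<Sum>i\<le>d. b i * int (hilbert_basis i n)) = 0) sequentially"
      proof -
        have "eventually (\<lambda>n. (\<Sum>i\<le>d. ((-1) ^ (d - i) * c' (d - i)) * int (hilbert_basis i n))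
            = (\<Sum>i\<le>d. ((-1) ^ (d - i) * c (d - i)) * int (hilbert_basis i n))) sequentially"
          using c c' unfolding is_hilbert_coeffs_def sum_eq by (auto elim: eventually_elim2)
        then show ?thesis by (rule eventually_mono) (simp add: b_def sum_subtractf left_diff_distrib)
      qed
      then have "b (d - i) = 0" by (rule hilbert_sum_unique) simp
      then show ?thesis using True by (simp add: b_def)
    qed
  qed
  ultimately have "hilbert_coeff d f = c" unfolding hilbert_coeff_def by (rule the_equality)
  then show ?thesis using that[OF a] by (simp add: c_def)
qed

lemma simplex_sum_ge:
  fixes h :: "nat list \<Rightarrow> enat"
  shows "length u = e \<Longrightarrow> h u \<le> simplex_sum e h (sum_list u)"
proof (induct e arbitrary: h u)
  case (Suc e)
  obtain k v where u: "u = k # v" "length v = e" using Suc(2) by (cases u) auto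
  have "h u \<le> simplex_sum e (\<lambda>u. h (k # u)) (sum_list u - k)"
    using Suc(1)[of v "\<lambda>u. h (k # u)"] u by simp
  also have "\<dots> \<le> (\<Sum>k\<le>sum_list u. simplex_sum e (\<lambda>u. h (k # u)) (sum_list u - k))"
    using u by (intro member_le_sum[where f = "\<lambda>k. simplex_sum e (\<lambda>u. h (k # u)) (sum_list u - k)"]) auto
  finally show ?case by simp
qed simp

lemma simplex_sum_enat:
  fixes h :: "nat list \<Rightarrow> nat"
  shows "simplex_sum e (\<lambda>u. enat (h u)) n = enat (simplex_sum e h n)"
proof (induct e arbitrary: h n)
  case (Suc e)
  have "(\<Sum>k\<in>A. enat (g k)) = enat (\<Sum>k\<in>A. g k)" for A and g :: "nat \<Rightarrow> nat"
    by (induct A rule: infinite_finite_induct) (auto simp: zero_enat_def)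
  then show ?case using Suc by simp
qed (auto simp: zero_enat_def)

lemma simplex_sum_int:
  fixes h :: "nat list \<Rightarrow> nat"
  shows "simplex_sum e (\<lambda>u. int (h u)) n = int (simplex_sum e h n)"
  by (induct e arbitrary: h n) auto

context cring begin

section \<open>Hilbert functions of graded modules\<close>

text \<open>
  The part of \<open>J\<^sup>m B\<close> that is divisible by \<open>x\<close>, multiplied by \<open>x\<^sup>k\<close>. In degree \<open>0\<close> there is none,
  which the truncated subtraction \<open>m - 1\<close> would miss.
\<close>

definition slice_rest :: "'a set \<Rightarrow> 'a set \<Rightarrow> 'a \<Rightarrow> nat \<Rightarrow> nat \<Rightarrow> 'a set" where
  "slice_rest B J x k m = (if m = 0 then {\<zero>} else (PIdl (x [^] Suc k)) \<cdot> (J \<up> (m - 1) \<cdot> B))"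

text \<open>
  For a graded family \<open>Q\<close> of relations on the module of forms in \<open>x # xs\<close> with coefficients in \<open>B\<close>: the
  relations satisfied by those forms in \<open>xs\<close> that are the coefficients of \<open>x\<^sup>k\<close>, where higher powers
  of \<open>x\<close> are neglected.
\<close>

definition slice :: "'a set \<Rightarrow> 'a set \<Rightarrow> 'a \<Rightarrow> (nat \<Rightarrow> 'a set) \<Rightarrow> nat \<Rightarrow> nat \<Rightarrow> 'a set" where
  "slice B J x Q k m = colon (Q (m + k) \<uplus> slice_rest B J x k m) (x [^] k)"

text \<open>
  The contribution of the monomial with exponents \<open>u\<close> to the length of a graded piece: the length of
  the module of its possible coefficients modulo those that can be rewritten with monomials of higher
  lexicographic order.
\<close>

primrec monomial_len :: "'a set \<Rightarrow> 'a list \<Rightarrow> (nat \<Rightarrow> 'a set) \<Rightarrow> nat list \<Rightarrow> enat" where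
  "monomial_len B [] Q u = len (Q 0) (Q 0 \<uplus> B)"
| "monomial_len B (x # xs) Q u = monomial_len B xs (slice B (adjoin {\<zero>} (x # xs)) x Q (hd u)) (tl u)"

lemma slice_rest_ideal:
  "ideal B R \<Longrightarrow> ideal J R \<Longrightarrow> x \<in> carrier R \<Longrightarrow> ideal (slice_rest B J x k m) R"
  unfolding slice_rest_def by (auto intro!: ideal_ops simp del: Group.nat_pow_Suc)

lemma slice_ideal:
  "ideal B R \<Longrightarrow> ideal J R \<Longrightarrow> x \<in> carrier R \<Longrightarrow> (\<And>n. ideal (Q n) R) \<Longrightarrow> ideal (slice B J x Q k m) R"
  unfolding slice_def by (intro colon_ideal add_ideals slice_rest_ideal) auto

text \<open>
  The forms divisible by \<open>x\<^sup>k\<close>, for \<open>k = 0, 1, \<dots>\<close>, filter the graded piece of degree \<open>n\<close>. The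
  \<open>k\<close>-th quotient is a graded piece of degree \<open>n - k\<close> in the variables \<open>xs\<close> for the slice of
  relations, so the recursion of \<open>monomial_len\<close> follows that of \<open>simplex_sum\<close>.
\<close>

lemma len_graded_piece:
  assumes "ideal B R" "set xs \<subseteq> carrier R" "\<And>n. ideal (Q n) R"
  shows "len (Q n) (Q n \<uplus> (adjoin {\<zero>} xs) \<up> n \<cdot> B)
    = simplex_sum (length xs) (monomial_len B xs Q) n"
  using assms(2,3)
proof (induct xs arbitrary: Q n)
  case Nil
  show ?case
  proof (cases n)
    case 0 then show ?thesis by (simp add: prod_one_left assms)
  next
    case (Suc m)
    have "{\<zero>} \<up> n = {\<zero>}"
      using ideal_pow_ideal[OF zeroideal] by (simp add: Suc ideal_prod_zero)
    then show ?thesis using Suc by (simp add: prod_zero_left assms sum_zero Nil)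
  qed
next
  case (Cons x xs)
  have x: "x \<in> carrier R" "set xs \<subseteq> carrier R" using Cons by auto
  let ?J = "adjoin {\<zero>} (x # xs)" and ?I = "adjoin {\<zero>} xs"
  have J: "ideal ?J R" and I: "ideal ?I R" using x Cons(2) by (auto simp: zeroideal cgenideal_ideal zero_sum)
  have J_eq: "?J = ?I \<uplus> PIdl x" using adjoin_sum[OF zeroideal cgenideal_ideal[OF x(1)] x(2)] by simp
  have xk: "x [^] k \<in> carrier R" and P: "ideal (PIdl (x [^] k)) R" for k :: nat using x by (auto intro: cgenideal_ideal)
  have J': "ideal (?J \<up> k \<cdot> B) R" and I': "ideal (?I \<up> k \<cdot> B) R" for k
    using J I assms(1) by (auto intro: ideal_prod_is_ideal ideal_pow_ideal)
  define S where "S k = (if k \<le> n then (PIdl (x [^] k)) \<cdot> (?J \<up> (n - k) \<cdot> B) else {\<zero>})" for k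
  have S: "ideal (S k) R" for k unfolding S_def using P J' by (auto intro: ideal_prod_is_ideal zeroideal)
  define T where "T k = Q n \<uplus> S k" for k
  have T: "ideal (T k) R" for k unfolding T_def by (rule add_ideals[OF Cons(3) S])
  have rest: "slice_rest B ?J x k (n - k) = S (Suc k)" if "k \<le> n" for k
    using that by (auto simp: slice_rest_def S_def simp del: Group.nat_pow_Suc adjoin.simps)
  have split: "S k = S (Suc k) \<uplus> (PIdl (x [^] k)) \<cdot> (?I \<up> (n - k) \<cdot> B)" if k: "k \<le> n" for k
  proof (cases "n - k")
    case 0
    then have "S (Suc k) = {\<zero>}" using k by (simp add: S_def)
    then show ?thesis using 0 k zero_sum[OF ideal_prod_is_ideal[OF P[of k] I'[of 0]]] by (simp add: S_def)
  next
    case (Suc j)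
    have Jj: "ideal (?J \<up> j) R" and Ij: "ideal (?I \<up> (Suc j)) R"
      using J I by (auto intro: ideal_pow_ideal simp del: Group.nat_pow_Suc)
    have Px: "ideal (PIdl x) R" by (rule cgenideal_ideal[OF x(1)])
    have "?J \<up> (Suc j) \<cdot> B = (?I \<up> (Suc j) \<uplus> (PIdl x) \<cdot> ?J \<up> j) \<cdot> B"
      unfolding J_eq pow_sum_principal[OF I x(1)] ..
    also have "\<dots> = ?I \<up> (Suc j) \<cdot> B \<uplus> ((PIdl x) \<cdot> ?J \<up> j) \<cdot> B"
      by (rule ideal_prod_distr(2)[OF assms(1) Ij ideal_prod_is_ideal[OF Px Jj]])
    also have "((PIdl x) \<cdot> ?J \<up> j) \<cdot> B = (PIdl x) \<cdot> (?J \<up> j \<cdot> B)"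
      by (rule ideal_prod_assoc[OF Px Jj assms(1)])
    finally have "(PIdl (x [^] k)) \<cdot> (?J \<up> (Suc j) \<cdot> B) =
        (PIdl (x [^] k)) \<cdot> (?I \<up> (Suc j) \<cdot> B) \<uplus> (PIdl (x [^] k)) \<cdot> ((PIdl x) \<cdot> (?J \<up> j \<cdot> B))"
      using ideal_prod_distr(1)[OF P[of k] I'[of "Suc j"] ideal_prod_is_ideal[OF Px J'[of j]]] by (simp only:)
    also have "(PIdl (x [^] k)) \<cdot> ((PIdl x) \<cdot> (?J \<up> j \<cdot> B)) = (PIdl (x [^] Suc k)) \<cdot> (?J \<up> j \<cdot> B)"
      using smul_assoc[OF xk x(1) J'] by simp
    also have "\<dots> = S (Suc k)"
    proof -
      have "Suc k \<le> n" "n - Suc k = j" using Suc by auto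
      then show ?thesis unfolding S_def by simp
    qed
    finally show ?thesis
      using k Suc sum_commute[OF ideal_prod_is_ideal[OF P I'] S]
      by (simp add: S_def del: Group.nat_pow_Suc adjoin.simps)
  qed
  have TT: "T k = T (Suc k) \<uplus> (PIdl (x [^] k)) \<cdot> (?I \<up> (n - k) \<cdot> B)" if "k \<le> n" for k
    unfolding T_def split[OF that] by (rule sum_assoc[OF Cons(3) S ideal_prod_is_ideal[OF P I'], symmetric])
  have step: "len (T (Suc k)) (T k) = simplex_sum (length xs) (\<lambda>u. monomial_len B (x # xs) Q (k # u)) (n - k)"
    if k: "k \<le> n" for k
  proof -
    have sl: "slice B ?J x Q k (n - k) = colon (T (Suc k)) (x [^] k)"
      unfolding slice_def rest[OF k] T_def using k by simp
    have "len (T (Suc k)) (T k) = len ((?I \<up> (n - k) \<cdot> B) \<inter> colon (T (Suc k)) (x [^] k)) (?I \<up> (n - k) \<cdot> B)"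
      unfolding TT[OF k] by (rule len_smul[OF T I' xk])
    also have "\<dots> = len (colon (T (Suc k)) (x [^] k)) (colon (T (Suc k)) (x [^] k) \<uplus> ?I \<up> (n - k) \<cdot> B)"
      by (rule len_diamond[OF colon_ideal[OF T xk] I', symmetric])
    also have "\<dots> = simplex_sum (length xs) (monomial_len B xs (slice B ?J x Q k)) (n - k)"
      unfolding sl[symmetric] by (rule Cons(1)[OF x(2) slice_ideal[OF assms(1) J x(1) Cons(3)]])
    finally show ?thesis by simp
  qed
  have tel: "k \<le> Suc n \<Longrightarrow> T k \<subseteq> T 0 \<and> len (T k) (T 0) = (\<Sum>j<k. len (T (Suc j)) (T j))" for k
  proof (induct k)
    case (Suc k)
    then have IH: "T k \<subseteq> T 0" "len (T k) (T 0) = (\<Sum>j<k. len (T (Suc j)) (T j))" and k: "k \<le> n" by auto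
    have le: "T (Suc k) \<subseteq> T k" unfolding TT[OF k] by (rule sum_upper1[OF T ideal_prod_is_ideal[OF P I']])
    have "len (T (Suc k)) (T 0) = len (T (Suc k)) (T k) + len (T k) (T 0)" by (rule len_add[OF T T T le IH(1)])
    then show ?case using IH le by (auto simp: add.commute)
  qed simp
  have "T (Suc n) = Q n" unfolding T_def S_def using sum_zero[OF Cons(3)] by simp
  moreover have "T 0 = Q n \<uplus> ?J \<up> n \<cdot> B"
    unfolding T_def S_def using prod_one_left[OF J'] by (simp add: PIdl_one del: adjoin.simps)
  ultimately have "len (Q n) (Q n \<uplus> ?J \<up> n \<cdot> B) = (\<Sum>k<Suc n. len (T (Suc k)) (T k))"
    using tel[of "Suc n"] by simp
  also have "\<dots> = simplex_sum (length (x # xs)) (monomial_len B (x # xs) Q) n"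
    using step by (simp add: lessThan_Suc_atMost del: sum.lessThan_Suc monomial_len.simps)
  finally show ?case .
qed

lemma monomial_len_mono:
  assumes "ideal B R" "set xs \<subseteq> carrier R" "\<And>n. ideal (Q n) R" "\<And>n. ideal (Q' n) R" "\<And>n. Q n \<subseteq> Q' n"
  shows "monomial_len B xs Q' u \<le> monomial_len B xs Q u"
  using assms(2-)
proof (induct xs arbitrary: Q Q' u)
  case Nil then show ?case using len_sum_antimono[OF _ _ assms(1)] by simp
next
  case (Cons x xs)
  have x: "x \<in> carrier R" "set xs \<subseteq> carrier R" using Cons by auto
  let ?J = "adjoin {\<zero>} (x # xs)"
  have J: "ideal ?J R" by (rule adjoin_ideal[OF zeroideal Cons(2)])
  have "slice B ?J x Q k m \<subseteq> slice B ?J x Q' k m" for k m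
    unfolding slice_def colon_def using isum_mono[OF Cons(5)[of "m + k"] order_refl] by blast
  then show ?case
    using Cons(1)[OF x(2) slice_ideal[OF assms(1) J x(1) Cons(3)] slice_ideal[OF assms(1) J x(1) Cons(4)]]
    by (simp del: adjoin.simps)
qed

text \<open>
  Multiplying a relation by a variable gives a relation, so the modules of coefficients shrink when
  exponents grow.
\<close>

lemma monomial_len_antitone:
  assumes B: "ideal B R" and "set xs \<subseteq> carrier R" "\<And>n. ideal (Q n) R"
    and "\<And>x n. x \<in> set xs \<Longrightarrow> Q n \<subseteq> colon (Q (Suc n)) x"
    and "list_all2 (\<le>) u v" "length u = length xs"
  shows "monomial_len B xs Q v \<le> monomial_len B xs Q u"
  using assms(2-)
proof (induct xs arbitrary: Q u v)
  case Nil then show ?case by simp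
next
  case (Cons x xs)
  have x: "x \<in> carrier R" "set xs \<subseteq> carrier R" using Cons by auto
  let ?J = "adjoin {\<zero>} (x # xs)"
  have J: "ideal ?J R" by (rule adjoin_ideal[OF zeroideal Cons(2)])
  have JB: "ideal (?J \<up> k \<cdot> B) R" for k using J B by (auto intro: ideal_prod_is_ideal ideal_pow_ideal)
  have xk: "x [^] k \<in> carrier R" and P: "ideal (PIdl (x [^] k)) R" for k :: nat using x by (auto intro: cgenideal_ideal)
  obtain k u' l v' where uv: "u = k # u'" "v = l # v'" "k \<le> l" "list_all2 (\<le>) u' v'" "length u' = length xs"
    using Cons(5,6) by (cases u; cases v) auto
  note si = slice_ideal[OF B J x(1) Cons(3)]
  note ri = slice_rest_ideal[OF B J x(1)]
  have id: "ideal (Q (m + k) \<uplus> slice_rest B ?J x k m) R" for m k by (rule add_ideals[OF Cons(3) ri])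
  have up: "slice B ?J x Q k m \<subseteq> slice B ?J x Q (Suc k) m" for k m
  proof
    fix a assume "a \<in> slice B ?J x Q k m"
    then have a: "a \<in> carrier R" "x [^] k \<otimes> a \<in> Q (m + k) \<uplus> slice_rest B ?J x k m"
      by (auto simp: slice_def colon_def)
    let ?E = "Q (m + Suc k) \<uplus> slice_rest B ?J x (Suc k) m"
    have E: "ideal (colon ?E x) R" by (rule colon_ideal[OF id x(1)])
    have "Q (m + k) \<subseteq> colon (Q (m + Suc k)) x" using Cons(4)[of x "m + k"] by simp
    then have 1: "Q (m + k) \<subseteq> colon ?E x" using sum_upper1[OF Cons(3) ri] unfolding colon_def by blast
    have "(PIdl x) \<cdot> slice_rest B ?J x k m \<subseteq> slice_rest B ?J x (Suc k) m"
    proof (cases "m = 0")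
      case True
      then show ?thesis using ideal_prod_zero[OF cgenideal_ideal[OF x(1)]] by (simp add: slice_rest_def)
    next
      case False
      have "(PIdl x) \<cdot> ((PIdl (x [^] Suc k)) \<cdot> (?J \<up> (m - 1) \<cdot> B)) =
        (PIdl (x \<otimes> x [^] Suc k)) \<cdot> (?J \<up> (m - 1) \<cdot> B)"
        by (rule smul_assoc[OF x(1) xk JB, symmetric])
      also have "x \<otimes> x [^] Suc k = x [^] Suc (Suc k)" by (rule nat_pow_Suc2[OF x(1), symmetric])
      finally show ?thesis using False by (simp add: slice_rest_def del: Group.nat_pow_Suc adjoin.simps)
    qed
    then have "(PIdl x) \<cdot> slice_rest B ?J x k m \<subseteq> ?E"
      using sum_upper2[OF Cons(3)[of "m + Suc k"] ri[of "Suc k" m]] by blast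
    then have 2: "slice_rest B ?J x k m \<subseteq> colon ?E x" using smul_le_iff[OF x(1) ri] by blast
    have "x [^] k \<otimes> a \<in> colon ?E x" using a(2) sum_le_iff[OF Cons(3) ri E] 1 2 by blast
    then have "x \<otimes> (x [^] k \<otimes> a) \<in> ?E" by (simp add: colon_def)
    moreover have "x \<otimes> (x [^] k \<otimes> a) = x [^] Suc k \<otimes> a"
      unfolding nat_pow_Suc2[OF x(1)] using x(1) a(1) by (simp add: m_assoc)
    ultimately show "a \<in> slice B ?J x Q (Suc k) m" using a(1) by (simp only: slice_def colon_def mem_Collect_eq)
  qed
  have "slice B ?J x Q k m \<subseteq> slice B ?J x Q l m" for m
    by (rule lift_Suc_mono_le[of "\<lambda>k. slice B ?J x Q k m"]) (use up uv(3) in auto)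
  then have "monomial_len B xs (slice B ?J x Q l) u' \<le> monomial_len B xs (slice B ?J x Q k) u'"
    by (intro monomial_len_mono[OF B x(2) si si])
  moreover have "monomial_len B xs (slice B ?J x Q l) v' \<le> monomial_len B xs (slice B ?J x Q l) u'"
  proof (rule Cons(1)[OF x(2) si _ uv(4,5)])
    fix y m assume y: "y \<in> set xs"
    have yc: "y \<in> carrier R" using y x(2) by blast
    have yJ: "y \<in> ?J" using adjoin_mem[OF zeroideal Cons(2)] y by auto
    show "slice B ?J x Q l m \<subseteq> colon (slice B ?J x Q l (Suc m)) y"
    proof
      fix a assume "a \<in> slice B ?J x Q l m"
      then have a: "a \<in> carrier R" "x [^] l \<otimes> a \<in> Q (m + l) \<uplus> slice_rest B ?J x l m"
        by (auto simp: slice_def colon_def)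
      let ?E = "Q (Suc m + l) \<uplus> slice_rest B ?J x l (Suc m)"
      have E: "ideal (colon ?E y) R" by (rule colon_ideal[OF id yc])
      have "Q (m + l) \<subseteq> colon (Q (Suc m + l)) y" using Cons(4)[of y "m + l"] y by simp
      then have 1: "Q (m + l) \<subseteq> colon ?E y" using sum_upper1[OF Cons(3) ri] unfolding colon_def by blast
      have "(PIdl y) \<cdot> slice_rest B ?J x l m \<subseteq> slice_rest B ?J x l (Suc m)"
      proof (cases m)
        case 0
        then show ?thesis
          using ideal_prod_zero[OF cgenideal_ideal[OF yc]] ideal_zero_mem[OF ri[of l "Suc 0"]] by (simp add: slice_rest_def)
      next
        case (Suc j)
        have Jj: "ideal (?J \<up> j) R" by (rule ideal_pow_ideal[OF J])
        have "(PIdl y) \<cdot> ((PIdl (x [^] Suc l)) \<cdot> (?J \<up> j \<cdot> B)) =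
          (PIdl (x [^] Suc l)) \<cdot> ((PIdl y) \<cdot> (?J \<up> j \<cdot> B))"
          by (rule prod_left_commute[OF cgenideal_ideal[OF yc] P JB])
        also have "(PIdl y) \<cdot> (?J \<up> j \<cdot> B) \<subseteq> ?J \<cdot> (?J \<up> j \<cdot> B)"
          using PIdl_le_iff[OF J yc] yJ by (intro prod_mono order_refl) blast
        also have "?J \<cdot> (?J \<up> j \<cdot> B) = ?J \<up> (Suc j) \<cdot> B"
          unfolding ideal_pow_Suc[OF J] by (rule ideal_prod_assoc[OF J Jj B, symmetric])
        finally show ?thesis using Suc by (simp add: slice_rest_def prod_mono del: Group.nat_pow_Suc adjoin.simps)
      qed
      then have "(PIdl y) \<cdot> slice_rest B ?J x l m \<subseteq> ?E"
        using sum_upper2[OF Cons(3)[of "Suc m + l"] ri[of l "Suc m"]] by blast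
      then have 2: "slice_rest B ?J x l m \<subseteq> colon ?E y" using smul_le_iff[OF yc ri] by blast
      have "x [^] l \<otimes> a \<in> colon ?E y" using a(2) sum_le_iff[OF Cons(3) ri E] 1 2 by blast
      then have "y \<otimes> (x [^] l \<otimes> a) \<in> ?E" by (simp add: colon_def)
      moreover have "y \<otimes> (x [^] l \<otimes> a) = x [^] l \<otimes> (y \<otimes> a)" using xk yc a(1) by (intro m_lcomm)
      ultimately have "y \<otimes> a \<in> slice B ?J x Q l (Suc m)"
        using a(1) yc by (simp only: slice_def colon_def mem_Collect_eq m_closed)
      then show "a \<in> colon (slice B ?J x Q l (Suc m)) y" using a(1) by (simp only: colon_def mem_Collect_eq)
    qed
  qed
  ultimately show ?case unfolding uv by (simp del: adjoin.simps)
qed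

text \<open>
  The Hilbert-Serre theorem for the graded module with pieces \<open>J\<^sup>n B / Q n\<close>, where \<open>J\<close> is generated
  by \<open>xs\<close>.
\<close>

theorem graded_len_eventually_poly:
  assumes B: "ideal B R" and xs: "set xs \<subseteq> carrier R" and Q: "\<And>n. ideal (Q n) R"
    and "\<And>x n. x \<in> set xs \<Longrightarrow> Q n \<subseteq> colon (Q (Suc n)) x"
    and f: "\<And>n. len (Q n) (Q n \<uplus> (adjoin {\<zero>} xs) \<up> n \<cdot> B) = enat (f n)"
  shows "eventually_poly (length xs) (\<lambda>n. int (f n))"
proof -
  define h where "h u = the_enat (monomial_len B xs Q u)" for u
  have fin: "monomial_len B xs Q u = enat (h u)" if "length u = length xs" for u
  proof -
    have "monomial_len B xs Q u \<le> enat (f (sum_list u))"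
      using simplex_sum_ge[of u "length xs" "monomial_len B xs Q"] that
      unfolding len_graded_piece[OF B xs Q, symmetric] f by simp
    then obtain k where "monomial_len B xs Q u = enat k" using enat_ile by blast
    then show ?thesis by (simp add: h_def)
  qed
  have "enat (f n) = enat (simplex_sum (length xs) h n)" for n
  proof -
    have "enat (f n) = simplex_sum (length xs) (monomial_len B xs Q) n"
      unfolding len_graded_piece[OF B xs Q, symmetric] f ..
    also have "\<dots> = simplex_sum (length xs) (\<lambda>u. enat (h u)) n" using fin by (rule simplex_sum_cong)
    finally show ?thesis unfolding simplex_sum_enat .
  qed
  then have "(\<lambda>n. int (f n)) = simplex_sum (length xs) (\<lambda>u. int (h u))" by (simp add: simplex_sum_int fun_eq_iff)
  moreover have "h v \<le> h u" if "list_all2 (\<le>) u v" "length u = length xs" for u v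
  proof -
    have "length v = length xs" using that list_all2_lengthD by fastforce
    then show ?thesis using monomial_len_antitone[where Q = Q, OF B xs Q assms(4) that] fin that(2) by simp
  qed
  ultimately show ?thesis using eventually_poly_antitone[of "length xs" h] by simp
qed

end

section \<open>The first two coefficients of the Hilbert polynomial\<close>

text \<open>
  The factor \<open>(1 + r / n)\<^sup>d\<close> tends to \<open>1\<close>.
\<close>

lemma limit_shift_ratio:
  fixes f :: "nat \<Rightarrow> real"
  assumes "(\<lambda>n. f n / real n ^ d) \<longlonglongrightarrow> L"
  shows "(\<lambda>n. f (n + r) / real n ^ d) \<longlonglongrightarrow> L"
proof -
  have "(\<lambda>n. f (n + r) / real (n + r) ^ d) \<longlonglongrightarrow> L"
    using LIMSEQ_ignore_initial_segment[OF assms, of r] by simp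
  moreover have "(\<lambda>n. (1 + real r / real n) ^ d) \<longlonglongrightarrow> (1 + 0) ^ d"
    by (intro tendsto_power tendsto_add tendsto_const lim_const_over_n)
  ultimately have "(\<lambda>n. f (n + r) / real (n + r) ^ d * (1 + real r / real n) ^ d) \<longlonglongrightarrow> L * (1 + 0) ^ d"
    by (rule tendsto_mult)
  then have "(\<lambda>n. f (n + r) / real (n + r) ^ d * (1 + real r / real n) ^ d) \<longlonglongrightarrow> L" by simp
  moreover have "eventually (\<lambda>n. f (n + r) / real (n + r) ^ d * (1 + real r / real n) ^ d = f (n + r) / real n ^ d) sequentially"
    unfolding eventually_sequentially
  proof (intro exI[of _ 1] allI impI)
    fix n :: nat assume n: "1 \<le> n"
    have "1 + real r / real n = real (n + r) / real n" using n by (simp add: field_simps)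
    then show "f (n + r) / real (n + r) ^ d * (1 + real r / real n) ^ d = f (n + r) / real n ^ d"
      using n by (simp add: power_divide)
  qed
  ultimately show ?thesis by (rule Lim_transform_eventually)
qed

lemma hilbert_basis_limit_Suc: "(\<lambda>n. real (hilbert_basis i (Suc n)) / real n ^ i) \<longlonglongrightarrow> 1 / fact i"
  using limit_shift_ratio[OF hilbert_basis_limit[of i], of 1] by simp

lemma hilbert_basis_limit_zero: "(\<lambda>n. real (hilbert_basis i (Suc n)) / real n ^ Suc i) \<longlonglongrightarrow> 0"
proof -
  have "(\<lambda>n. real (hilbert_basis i (Suc n)) / real n ^ i * (1 / real n)) \<longlonglongrightarrow> 1 / fact i * 0"
    by (intro tendsto_mult hilbert_basis_limit_Suc lim_const_over_n)
  then show ?thesis by (simp add: field_simps)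
qed

text \<open>
  Both bounds have leading term \<open>j\<close> times that of the basis polynomial, and a shift of the argument
  does not change the leading term.
\<close>

lemma hilbert_leading_coeff:
  fixes a :: "nat \<Rightarrow> int" and c :: "nat \<Rightarrow> nat"
  assumes c: "eventually (\<lambda>n. int (c n) = (\<Sum>i\<le>Suc e. a i * int (hilbert_basis i n))) sequentially"
    and upper: "\<And>n. c n \<le> j * hilbert_basis (Suc e) n + k * hilbert_basis e (Suc n)"
    and lower: "\<And>n. j * hilbert_basis (Suc e) n \<le> c (n + r)"
  shows "a (Suc e) = int j"
proof -
  let ?F = "fact (Suc e) :: real"
  have "eventually (\<lambda>n. real_of_int (\<Sum>i\<le>Suc e. a i * int (hilbert_basis i n)) / real n ^ Suc e = real (c n) / real n ^ Suc e) sequentially"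
    using c by (rule eventually_mono) (metis of_int_of_nat_eq)
  with hilbert_sum_limit[of a "Suc e"]
  have C: "(\<lambda>n. real (c n) / real n ^ Suc e) \<longlonglongrightarrow> real_of_int (a (Suc e)) / ?F"
    by (rule Lim_transform_eventually)
  have "(\<lambda>n. real j * (real (hilbert_basis (Suc e) n) / real n ^ Suc e) + real k * (real (hilbert_basis e (Suc n)) / real n ^ Suc e))
      \<longlonglongrightarrow> real j * (1 / ?F) + real k * 0"
    by (intro tendsto_add tendsto_mult tendsto_const hilbert_basis_limit hilbert_basis_limit_zero)
  then have U: "(\<lambda>n. real (j * hilbert_basis (Suc e) n + k * hilbert_basis e (Suc n)) / real n ^ Suc e) \<longlonglongrightarrow> real j / ?F"
    by (simp add: add_divide_distrib)
  have "real_of_int (a (Suc e)) / ?F \<le> real j / ?F"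
    by (rule LIMSEQ_le[OF C U]) (use upper in \<open>auto intro!: exI[of _ 0] divide_right_mono simp del: of_nat_add of_nat_mult\<close>)
  moreover have L: "(\<lambda>n. real (j * hilbert_basis (Suc e) n) / real n ^ Suc e) \<longlonglongrightarrow> real j / ?F"
    using tendsto_mult[OF tendsto_const hilbert_basis_limit[of "Suc e"], of "real j"] by simp
  have "real j / ?F \<le> real_of_int (a (Suc e)) / ?F"
    by (rule LIMSEQ_le[OF L limit_shift_ratio[OF C, of r]])
      (use lower in \<open>auto intro!: exI[of _ 0] divide_right_mono simp del: of_nat_add of_nat_mult\<close>)
  ultimately have "real_of_int (a (Suc e)) = real j" by (simp add: divide_le_cancel)
  then show ?thesis by (metis of_int_eq_iff of_int_of_nat_eq)
qed

lemma hilbert_second_coeff_limit: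
  fixes a :: "nat \<Rightarrow> int" and c :: "nat \<Rightarrow> nat"
  assumes c: "eventually (\<lambda>n. int (c n) = (\<Sum>i\<le>Suc e. a i * int (hilbert_basis i n))) sequentially"
  shows "(\<lambda>n. (real (c n) - real_of_int (a (Suc e)) * real (hilbert_basis (Suc e) n)) / real n ^ e) \<longlonglongrightarrow> real_of_int (a e) / fact e"
proof -
  have "eventually (\<lambda>n. real_of_int (\<Sum>i\<le>e. a i * int (hilbert_basis i n)) / real n ^ e
      = (real (c n) - real_of_int (a (Suc e)) * real (hilbert_basis (Suc e) n)) / real n ^ e) sequentially"
    using c
  proof (rule eventually_mono)
    fix n assume "int (c n) = (\<Sum>i\<le>Suc e. a i * int (hilbert_basis i n))"
    then have "real_of_int (int (c n)) = real_of_int (\<Sum>i\<le>Suc e. a i * int (hilbert_basis i n))" by simp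
    then show "real_of_int (\<Sum>i\<le>e. a i * int (hilbert_basis i n)) / real n ^ e
      = (real (c n) - real_of_int (a (Suc e)) * real (hilbert_basis (Suc e) n)) / real n ^ e" by simp
  qed
  with hilbert_sum_limit[of a e] show ?thesis by (rule Lim_transform_eventually)
qed

context noetherian_local_ring begin

lemma open_len: "open_ideal A \<Longrightarrow> len A (carrier R) = enat (colength R A)"
  using open_ideal_finite_len colength_eq open_idealD by metis

lemma len_open_pair:
  assumes "open_ideal A" "ideal B R" "A \<subseteq> B"
  shows "len A B = enat (colength R A - colength R B)" "colength R B \<le> colength R A"
proof -
  have B: "open_ideal B" by (rule open_ideal_mono[OF assms])
  have "enat (colength R A) = len A B + enat (colength R B)"
    using len_add[OF open_idealD[OF assms(1)] assms(2) oneideal assms(3) ideal_carrier_subset[OF assms(2)]]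
    unfolding open_len[OF assms(1)] open_len[OF B] .
  then show "len A B = enat (colength R A - colength R B)" "colength R B \<le> colength R A"
    by (cases "len A B"; simp)+
qed

lemma colength_eqD:
  assumes "open_ideal A" "ideal B R" "A \<subseteq> B" "colength R A = colength R B" shows "A = B"
  using len_eq_0D[OF open_idealD[OF assms(1)] assms(2,3)] len_open_pair(1)[OF assms(1-3)] assms(4)
  by (simp add: zero_enat_def)

lemma colength_m: "colength R \<mm> = 1"
  by (rule colength_eq) (simp_all add: len_m one_enat_def)

context
  fixes J :: "'a set" and xs :: "'a list" and e :: nat
  assumes J: "J = adjoin {\<zero>} xs" "set xs \<subseteq> \<mm>" "regular_mod {\<zero>} xs" "length xs = Suc e" "open_ideal J"
begin

text \<open>
  \<open>hilbert_basis e (Suc n)\<close> is the number of monomials of degree \<open>n\<close> in \<open>e + 1\<close> variables.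
\<close>

lemma len_param_pow:
  assumes "ideal K R" "J \<subseteq> K"
  shows "len (K \<cdot> J \<up> n) (J \<up> n) = enat (colength R K * hilbert_basis e (Suc n))"
proof -
  have xs: "set xs \<subseteq> carrier R" using J(2) ideal_carrier_subset[OF m_ideal] by blast
  have "open_ideal K" by (rule open_ideal_mono[OF J(5) assms])
  then have "len (K \<cdot> J \<up> n) (J \<up> n) = enat (colength R K * ((n + length xs - 1) choose n))"
    using len_regular_pow[OF xs J(3) assms(1), of "colength R K" n] assms(2) open_len unfolding J(1) by simp
  also have "(n + length xs - 1) choose n = hilbert_basis e (Suc n)"
    using binomial_symmetric[of n "n + e"] J(4) by (simp add: hilbert_basis_def add.commute)
  finally show ?thesis .
qed

lemma param_ideal: "ideal J R" by (rule open_idealD[OF J(5)])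

lemma colength_param_pow: "colength R (J \<up> n) = colength R J * hilbert_basis (Suc e) n"
proof (induct n)
  case 0
  have "colength R (carrier R) = 0" by (rule colength_eq[OF oneideal]) (simp add: zero_enat_def)
  then show ?case by (simp add: hilbert_basis_def)
next
  case (Suc n)
  have o: "open_ideal (J \<up> (Suc n))" by (rule open_ideal_pow[OF J(5)])
  have J': "ideal (J \<up> n) R" by (rule ideal_pow_ideal[OF param_ideal])
  have le: "J \<up> (Suc n) \<subseteq> J \<up> n" by (rule ideal_pow_antimono[OF param_ideal]) simp
  have "len (J \<up> (Suc n)) (J \<up> n) = enat (colength R J * hilbert_basis e (Suc n))"
    using len_param_pow[OF param_ideal order_refl, of n] unfolding ideal_pow_Suc[OF param_ideal] .
  then show ?case using len_open_pair[OF o J' le] Suc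
    by (simp add: hilbert_basis_diff distrib_left del: Group.nat_pow_Suc)
qed

lemma colength_prod_param_pow:
  assumes K: "ideal K R" "J \<subseteq> K"
  shows "colength R (K \<cdot> J \<up> n) = colength R J * hilbert_basis (Suc e) n + colength R K * hilbert_basis e (Suc n)"
proof -
  have J': "ideal (J \<up> n) R" by (rule ideal_pow_ideal[OF param_ideal])
  have "open_ideal K" by (rule open_ideal_mono[OF J(5) K])
  then have o: "open_ideal (K \<cdot> J \<up> n)" by (rule open_ideal_prod[OF _ open_ideal_pow[OF J(5)]])
  show ?thesis
    using len_open_pair[OF o J' prod_le2[OF K(1) J']] len_param_pow[OF K, of n] colength_param_pow[of n] by simp
qed

context
  fixes I K :: "'a set"
  assumes red: "reduction R J I" and I: "ideal I R" and K: "ideal K R" "I \<subseteq> K"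
begin

lemma JI: "J \<subseteq> I" "J \<subseteq> K" and I_open: "open_ideal I" and K_open: "open_ideal K"
  using reductionD[OF red I] K open_ideal_mono[OF J(5) I] open_ideal_mono[OF J(5) K(1)] by auto

text \<open>
  Beyond the reduction number \<open>r\<close>, the modules \<open>K I\<^sup>n / K I\<^bsup>n+1\<^esup>\<close> are the pieces of a graded
  module that is generated in one degree over the forms in the generators of \<open>J\<close>.
\<close>

lemma hilbert_function_eventually_poly:
  "eventually_poly (Suc (Suc e)) (\<lambda>n. int (colength R (K \<cdot> I \<up> n)))"
proof -
  define c where "c n = colength R (K \<cdot> I \<up> n)" for n
  have I': "ideal (I \<up> k) R" and J': "ideal (J \<up> k) R" for k
    using I param_ideal by (auto intro: ideal_pow_ideal)
  have KI: "ideal (K \<cdot> I \<up> k) R" for k by (rule ideal_prod_is_ideal[OF K(1) I'])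
  have KIo: "open_ideal (K \<cdot> I \<up> k)" for k by (intro open_ideal_prod open_ideal_pow I_open K_open)
  obtain r where r: "\<And>m. I \<up> (r + m) = J \<up> m \<cdot> I \<up> r"
    using reductionD(3)[OF red I] by blast
  have xs: "set xs \<subseteq> carrier R" using J(2) ideal_carrier_subset[OF m_ideal] by blast
  have piece: "J \<up> n \<cdot> (K \<cdot> I \<up> r) = K \<cdot> I \<up> (r + n)" for n
    unfolding r by (rule prod_left_commute[OF J' K(1) I'])
  have le: "K \<cdot> I \<up> (Suc n) \<subseteq> K \<cdot> I \<up> n" for n
    by (intro prod_mono order_refl ideal_pow_antimono I) simp
  have "eventually_poly (length xs) (\<lambda>n. int (c (Suc (r + n)) - c (r + n)))"
  proof (rule graded_len_eventually_poly[OF KI[of r] xs])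
    fix n
    show "ideal (K \<cdot> I \<up> (Suc (r + n))) R" by (rule KI)
    show "len (K \<cdot> I \<up> (Suc (r + n))) (K \<cdot> I \<up> (Suc (r + n)) \<uplus>
        (adjoin {\<zero>} xs) \<up> n \<cdot> (K \<cdot> I \<up> r)) = enat (c (Suc (r + n)) - c (r + n))"
      unfolding J(1)[symmetric] piece sum_absorb2[OF KI KI le] c_def by (rule len_open_pair(1)[OF KIo KI le])
    fix x assume x: "x \<in> set xs"
    have xc: "x \<in> carrier R" using x xs by blast
    have "x \<in> I" using x adjoin_mem[OF zeroideal xs] JI(1) J(1) by blast
    then have "(PIdl x) \<cdot> (K \<cdot> I \<up> (Suc (r + n))) \<subseteq> I \<cdot> (K \<cdot> I \<up> (Suc (r + n)))"
      using PIdl_le_iff[OF I xc] by (intro prod_mono order_refl) blast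
    also have "\<dots> = K \<cdot> I \<up> (Suc (r + Suc n))"
      using prod_left_commute[OF I K(1) I'[of "Suc (r + n)"]]
      unfolding ideal_pow_Suc[OF I, of "Suc (r + n)", symmetric] by (simp only: add_Suc_right)
    finally show "K \<cdot> I \<up> (Suc (r + n)) \<subseteq> colon (K \<cdot> I \<up> (Suc (r + Suc n))) x"
      unfolding smul_le_iff[OF xc KI] .
  qed
  moreover have "int (c (Suc (r + n)) - c (r + n)) = int (c (Suc n + r)) - int (c (n + r))" for n
    using len_open_pair(2)[OF KIo KI le, of "r + n"] unfolding c_def by (simp add: of_nat_diff add.commute)
  ultimately have "eventually_poly (Suc (Suc e)) (\<lambda>n. int (c (n + r)))" using J(4) by simp
  then show ?thesis using eventually_poly_shift[of "Suc (Suc e)" "\<lambda>n. int (c n)" r] unfolding c_def by blast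
qed

lemma hilbert_bounds:
  shows hilbert_upper: "colength R (K \<cdot> I \<up> n) \<le> colength R J * hilbert_basis (Suc e) n + colength R K * hilbert_basis e (Suc n)"
    and hilbert_lower: "\<exists>r. \<forall>n. colength R J * hilbert_basis (Suc e) n \<le> colength R (K \<cdot> I \<up> (n + r))"
proof -
  have I': "ideal (I \<up> k) R" and J': "ideal (J \<up> k) R" for k
    using I param_ideal by (auto intro: ideal_pow_ideal)
  have o: "open_ideal (K \<cdot> J \<up> n)" by (intro open_ideal_prod open_ideal_pow J(5) K_open)
  have "K \<cdot> J \<up> n \<subseteq> K \<cdot> I \<up> n" by (intro prod_mono order_refl ideal_pow_mono param_ideal I JI)
  then show "colength R (K \<cdot> I \<up> n) \<le> colength R J * hilbert_basis (Suc e) n + colength R K * hilbert_basis e (Suc n)"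
    using len_open_pair(2)[OF o ideal_prod_is_ideal[OF K(1) I']] colength_prod_param_pow[OF K(1) JI(2)] by simp
  obtain r where r: "\<And>m. I \<up> (r + m) = J \<up> m \<cdot> I \<up> r"
    using reductionD(3)[OF red I] by blast
  have "colength R J * hilbert_basis (Suc e) n \<le> colength R (K \<cdot> I \<up> (n + r))" for n
  proof -
    have "K \<cdot> I \<up> (n + r) \<subseteq> J \<up> n"
      using prod_le2[OF K(1) I'[of "n + r"]] prod_le1[OF J' I', of n r] r[of n] by (simp add: add.commute)
    moreover have "open_ideal (K \<cdot> I \<up> (n + r))" by (intro open_ideal_prod open_ideal_pow I_open K_open)
    ultimately show ?thesis using len_open_pair(2)[OF _ J'] colength_param_pow by metis
  qed
  then show "\<exists>r. \<forall>n. colength R J * hilbert_basis (Suc e) n \<le> colength R (K \<cdot> I \<up> (n + r))" by blast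
qed

lemma g_coeffs:
  assumes dim: "krull_dim R = enat (Suc e)"
  shows g_coeff_0: "g_coeff R I K 0 = int (colength R J)"
    and g_coeff_1: "(\<lambda>n. (real (colength R (K \<cdot> I \<up> n)) - real (colength R J) * real (hilbert_basis (Suc e) n)) / real n ^ e)
      \<longlonglongrightarrow> - real_of_int (g_coeff R I K 1) / fact e"
proof -
  let ?c = "\<lambda>n. colength R (K \<cdot> I \<up> n)"
  obtain a where a: "eventually (\<lambda>n. int (?c n) = (\<Sum>i\<le>Suc e. a i * int (hilbert_basis i n))) sequentially"
    "\<And>i. i \<le> Suc e \<Longrightarrow> hilbert_coeff (Suc e) ?c i = (-1) ^ i * a (Suc e - i)"
    using hilbert_coeff_exists[OF hilbert_function_eventually_poly] by blast
  have g: "g_coeff R I K i = (-1) ^ i * a (Suc e - i)" if "i \<le> Suc e" for i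
    using a(2)[OF that] by (simp add: g_coeff_def dim)
  obtain r where r: "\<And>n. colength R J * hilbert_basis (Suc e) n \<le> ?c (n + r)" using hilbert_lower by blast
  have top: "a (Suc e) = int (colength R J)" by (rule hilbert_leading_coeff[OF a(1) hilbert_upper r])
  then show "g_coeff R I K 0 = int (colength R J)" using g[of 0] by simp
  have "real_of_int (a e) = - real_of_int (g_coeff R I K 1)" using g[of 1] by simp
  then show "(\<lambda>n. (real (?c n) - real (colength R J) * real (hilbert_basis (Suc e) n)) / real n ^ e)
      \<longlonglongrightarrow> - real_of_int (g_coeff R I K 1) / fact e"
    using hilbert_second_coeff_limit[OF a(1)] top by simp
qed

lemma g_coeff_1_of_minimal:
  assumes dim: "krull_dim R = enat (Suc e)" and eq: "K \<cdot> I = K \<cdot> J"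
  shows "g_coeff R I K 1 = - int (colength R K)"
proof -
  have I': "ideal (I \<up> k) R" and J': "ideal (J \<up> k) R" for k
    using I param_ideal by (auto intro: ideal_pow_ideal)
  have KI: "K \<cdot> I \<up> (Suc n) = K \<cdot> J \<up> (Suc n)" for n
  proof (induct n)
    case 0 then show ?case using eq by (simp add: prod_one_left I param_ideal)
  next
    case (Suc n)
    have "K \<cdot> I \<up> (Suc (Suc n)) = I \<cdot> (K \<cdot> I \<up> (Suc n))"
      unfolding ideal_pow_Suc[OF I, of "Suc n"] by (rule prod_left_commute[OF K(1) I I'])
    also have "\<dots> = I \<cdot> (K \<cdot> J \<up> (Suc n))" unfolding Suc ..
    also have "\<dots> = (K \<cdot> I) \<cdot> J \<up> (Suc n)"
      unfolding prod_left_commute[OF I K(1) J'] ideal_prod_assoc[OF K(1) I J'] ..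
    also have "\<dots> = K \<cdot> J \<up> (Suc (Suc n))"
      unfolding eq ideal_pow_Suc[OF param_ideal, of "Suc n"] by (rule ideal_prod_assoc[OF K(1) param_ideal J'])
    finally show ?case .
  qed
  have "eventually (\<lambda>n. real (colength R K) * (real (hilbert_basis e (Suc n)) / real n ^ e) =
      (real (colength R (K \<cdot> I \<up> n)) - real (colength R J) * real (hilbert_basis (Suc e) n)) / real n ^ e) sequentially"
    unfolding eventually_sequentially
  proof (intro exI[of _ 1] allI impI)
    fix n :: nat assume "1 \<le> n"
    then obtain m where "n = Suc m" by (cases n) auto
    then have "colength R (K \<cdot> I \<up> n) = colength R J * hilbert_basis (Suc e) n + colength R K * hilbert_basis e (Suc n)"
      using KI[of m] colength_prod_param_pow[OF K(1) JI(2), of n] by simp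
    then show "real (colength R K) * (real (hilbert_basis e (Suc n)) / real n ^ e) =
      (real (colength R (K \<cdot> I \<up> n)) - real (colength R J) * real (hilbert_basis (Suc e) n)) / real n ^ e"
      by simp
  qed
  moreover have "(\<lambda>n. real (colength R K) * (real (hilbert_basis e (Suc n)) / real n ^ e)) \<longlonglongrightarrow> real (colength R K) * (1 / fact e)"
    by (intro tendsto_mult tendsto_const hilbert_basis_limit_Suc)
  ultimately have "(\<lambda>n. (real (colength R (K \<cdot> I \<up> n)) - real (colength R J) * real (hilbert_basis (Suc e) n)) / real n ^ e)
      \<longlonglongrightarrow> real (colength R K) * (1 / fact e)" by (rule Lim_transform_eventually[rotated])
  then have "real (colength R K) * (1 / fact e) = - real_of_int (g_coeff R I K 1) / fact e"
    using g_coeff_1[OF dim] LIMSEQ_unique by blast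
  then have "real (colength R K) / fact e = (- real_of_int (g_coeff R I K 1)) / fact e" by (simp only: times_divide_eq_right mult_1_right)
  then have "real (colength R K) = - real_of_int (g_coeff R I K 1)" by (simp only: divide_cancel_right fact_nonzero) simp
  then have "real_of_int (g_coeff R I K 1) = - real (colength R K)" by simp
  then show ?thesis by (metis of_int_eq_iff of_int_minus of_int_of_nat_eq)
qed

text \<open>
  With \<open>A = J + K I\<close>, the quotient of \<open>K I\<^sup>n\<close> by \<open>K J\<^sup>n\<close> maps onto \<open>(K I\<^sup>n + J\<^sup>n) / J\<^sup>n\<close>, which
  contains \<open>A J\<^bsup>n-1\<^esup> / J\<^sup>n\<close>. The length of the latter is the length of \<open>A / J\<close> times the number of
  monomials of degree \<open>n - 1\<close>, by the formula for parameter ideals applied to \<open>A\<close> and to \<open>J\<close>.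
\<close>

lemma g_coeff_1_lower_bound:
  assumes dim: "krull_dim R = enat (Suc e)"
  shows "int (colength R J) - int (colength R (J \<uplus> K \<cdot> I)) \<le> g_coeff R I K 1 + int (colength R K)"
proof -
  let ?A = "J \<uplus> K \<cdot> I"
  define t where "t = colength R J - colength R ?A"
  have KIi: "ideal (K \<cdot> I) R" by (rule ideal_prod_is_ideal[OF K(1) I])
  have A: "ideal ?A R" by (rule add_ideals[OF param_ideal KIi])
  have JA: "J \<subseteq> ?A" by (rule sum_upper1[OF param_ideal KIi])
  have tA: "colength R J = colength R ?A + t" using len_open_pair(2)[OF J(5) A JA] by (simp add: t_def)
  have I': "ideal (I \<up> k) R" and J': "ideal (J \<up> k) R" for k
    using I param_ideal by (auto intro: ideal_pow_ideal)
  have bound: "colength R (K \<cdot> I \<up> n) + t * hilbert_basis e n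
      \<le> colength R J * hilbert_basis (Suc e) n + colength R K * hilbert_basis e (Suc n)" if n: "1 \<le> n" for n
  proof -
    obtain m where m: "n = Suc m" using n by (cases n) auto
    let ?KI = "K \<cdot> I \<up> n" and ?KJ = "K \<cdot> J \<up> n" and ?J = "J \<up> n"
    have KIn: "ideal ?KI R" and KJn: "ideal ?KJ R" by (auto intro: ideal_prod_is_ideal[OF K(1)] I' J')
    have KJo: "open_ideal ?KJ" by (intro open_ideal_prod open_ideal_pow J(5) K_open)
    have KJI: "?KJ \<subseteq> ?KI" by (intro prod_mono order_refl ideal_pow_mono param_ideal I JI)
    have AJ: "ideal (?A \<cdot> J \<up> m) R" by (rule ideal_prod_is_ideal[OF A J'])
    have le1: "?J \<subseteq> ?A \<cdot> J \<up> m"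
      unfolding m ideal_pow_Suc[OF param_ideal] by (intro prod_mono JA order_refl)
    have le2: "?A \<cdot> J \<up> m \<subseteq> J \<up> m" by (rule prod_le2[OF A J'])
    have "len ?J (J \<up> m) = enat (colength R J * hilbert_basis e n)"
      using len_param_pow[OF param_ideal order_refl, of m] unfolding m ideal_pow_Suc[OF param_ideal] .
    moreover have "len (?A \<cdot> J \<up> m) (J \<up> m) = enat (colength R ?A * hilbert_basis e n)"
      unfolding m by (rule len_param_pow[OF A JA])
    ultimately have "enat (colength R J * hilbert_basis e n) = len ?J (?A \<cdot> J \<up> m) + enat (colength R ?A * hilbert_basis e n)"
      using len_add[OF J' AJ J' le1 le2] by simp
    then have "enat (t * hilbert_basis e n) = len ?J (?A \<cdot> J \<up> m)"
      unfolding tA by (cases "len ?J (?A \<cdot> J \<up> m)") (simp_all add: distrib_right)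
    also have "len ?J (?A \<cdot> J \<up> m) \<le> len ?J (?J \<uplus> ?KI)"
    proof (rule len_mono[OF order_refl])
      have "(K \<cdot> I) \<cdot> J \<up> m = K \<cdot> (I \<cdot> J \<up> m)" by (rule ideal_prod_assoc[OF K(1) I J'])
      also have "\<dots> \<subseteq> K \<cdot> (I \<cdot> I \<up> m)" by (intro prod_mono order_refl ideal_pow_mono param_ideal I JI)
      also have "\<dots> = ?KI" unfolding m ideal_pow_Suc[OF I] ..
      finally show "?A \<cdot> J \<up> m \<subseteq> ?J \<uplus> ?KI"
        unfolding ideal_prod_distr(2)[OF J' param_ideal KIi] m ideal_pow_Suc[OF param_ideal, of m, symmetric]
        by (intro isum_mono order_refl)
    qed
    also have "\<dots> = len (?KI \<inter> ?J) ?KI" by (rule len_diamond[OF J' KIn])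
    also have "\<dots> \<le> len ?KJ ?KI" using KJI prod_le2[OF K(1) J'] by (intro len_mono) auto
    finally have "t * hilbert_basis e n \<le> colength R ?KJ - colength R ?KI"
      unfolding len_open_pair(1)[OF KJo KIn KJI] by simp
    then show ?thesis
      using len_open_pair(2)[OF KJo KIn KJI] colength_prod_param_pow[OF K(1) JI(2), of n] by simp
  qed
  have "- real_of_int (g_coeff R I K 1) / fact e \<le> real (colength R K) * (1 / fact e) - real t * (1 / fact e)"
  proof (rule LIMSEQ_le[OF g_coeff_1[OF dim]])
    show "(\<lambda>n. real (colength R K) * (real (hilbert_basis e (Suc n)) / real n ^ e) - real t * (real (hilbert_basis e n) / real n ^ e))
        \<longlonglongrightarrow> real (colength R K) * (1 / fact e) - real t * (1 / fact e)"
      by (intro tendsto_diff tendsto_mult tendsto_const hilbert_basis_limit_Suc hilbert_basis_limit)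
    show "\<exists>N. \<forall>n\<ge>N. (real (colength R (K \<cdot> I \<up> n)) - real (colength R J) * real (hilbert_basis (Suc e) n)) / real n ^ e
        \<le> real (colength R K) * (real (hilbert_basis e (Suc n)) / real n ^ e) - real t * (real (hilbert_basis e n) / real n ^ e)"
    proof (intro exI[of _ 1] allI impI)
      fix n :: nat assume "1 \<le> n"
      then have "real (colength R (K \<cdot> I \<up> n) + t * hilbert_basis e n)
          \<le> real (colength R J * hilbert_basis (Suc e) n + colength R K * hilbert_basis e (Suc n))"
        using bound[of n] by (simp only: of_nat_le_iff)
      then have "real (colength R (K \<cdot> I \<up> n)) - real (colength R J) * real (hilbert_basis (Suc e) n)
          \<le> real (colength R K) * real (hilbert_basis e (Suc n)) - real t * real (hilbert_basis e n)"
        by simp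
      from divide_right_mono[OF this, of "real n ^ e"]
      show "(real (colength R (K \<cdot> I \<up> n)) - real (colength R J) * real (hilbert_basis (Suc e) n)) / real n ^ e
        \<le> real (colength R K) * (real (hilbert_basis e (Suc n)) / real n ^ e) - real t * (real (hilbert_basis e n) / real n ^ e)"
        by (simp add: diff_divide_distrib)
    qed
  qed
  then have "(- real_of_int (g_coeff R I K 1)) / fact e \<le> (real (colength R K) - real t) / fact e"
    by (simp only: times_divide_eq_right mult_1_right diff_divide_distrib)
  then have "- real_of_int (g_coeff R I K 1) \<le> real (colength R K) - real t"
    using fact_gt_zero[of e, where ?'a = real] by (simp only: divide_le_cancel)
  then have "real_of_int (int t) \<le> real_of_int (g_coeff R I K 1 + int (colength R K))" by simp
  then have "int t \<le> g_coeff R I K 1 + int (colength R K)" by (simp only: of_int_le_iff)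
  then show ?thesis using tA by simp
qed

lemma minimal_of_g_coeff_1:
  assumes dim: "krull_dim R = enat (Suc e)" and "K \<cdot> I \<inter> J = K \<cdot> J" "g_coeff R I K 1 = - int (colength R K)"
  shows "K \<cdot> I = K \<cdot> J"
proof -
  have KI: "ideal (K \<cdot> I) R" by (rule ideal_prod_is_ideal[OF K(1) I])
  have A: "ideal (J \<uplus> K \<cdot> I) R" by (rule add_ideals[OF param_ideal KI])
  have JA: "J \<subseteq> J \<uplus> K \<cdot> I" by (rule sum_upper1[OF param_ideal KI])
  have "colength R J = colength R (J \<uplus> K \<cdot> I)"
    using g_coeff_1_lower_bound[OF dim] assms(3) len_open_pair(2)[OF J(5) A JA] by simp
  then have "J = J \<uplus> K \<cdot> I" using colength_eqD[OF J(5) A JA] by simp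
  then have "K \<cdot> I \<subseteq> J" using sum_upper2[OF param_ideal KI] by simp
  then show ?thesis using assms(2) by blast
qed

end
end

section \<open>Minimal generators and minimal multiplicity\<close>

lemma len_adjoin_le:
  assumes "ideal C R" "set xs \<subseteq> carrier R" "\<And>x. x \<in> set xs \<Longrightarrow> \<mm> \<subseteq> colon C x"
  shows "len C (adjoin C xs) \<le> enat (length xs)"
  using assms
proof (induct xs arbitrary: C)
  case Nil then show ?case by (simp add: zero_enat_def)
next
  case (Cons x xs)
  have x: "x \<in> carrier R" "set xs \<subseteq> carrier R" using Cons by auto
  have P: "ideal (PIdl x) R" by (rule cgenideal_ideal[OF x(1)])
  let ?D = "C \<uplus> PIdl x"
  have D: "ideal ?D R" by (rule add_ideals[OF Cons(2) P])
  have CD: "C \<subseteq> ?D" by (rule sum_upper1[OF Cons(2) P])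
  have "len C ?D = len (carrier R \<inter> colon C x) (carrier R)"
    using len_smul[OF Cons(2) oneideal x(1)] by (simp add: ideal_prod_one P)
  also have "\<dots> \<le> len \<mm> (carrier R)"
    using Cons(4)[of x] ideal_carrier_subset[OF m_ideal] by (intro len_mono) auto
  finally have 1: "len C ?D \<le> enat 1" by (simp add: len_m one_enat_def)
  have "len ?D (adjoin ?D xs) \<le> enat (length xs)"
    by (rule Cons(1)[OF D x(2)]) (use Cons(4) CD in \<open>force simp: colon_def\<close>)
  with 1 have "len C ?D + len ?D (adjoin ?D xs) \<le> enat 1 + enat (length xs)" by (rule add_mono)
  moreover have "len C (adjoin ?D xs) = len C ?D + len ?D (adjoin ?D xs)"
    by (rule len_add[OF Cons(2) D adjoin_ideal[OF D x(2)] CD adjoin_upper[OF D x(2)]])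
  ultimately have "len C (adjoin ?D xs) \<le> enat 1 + enat (length xs)" by simp
  then show ?case by simp
qed

text \<open>
  Adding a new element of \<open>B\<close> to \<open>C\<close> raises the length by exactly one, because \<open>\<mm> B \<subseteq> C\<close>.
\<close>

lemma exists_generators_above:
  assumes "ideal B R" "ideal C R" "\<mm> \<cdot> B \<subseteq> C" "C \<subseteq> B" "len C B = enat m"
  shows "\<exists>ys. set ys \<subseteq> B \<and> length ys \<le> m \<and> B = adjoin C ys"
  using assms(2-)
proof (induct m arbitrary: C)
  case 0
  then have "C = B" using len_eq_0D[OF 0(1) assms(1)] by (simp add: zero_enat_def)
  then show ?case by (intro exI[of _ "[]"]) simp
next
  case (Suc m)
  have "C \<noteq> B" using Suc(5) by (auto simp: zero_enat_def)
  then obtain y where y: "y \<in> B" "y \<notin> C" using Suc(4) by blast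
  have yc: "y \<in> carrier R" by (rule ideal.Icarr[OF assms(1) y(1)])
  have P: "ideal (PIdl y) R" by (rule cgenideal_ideal[OF yc])
  let ?D = "C \<uplus> PIdl y"
  have D: "ideal ?D R" by (rule add_ideals[OF Suc(2) P])
  have CD: "C \<subseteq> ?D" by (rule sum_upper1[OF Suc(2) P])
  have DB: "?D \<subseteq> B" using sum_le_iff[OF Suc(2) P assms(1)] Suc(4) PIdl_le_iff[OF assms(1) yc] y(1) by blast
  have "y \<in> ?D" using sum_upper2[OF Suc(2) P] cgenideal_self[OF yc] by blast
  then have ge: "1 \<le> len C ?D" using CD y(2) by (intro len_pos Suc(2) D) blast
  have "len C B = len C ?D + len ?D B" by (rule len_add[OF Suc(2) D assms(1) CD DB])
  then have "enat (Suc m) = len C ?D + len ?D B" using Suc(5) by simp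
  then obtain k l where kl: "len C ?D = enat k" "len ?D B = enat l" "Suc m = k + l" by (cases "len C ?D"; cases "len ?D B") auto
  then have "k \<ge> 1" using ge by (simp add: one_enat_def)
  then have lm: "l \<le> m" using kl(3) by simp
  have "\<exists>ys. set ys \<subseteq> B \<and> length ys \<le> l \<and> B = adjoin ?D ys" if "l = m"
    using Suc(1)[OF D _ DB] kl(2) Suc(3) CD that by blast
  moreover have "k = 1"
  proof -
    have "len C (adjoin C [y]) \<le> enat 1"
      using len_adjoin_le[OF Suc(2), of "[y]"] yc Suc(3) y(1) by (auto simp: colon_def ideal.Icarr[OF m_ideal] m_comm subset_iff ideal_prod.prod)
    then show ?thesis using kl(1) \<open>k \<ge> 1\<close> by simp
  qed
  ultimately obtain ys where ys: "set ys \<subseteq> B" "length ys \<le> m" "B = adjoin ?D ys" using kl(3) by auto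
  then show ?case using y(1) by (intro exI[of _ "y # ys"]) simp
qed

lemma m_prod_le_colon:
  assumes "ideal B R" "x \<in> B" "\<mm> \<cdot> B \<subseteq> C" shows "\<mm> \<subseteq> colon C x"
proof
  fix m assume m: "m \<in> \<mm>"
  have car: "m \<in> carrier R" "x \<in> carrier R" using ideal.Icarr[OF m_ideal m] ideal.Icarr[OF assms(1,2)] by auto
  have "m \<otimes> x \<in> C" using assms(3) ideal_prod.prod[OF m assms(2), of R] by blast
  then show "m \<in> colon C x" using car by (simp add: colon_def m_comm[of x m])
qed

lemma len_m_prod_le:
  assumes "ideal B R" "set ys \<subseteq> carrier R" "B = adjoin {\<zero>} ys"
  shows "len (\<mm> \<cdot> B) B \<le> enat (length ys)"
proof -
  have mB: "ideal (\<mm> \<cdot> B) R" by (rule ideal_prod_is_ideal[OF m_ideal assms(1)])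
  have "adjoin (\<mm> \<cdot> B) ys = \<mm> \<cdot> B \<uplus> B" using adjoin_eq_sum[OF mB assms(2)] assms(3) by simp
  also have "\<dots> = B" by (rule sum_absorb2[OF mB assms(1) prod_le2[OF m_ideal assms(1)]])
  finally show ?thesis
    using len_adjoin_le[OF mB assms(2)] m_prod_le_colon[OF assms(1) _ order_refl]
      adjoin_mem[OF zeroideal assms(2)] unfolding assms(3)[symmetric] by (auto simp: subset_iff)
qed

text \<open>
  By Nakayama, generators modulo \<open>\<mm> I\<close> generate \<open>I\<close>.
\<close>

lemma len_min_gens:
  assumes I: "ideal I R"
  shows "len (\<mm> \<cdot> I) I = enat (min_gens R I)"
proof -
  have mI: "ideal (\<mm> \<cdot> I) R" by (rule ideal_prod_is_ideal[OF m_ideal I])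
  have mle: "\<mm> \<cdot> I \<subseteq> I" by (rule prod_le2[OF m_ideal I])
  let ?P = "\<lambda>n. \<exists>S \<subseteq> carrier R. finite S \<and> card S = n \<and> I = Idl S"
  obtain S0 where "S0 \<subseteq> carrier R" "finite S0" "I = Idl S0" using finetely_gen[OF I] by blast
  then have "?P (card S0)" by blast
  then have "?P (min_gens R I)" unfolding min_gens_def by (rule LeastI)
  then obtain S where S: "S \<subseteq> carrier R" "finite S" "card S = min_gens R I" "I = Idl S" by blast
  obtain xs where xs: "set xs = S" "length xs = card S"
    using finite_distinct_list[OF S(2)] distinct_card by metis
  have "I = adjoin {\<zero>} xs" using S(1,4) Idl_eq_adjoin[of xs] xs(1) by simp
  then have le: "len (\<mm> \<cdot> I) I \<le> enat (min_gens R I)" using len_m_prod_le[OF I, of xs] xs S by simp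
  then obtain m where m: "len (\<mm> \<cdot> I) I = enat m" using enat_ile by blast
  obtain ys where ys: "set ys \<subseteq> I" "length ys \<le> m" "I = adjoin (\<mm> \<cdot> I) ys"
    using exists_generators_above[OF I mI order_refl mle m] by blast
  have ysc: "set ys \<subseteq> carrier R" using ys(1) ideal_carrier_subset[OF I] by blast
  have Y: "ideal (adjoin {\<zero>} ys) R" by (rule adjoin_ideal[OF zeroideal ysc])
  have "I = \<mm> \<cdot> I \<uplus> adjoin {\<zero>} ys" using ys(3) adjoin_eq_sum[OF mI ysc] by (rule trans)
  then have "I \<subseteq> adjoin {\<zero>} ys \<uplus> \<mm> \<cdot> I" using sum_commute[OF mI Y] by simp
  then have "I \<subseteq> adjoin {\<zero>} ys" by (rule nakayama[OF Y I])
  moreover have "adjoin {\<zero>} ys \<subseteq> I" using adjoin_le_iff[OF zeroideal ysc I] ys(1) ideal_zero_mem[OF I] by simp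
  ultimately have "I = Idl (set ys)" using Idl_eq_adjoin[OF ysc] by simp
  then have "min_gens R I \<le> card (set ys)" unfolding min_gens_def using ysc by (intro Least_le) auto
  also have "\<dots> \<le> m" using ys(2) card_length[of ys] by simp
  finally show ?thesis using le m by simp
qed

text \<open>
  If some \<open>z \<in> \<mm> I \<inter> J\<close> were outside \<open>\<mm> J\<close>, it could be taken as one of the \<open>e + 1\<close> generators of
  \<open>J\<close>. Modulo \<open>\<mm> I\<close> the other \<open>e\<close> generators would suffice, so by Nakayama they would generate a
  reduction of \<open>I\<close>, hence \<open>J\<close> itself by minimality. But \<open>J / \<mm> J\<close> has length \<open>e + 1\<close>.
\<close>

lemma minimal_reduction_inter:
  assumes J: "J = adjoin {\<zero>} xs" "set xs \<subseteq> \<mm>" "regular_mod {\<zero>} xs" "length xs = Suc e" "open_ideal J"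
    and min: "minimal_reduction R J I" and I: "ideal I R" "I \<subseteq> \<mm>"
  shows "\<mm> \<cdot> I \<inter> J = \<mm> \<cdot> J"
proof
  have red: "reduction R J I" using min by (simp add: minimal_reduction_def)
  note Ji = reductionD(1,2)[OF red I(1)]
  have mJ: "ideal (\<mm> \<cdot> J) R" and mI: "ideal (\<mm> \<cdot> I) R"
    using ideal_prod_is_ideal[OF m_ideal] Ji I by auto
  have mJI: "\<mm> \<cdot> J \<subseteq> \<mm> \<cdot> I" by (intro prod_mono order_refl Ji)
  have mJJ: "\<mm> \<cdot> J \<subseteq> J" by (rule prod_le2[OF m_ideal Ji(1)])
  then show "\<mm> \<cdot> J \<subseteq> \<mm> \<cdot> I \<inter> J" using mJI by blast
  have Jm: "J \<subseteq> \<mm>" using Ji(2) I(2) by blast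
  have lenJ: "len (\<mm> \<cdot> J) J = enat (Suc e)"
    using len_param_pow[OF J m_ideal Jm, of 1] by (simp add: prod_one_left Ji colength_m hilbert_basis_def)
  show "\<mm> \<cdot> I \<inter> J \<subseteq> \<mm> \<cdot> J"
  proof (rule subsetI, rule ccontr)
    fix z assume z: "z \<in> \<mm> \<cdot> I \<inter> J" "z \<notin> \<mm> \<cdot> J"
    have zc: "z \<in> carrier R" using z ideal.Icarr[OF Ji(1)] by blast
    have P: "ideal (PIdl z) R" by (rule cgenideal_ideal[OF zc])
    let ?C = "\<mm> \<cdot> J \<uplus> PIdl z"
    have C: "ideal ?C R" by (rule add_ideals[OF mJ P])
    have mC: "\<mm> \<cdot> J \<subseteq> ?C" by (rule sum_upper1[OF mJ P])
    have "z \<in> ?C" using sum_upper2[OF mJ P] cgenideal_self[OF zc] by blast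
    then have ge: "1 \<le> len (\<mm> \<cdot> J) ?C" using mC z(2) by (intro len_pos mJ C) blast
    have CJ: "?C \<subseteq> J" using sum_le_iff[OF mJ P Ji(1)] mJJ PIdl_le_iff[OF Ji(1) zc] z by blast
    have "enat (Suc e) = len (\<mm> \<cdot> J) ?C + len ?C J" using len_add[OF mJ C Ji(1) mC CJ] lenJ by simp
    then obtain k where k: "len ?C J = enat k" "k \<le> e"
      using ge by (cases "len (\<mm> \<cdot> J) ?C"; cases "len ?C J") (auto simp: one_enat_def)
    obtain ys where ys: "set ys \<subseteq> J" "length ys \<le> k" "J = adjoin ?C ys"
      using exists_generators_above[OF Ji(1) C mC CJ k(1)] by blast
    have ysc: "set ys \<subseteq> carrier R" using ys(1) ideal_carrier_subset[OF Ji(1)] by blast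
    let ?W = "adjoin {\<zero>} ys"
    have W: "ideal ?W R" by (rule adjoin_ideal[OF zeroideal ysc])
    have WJ: "?W \<subseteq> J" using adjoin_le_iff[OF zeroideal ysc Ji(1)] ys(1) ideal_zero_mem[OF Ji(1)] by simp
    have "?C \<subseteq> \<mm> \<cdot> I" using sum_le_iff[OF mJ P mI] mJI PIdl_le_iff[OF mI zc] z by blast
    then have "?C \<uplus> ?W \<subseteq> \<mm> \<cdot> I \<uplus> ?W" by (intro isum_mono order_refl)
    then have JW: "J \<subseteq> ?W \<uplus> \<mm> \<cdot> I"
      using ys(3) adjoin_eq_sum[OF C ysc] sum_commute[OF mI W] by simp
    obtain n where n: "I \<up> (Suc n) = J \<cdot> I \<up> n" using red unfolding reduction_def by blast
    have I': "ideal (I \<up> l) R" for l by (rule ideal_pow_ideal[OF I(1)])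
    have WI: "ideal (?W \<cdot> I \<up> n) R" by (rule ideal_prod_is_ideal[OF W I'])
    have "I \<up> (Suc n) \<subseteq> (?W \<uplus> \<mm> \<cdot> I) \<cdot> I \<up> n" unfolding n by (intro prod_mono JW order_refl)
    also have "\<dots> = ?W \<cdot> I \<up> n \<uplus> \<mm> \<cdot> I \<up> (Suc n)"
      unfolding ideal_prod_distr(2)[OF I' W mI] ideal_prod_assoc[OF m_ideal I(1) I'] ideal_pow_Suc[OF I(1)] ..
    finally have "I \<up> (Suc n) \<subseteq> ?W \<cdot> I \<up> n" by (rule nakayama[OF WI I'])
    moreover have "?W \<cdot> I \<up> n \<subseteq> I \<up> (Suc n)" unfolding n by (intro prod_mono WJ order_refl)
    ultimately have "reduction R ?W I" unfolding reduction_def using W WJ Ji(2) by blast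
    then have "?W = J" using min WJ by (simp add: minimal_reduction_def)
    then have "len (\<mm> \<cdot> J) J \<le> enat (length ys)" using len_m_prod_le[OF Ji(1) ysc] by simp
    then show False using lenJ ys(2) k(2) by simp
  qed
qed

end

theorem proposition6p1:
  fixes R :: "('a, 'b) ring_scheme" (structure)
    and \<mm> I J K :: "'a set" and d :: nat
  assumes CM: "cohen_macaulay_local R \<mm>"
    and dim: "krull_dim R = enat d" "d > 0"
    and residue_field: "infinite (carrier (R Quot \<mm>))"
    and I: "primary_to R \<mm> I"
    and J: "minimal_reduction R J I"
    and K: "ideal K R" "I \<subseteq> K"
  shows "(minimal_multiplicity_wrt R K I \<longrightarrow> g_coeff R I K 1 = - int (colength R K)) \<and>
    (K \<cdot> I \<inter> J = K \<cdot> J \<and> g_coeff R I K 1 = - int (colength R K) \<longrightarrow>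
       minimal_multiplicity_wrt R K I) \<and>
    (minimal_multiplicity R I \<longleftrightarrow> g_coeff R I \<mm> 1 = - 1)"
proof -
  interpret noetherian_local_ring R \<mm> using CM by (simp add: cohen_macaulay_local_def)
  have depth: "depth R \<mm> = krull_dim R" using CM by (simp add: cohen_macaulay_local_def)
  obtain e where e: "d = Suc e" using dim(2) by (cases d) auto
  have dim': "krull_dim R = enat (Suc e)" using dim(1) e by simp
  have Io: "open_ideal I" and Im: "I \<subseteq> \<mm>" using primary_open[OF I] by auto
  have Ii: "ideal I R" by (rule open_idealD[OF Io])
  \<comment> \<open>Part (ii) concerns every minimal reduction, so the structure theorem is recorded for all of them.\<close>
  have params: "reduction R J' I \<and> ideal J' R \<and> J' \<subseteq> I \<and> open_ideal J' \<and>
      (\<exists>xs. J' = adjoin {\<zero>} xs \<and> set xs \<subseteq> \<mm> \<and> regular_mod {\<zero>} xs \<and> length xs = Suc e)"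
    if J': "minimal_reduction R J' I" for J'
  proof -
    have red: "reduction R J' I" using J' by (simp add: minimal_reduction_def)
    then show ?thesis
      using reductionD(1,2)[OF red Ii] reduction_open[OF red Io]
        minimal_reduction_regular[OF residue_field depth dim' Io Im J'] by blast
  qed
  obtain xs where xs: "J = adjoin {\<zero>} xs" "set xs \<subseteq> \<mm>" "regular_mod {\<zero>} xs" "length xs = Suc e"
    and red: "reduction R J I" and Ji: "ideal J R" "J \<subseteq> I" and Jo: "open_ideal J"
    using params[OF J] by blast
  note par = xs Jo
  have i: "g_coeff R I K 1 = - int (colength R K)" if "minimal_multiplicity_wrt R K I"
    using g_coeff_1_of_minimal[OF par red Ii K dim'] that J by (simp add: minimal_multiplicity_wrt_def)
  have ii: "minimal_multiplicity_wrt R K I"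
    if h: "K \<cdot> I \<inter> J = K \<cdot> J" "g_coeff R I K 1 = - int (colength R K)"
    unfolding minimal_multiplicity_wrt_def
  proof (intro allI impI)
    fix J' assume J': "minimal_reduction R J' I"
    obtain ys where ys: "J' = adjoin {\<zero>} ys" "set ys \<subseteq> \<mm>" "regular_mod {\<zero>} ys" "length ys = Suc e"
      and red': "reduction R J' I" and Ji': "ideal J' R" "J' \<subseteq> I" and Jo': "open_ideal J'"
      using params[OF J'] by blast
    note par' = ys Jo'
    have KIJ: "K \<cdot> I = K \<cdot> J" by (rule minimal_of_g_coeff_1[OF par red Ii K dim' h])
    have "colength R J = colength R J'"
      using g_coeff_0[OF par red Ii K dim'] g_coeff_0[OF par' red' Ii K dim'] by simp
    moreover have "J \<subseteq> K" "J' \<subseteq> K" using Ji Ji' K by auto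
    ultimately have "colength R (K \<cdot> J') = colength R (K \<cdot> J)"
      using colength_prod_param_pow[OF par K(1), of 1] colength_prod_param_pow[OF par' K(1), of 1]
      by (simp add: prod_one_left Ji Ji')
    then have "colength R (K \<cdot> J') = colength R (K \<cdot> I)" using KIJ by simp
    moreover have "K \<cdot> J' \<subseteq> K \<cdot> I" by (intro prod_mono order_refl Ji')
    moreover have "open_ideal (K \<cdot> J')" by (rule open_ideal_prod[OF open_ideal_mono[OF Io K] Jo'])
    ultimately have "K \<cdot> J' = K \<cdot> I" using ideal_prod_is_ideal[OF K(1) Ii] by (intro colength_eqD) auto
    then show "K \<cdot> I = K \<cdot> J'" by simp
  qed
  have iii: "minimal_multiplicity R I \<longleftrightarrow> g_coeff R I \<mm> 1 = - 1"
  proof -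
    have mJ: "open_ideal (\<mm> \<cdot> J)" and mI: "open_ideal (\<mm> \<cdot> I)" by (auto intro: open_ideal_prod open_ideal_m Jo Io)
    have mIi: "ideal (\<mm> \<cdot> I) R" by (rule open_idealD[OF mI])
    have le: "\<mm> \<cdot> J \<subseteq> \<mm> \<cdot> I" by (intro prod_mono order_refl Ji)
    have Jm: "J \<subseteq> \<mm>" using Ji Im by auto
    have "e_coeff R I 0 = g_coeff R I (carrier R) 0"
      unfolding e_coeff_def g_coeff_def using prod_one_left[OF ideal_pow_ideal[OF Ii]] by simp
    also have "\<dots> = int (colength R J)"
      by (rule g_coeff_0[OF par red Ii oneideal ideal_carrier_subset[OF Ii] dim'])
    finally have e0: "e_coeff R I 0 = int (colength R J)" .
    have cmJ: "colength R (\<mm> \<cdot> J) = colength R J + Suc e"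
      using colength_prod_param_pow[OF par m_ideal Jm, of 1]
      by (simp add: prod_one_left Ji colength_m hilbert_basis_def)
    have "enat (min_gens R I) = enat (colength R (\<mm> \<cdot> I) - colength R I)"
      using len_min_gens[OF Ii] len_open_pair(1)[OF mI Ii prod_le2[OF m_ideal Ii]] by simp
    then have cmI: "int (min_gens R I) = int (colength R (\<mm> \<cdot> I)) - int (colength R I)"
      using len_open_pair(2)[OF mI Ii prod_le2[OF m_ideal Ii]] by simp
    have "minimal_multiplicity R I \<longleftrightarrow> colength R (\<mm> \<cdot> J) = colength R (\<mm> \<cdot> I)"
      unfolding minimal_multiplicity_def e0 cmI using cmJ dim' by auto
    also have "\<dots> \<longleftrightarrow> \<mm> \<cdot> I = \<mm> \<cdot> J" using colength_eqD[OF mJ mIi le] by auto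
    also have "\<dots> \<longleftrightarrow> g_coeff R I \<mm> 1 = - 1"
      using g_coeff_1_of_minimal[OF par red Ii m_ideal Im dim']
        minimal_of_g_coeff_1[OF par red Ii m_ideal Im dim' minimal_reduction_inter[OF par J Ii Im]]
      by (auto simp: colength_m)
    finally show ?thesis .
  qed
  show ?thesis using i ii iii by blast
qed

end
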